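(* Let $d\ge1$, $\alpha>\frac{d-1}{2}$ and $\beta-\alpha>\frac{d-1}{2}$. Let $w:\mathcal{P}_d\to\mathrm{GL}_d$ be a measurable function such that $x=w(x)^\top w(x)$ for all $x\in\mathcal{P}_d$, and write $T_y(x):=w(y)^\top x\,w(y)$ for $x,y\in\mathcal{P}_d$. Let $x\in\mathcal{P}_d$, let $(X(n),n\ge1)$ be i.i.d. with the Beta type II distribution $\mathrm{B}^{\mathrm{II}}_d(\alpha,\beta)$, and define the Markov processes $\xi$ and $\xi'$ in $\mathcal{P}_d$ by $$\xi(0):=x,\quad \xi(n):=T_{X(n)}(I+\xi(n-1)),\qquad \xi'(0):=x,\quad\xi'(n):=T_{I+\xi'(n-1)}(X(n)),\qquad n\ge1.$$ Then the Beta type II distribution $\mathrm{B}^{\mathrm{II}}_d(\alpha,\beta-\alpha)$ is the unique $\mathcal{O}_d$-invariant stationary distribution for both processes $\xi$ and $\xi'$.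
   Context: $\mathcal{P}_d$ is the set of $d\times d$ real symmetric positive definite matrices, $\mathrm{GL}_d$ the group of invertible $d\times d$ real matrices, $\mathcal{O}_d$ the group of $d\times d$ orthogonal matrices; $|x|$ is the determinant, $\mathrm{tr}[x]$ the trace, $I$ the identity matrix. A distribution on $\mathcal{P}_d$ is $\mathcal{O}_d$-invariant if it is invariant under $x\mapsto k^\top xk$ for every $k\in\mathcal{O}_d$. $\mu(\mathrm{d}x):=|x|^{-(d+1)/2}\prod_{1\le i\le j\le d}\mathrm{d}x_{ij}$ on $\mathcal{P}_d$. For parameters $>\frac{d-1}{2}$, $\Gamma_d(\alpha):=\int_{\mathcal{P}_d}|x|^\alpha e^{-\mathrm{tr}[x]}\mu(\mathrm{d}x)$, $B_d(\alpha,\beta):=\Gamma_d(\alpha)\Gamma_d(\beta)/\Gamma_d(\alpha+\beta)$, and the matrix Beta type II distribution $\mathrm{B}^{\mathrm{II}}_d(\alpha,\beta)$ is $B_d(\alpha,\beta)^{-1}|x|^\alpha|I+x|^{-(\alpha+\beta)}\mu(\mathrm{d}x)$. *)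

theory Defs
  imports "HOL-Probability.Probability"
begin

definition PD :: "(real^'n^'n) set" where
  "PD = {A. transpose A = A \<and> (\<forall>v. v \<noteq> 0 \<longrightarrow> v \<bullet> (A *v v) > 0)}"

definition GLd :: "(real^'n^'n) set" where
  "GLd = {A. invertible A}"

abbreviation PD_space :: "(real^'n^'n) measure" where
  "PD_space \<equiv> restrict_space borel PD"

abbreviation GL_space :: "(real^'n^'n) measure" where
  "GL_space \<equiv> restrict_space borel GLd"

definition O_invariant :: "(real^'n^'n) measure \<Rightarrow> bool" where
  "O_invariant \<nu> \<longleftrightarrow>
     (\<forall>k. orthogonal_matrix k \<longrightarrow> distr \<nu> PD_space (\<lambda>x. transpose k ** x ** k) = \<nu>)"

text \<open>The measure \<open>\<Prod>\<^sub>i\<^sub>\<le>\<^sub>j dx\<^sub>i\<^sub>j\<close> on symmetric matrices: the image of Lebesgue measure on the upper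
  triangular entries. It is carried by the full matrix space, but supported on symmetric matrices.
  The linear order on the index type is only used to single out the pairs \<open>i \<le> j\<close>.\<close>

definition sym_lborel :: "(real^'n::{finite,linorder}^'n::{finite,linorder}) measure" where
  "sym_lborel = distr (\<Pi>\<^sub>M p\<in>{(i, j). i \<le> j}. lborel) borel
     (\<lambda>f. \<chi> i j. if i \<le> j then f (i, j) else f (j, i))"

definition mu :: "(real^'n::{finite,linorder}^'n::{finite,linorder}) measure" where
  "mu = density (restrict_space sym_lborel PD)
     (\<lambda>x. ennreal (det x powr (- (real CARD('n) + 1) / 2)))"

text \<open>The type argument of the next two functions carries the dimension \<open>d = CARD('n)\<close>. Both are only
  meaningful for parameters greater than \<open>(d - 1) / 2\<close>.\<close>

definition matrix_Gamma :: "'n::{finite,linorder} itself \<Rightarrow> real \<Rightarrow> real" where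
  "matrix_Gamma _ a = (LINT x|(mu :: (real^'n::{finite,linorder}^'n::{finite,linorder}) measure). det x powr a * exp (- trace x))"

definition matrix_Beta :: "'n::{finite,linorder} itself \<Rightarrow> real \<Rightarrow> real \<Rightarrow> real" where
  "matrix_Beta d a b = matrix_Gamma d a * matrix_Gamma d b / matrix_Gamma d (a + b)"

definition BetaII :: "real \<Rightarrow> real \<Rightarrow> (real^'n::{finite,linorder}^'n::{finite,linorder}) measure" where
  "BetaII a b = density mu
     (\<lambda>x. ennreal (det x powr a * det (mat 1 + x) powr (- (a + b)) / matrix_Beta TYPE('n) a b))"

definition T :: "(real^'n^'n \<Rightarrow> real^'n^'n) \<Rightarrow> real^'n^'n \<Rightarrow> real^'n^'n \<Rightarrow> real^'n^'n" where
  "T w y x = transpose (w y) ** x ** w y"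

primrec xi ::
  "(real^'n^'n \<Rightarrow> real^'n^'n) \<Rightarrow> (nat \<Rightarrow> 'w \<Rightarrow> real^'n^'n) \<Rightarrow> real^'n^'n \<Rightarrow> nat \<Rightarrow> 'w \<Rightarrow> real^'n^'n"
where
  "xi w X x 0 \<omega> = x"
| "xi w X x (Suc n) \<omega> = T w (X (Suc n) \<omega>) (mat 1 + xi w X x n \<omega>)"

primrec xi' ::
  "(real^'n^'n \<Rightarrow> real^'n^'n) \<Rightarrow> (nat \<Rightarrow> 'w \<Rightarrow> real^'n^'n) \<Rightarrow> real^'n^'n \<Rightarrow> nat \<Rightarrow> 'w \<Rightarrow> real^'n^'n"
where
  "xi' w X x 0 \<omega> = x"
| "xi' w X x (Suc n) \<omega> = T w (mat 1 + xi' w X x n \<omega>) (X (Suc n) \<omega>)"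

text \<open>Here \<open>Z x\<close> is the Markov process started at \<open>x\<close>, on the probability space \<open>M\<close> with state space
  \<open>S\<close>. The monadic bind is the law \<open>\<integral> P(Z x n \<in> \<cdot>) \<pi>(dx)\<close> at time \<open>n\<close> of the process with initial law
  \<open>\<pi>\<close>, so \<open>\<pi>\<close> is stationary iff it is the law at all times when it is the initial law.\<close>

definition stationary_distribution ::
  "'w measure \<Rightarrow> 'a measure \<Rightarrow> ('a \<Rightarrow> nat \<Rightarrow> 'w \<Rightarrow> 'a) \<Rightarrow> 'a measure \<Rightarrow> bool"
where
  "stationary_distribution M S Z \<pi> \<longleftrightarrow>
     prob_space \<pi> \<and> sets \<pi> = sets S \<and> (\<forall>n. \<pi> \<bind> (\<lambda>x. distr M S (Z x n)) = \<pi>)"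

end

theory Submission
  imports Defs
begin

text \<open>The measure \<open>mu\<close> is invariant under congruence by invertible matrices. Hence, given
  \<open>\<xi>' (n - 1) = z\<close>, the law of \<open>\<xi>' n\<close> has a strictly positive density
  \<open>p z x = det x powr \<alpha> * det (I + z) powr \<beta> * S z x\<close> with \<open>S z x\<close> proportional to
  \<open>det (I + z + x) powr - (\<alpha> + \<beta>)\<close>. As \<open>S\<close> is symmetric, the kernel \<open>p\<close> is reversible with respect to
  \<open>det z powr \<alpha> * det (I + z) powr - \<beta>\<close>, the density of \<open>BetaII \<alpha> (\<beta> - \<alpha>)\<close> up to a factor, and
  positivity makes the stationary distribution unique. If the initial law is orthogonally invariant,
  then \<open>\<xi>\<close> and \<open>\<xi>'\<close> have the same law after one step: both laws are orthogonally invariant, and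
  \<open>m\<^sup>T m\<close> and \<open>m m\<^sup>T\<close> lie on the same orbit of the orthogonal group, so averaging over the Haar measure
  makes the roles of \<open>X\<close> and \<open>I + \<xi>\<close> interchangeable.\<close>

text \<open>The obstacle is the freedom in \<open>w\<close>: replacing \<open>w y\<close> by
  \<open>u ** w y\<close>, with an orthogonal \<open>u\<close> that may vary with \<open>y\<close>,
  keeps the Gram matrix. In \<xi>' this rotation acts on the O_d-invariant innovation and disappears
  from the law of a step, so that kernel has an explicit density free of \<open>w\<close>. In \<xi>
  the rotation varies with the innovation and acts on the fixed matrix I + z, so the kernel may
  change with \<open>w\<close>, and only its average over an O_d-invariant initial law can be
  compared. The normalisation must be genuine: \<open>matrix_Gamma\<close> is a Lebesgue integral
  that would be 0 in a divergent case, so finiteness for parameters above (d - 1) / 2 is proved by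
  integrating out one diagonal entry at a time. The parameter \<beta> - \<alpha> arises from reading
  the power -\<beta> of det (I + z) as -(\<alpha> + (\<beta> - \<alpha>)). The Jacobian of a
  congruence and the invariance of the Haar measure rest on the same uniqueness argument for
  translation invariant measures.\<close>

type_synonym 'n sqmat = "((real, 'n) vec, 'n) vec"

abbreviation congr :: "real^'n^'n \<Rightarrow> real^'n^'n \<Rightarrow> real^'n^'n" where
  "congr a x \<equiv> transpose a ** x ** a"

section \<open>Symmetric positive definite matrices\<close>

lemma congr_congr: "congr b (congr a x) = congr (a ** b) x"
  by (simp add: matrix_transpose_mul matrix_mul_assoc)

lemma transpose_congr: "transpose (congr a x) = congr a (transpose x)"
  by (simp add: matrix_transpose_mul matrix_mul_assoc)

section \<open>Continuity and measurability of matrix operations\<close>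

lemma continuous_on_matrix_matrix_mult [continuous_intros]:
  fixes f :: "'a::topological_space \<Rightarrow> real^'n^'m" and g :: "'a \<Rightarrow> real^'k^'n"
  assumes "continuous_on S f" "continuous_on S g"
  shows "continuous_on S (\<lambda>x. f x ** g x)"
  unfolding matrix_matrix_mult_def by (intro continuous_intros assms)

lemma continuous_on_transpose [continuous_intros]:
  fixes f :: "'a::topological_space \<Rightarrow> real^'n^'m"
  assumes "continuous_on S f"
  shows "continuous_on S (\<lambda>x. transpose (f x))"
  unfolding transpose_def by (intro continuous_intros assms)

lemma continuous_on_det [continuous_intros]:
  fixes f :: "'a::topological_space \<Rightarrow> real^'n^'n"
  assumes "continuous_on S f"
  shows "continuous_on S (\<lambda>x. det (f x))"
  unfolding det_def by (intro continuous_intros assms)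

lemma continuous_on_trace [continuous_intros]:
  fixes f :: "'a::topological_space \<Rightarrow> real^'n^'n"
  assumes "continuous_on S f"
  shows "continuous_on S (\<lambda>x. trace (f x))"
  unfolding trace_def by (intro continuous_intros assms)

lemma borel_measurable_matrix_matrix_mult [measurable (raw)]:
  fixes f g :: "'a \<Rightarrow> real^'n^'n"
  assumes "f \<in> borel_measurable M" "g \<in> borel_measurable M"
  shows "(\<lambda>x. f x ** g x) \<in> borel_measurable M"
  by (rule borel_measurable_continuous_Pair[OF assms]) (intro continuous_intros)

lemma borel_measurable_transpose [measurable (raw)]:
  fixes f :: "'a \<Rightarrow> real^'n^'n"
  assumes "f \<in> borel_measurable M"
  shows "(\<lambda>x. transpose (f x)) \<in> borel_measurable M"
  by (rule borel_measurable_continuous_on[OF _ assms]) (intro continuous_intros)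

lemma borel_measurable_det [measurable (raw)]:
  fixes f :: "'a \<Rightarrow> real^'n^'n"
  assumes "f \<in> borel_measurable M"
  shows "(\<lambda>x. det (f x)) \<in> borel_measurable M"
  by (rule borel_measurable_continuous_on[OF _ assms]) (intro continuous_intros)

lemma borel_measurable_trace [measurable (raw)]:
  fixes f :: "'a \<Rightarrow> real^'n^'n"
  assumes "f \<in> borel_measurable M"
  shows "(\<lambda>x. trace (f x)) \<in> borel_measurable M"
  by (rule borel_measurable_continuous_on[OF _ assms]) (intro continuous_intros)

lemma borel_measurable_matrixI:
  fixes f :: "'a \<Rightarrow> real^'n^'m"
  assumes "\<And>i j. (\<lambda>x. f x $ i $ j) \<in> borel_measurable M"
  shows "f \<in> borel_measurable M"
  unfolding borel_measurable_euclidean_space[of f]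
  using assms by (auto simp: Basis_vec_def inner_axis)

section \<open>The cone of positive definite matrices\<close>

lemma PD_iff:
  "x \<in> PD \<longleftrightarrow> transpose x = x \<and> (\<forall>v. v \<noteq> 0 \<longrightarrow> v \<bullet> (x *v v) > 0)"
  by (simp add: PD_def)

lemma PD_mat_1: "mat 1 \<in> PD"
  by (simp add: PD_iff)

lemma transpose_add: "transpose (x + y) = transpose x + transpose (y::real^'n^'m)"
  by (simp add: transpose_def vec_eq_iff)

lemma PD_add: "x \<in> PD \<Longrightarrow> y \<in> PD \<Longrightarrow> x + y \<in> PD"
  by (auto simp: PD_iff transpose_add matrix_vector_mult_add_rdistrib inner_add_right add_pos_pos)

lemma PD_mat_1_add: "x \<in> PD \<Longrightarrow> mat 1 + x \<in> PD"
  by (simp add: PD_add PD_mat_1)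

lemma invertible_mult_nz:
  fixes a :: "real^'n^'n" and v :: "real^'n"
  assumes "invertible a" "v \<noteq> 0"
  shows "a *v v \<noteq> 0"
  using assms by (metis invertible_def matrix_left_invertible_ker)

lemma inner_congruence:
  fixes a x :: "real^'n^'n"
  shows "v \<bullet> ((congr a x) *v v) = (a *v v) \<bullet> (x *v (a *v v))"
proof -
  have "v \<bullet> ((congr a x) *v v) = v \<bullet> (transpose a *v (x *v (a *v v)))"
    by (simp add: matrix_vector_mul_assoc matrix_mul_assoc)
  then show ?thesis
    by (metis dot_lmul_matrix inner_commute transpose_matrix_vector)
qed

lemma PD_congruence:
  fixes a x :: "real^'n^'n"
  assumes "x \<in> PD" "invertible a"
  shows "congr a x \<in> PD"
  using assms unfolding PD_iff transpose_congr inner_congruence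
  by (auto simp: invertible_mult_nz)

lemma PD_congruence_iff:
  fixes a :: "real^'n^'n"
  assumes a: "invertible a"
  shows "congr a x \<in> PD \<longleftrightarrow> x \<in> PD"
proof
  assume *: "congr a x \<in> PD"
  obtain b where b: "a ** b = mat 1" "b ** a = mat 1"
    using a by (auto simp: invertible_def)
  have "congr b (congr a x) = x"
    by (simp add: congr_congr b)
  moreover have "invertible b"
    using b by (auto simp: invertible_def)
  ultimately show "x \<in> PD"
    using PD_congruence[OF *, of b] by simp
qed (simp add: PD_congruence a)

lemma PD_gram:
  fixes g :: "real^'n^'n"
  shows "invertible g \<Longrightarrow> transpose g ** g \<in> PD"
  using PD_congruence[OF PD_mat_1] by simp

lemma PD_det_nz: "x \<in> PD \<Longrightarrow> det x \<noteq> 0"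
  by (metis PD_iff inner_zero_right invertible_det_nz invertible_left_inverse less_irrefl
      matrix_left_invertible_ker)

text \<open>A determinant that vanishes nowhere on the segment from the identity to \<open>x\<close>
  cannot change sign there, and the segment stays in the convex cone \<open>PD\<close>.\<close>

lemma PD_det_pos:
  fixes x :: "real^'n^'n"
  assumes x: "x \<in> PD"
  shows "det x > 0"
proof (rule ccontr)
  assume "\<not> det x > 0"
  define h where "h t = det ((1 - t) *\<^sub>R mat 1 + t *\<^sub>R x)" for t :: real
  have "h 1 \<le> 0" "0 \<le> h 0"
    using \<open>\<not> det x > 0\<close> by (auto simp: h_def)
  moreover have "continuous_on {0..1} h"
    unfolding h_def by (intro continuous_intros)
  ultimately obtain t where t: "0 \<le> t" "t \<le> 1" "h t = 0"
    using IVT2'[of h 1 0 0] by auto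
  have "(1 - t) *\<^sub>R mat 1 + t *\<^sub>R x \<in> PD"
  proof -
    have "0 < (1 - t) * (v \<bullet> v) + t * (v \<bullet> (x *v v))" if "v \<noteq> 0" for v
    proof (cases "t = 0")
      case False
      then show ?thesis
        using t x that by (intro add_nonneg_pos) (auto simp: PD_iff)
    qed (use that in simp)
    moreover have "transpose ((1 - t) *\<^sub>R mat 1 + t *\<^sub>R x) = (1 - t) *\<^sub>R mat 1 + t *\<^sub>R x"
      using x by (simp add: PD_iff transpose_add transpose_scalar)
    ultimately show ?thesis
      by (simp add: PD_iff matrix_vector_mult_add_rdistrib inner_add_right
          scaleR_matrix_vector_assoc[symmetric])
  qed
  then show False
    using PD_det_nz t(3) by (auto simp: h_def)
qed

text \<open>By homogeneity positivity only has to be tested on the unit sphere. The matrices that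
  fail the test form the projection of a closed set along this compact sphere, hence a closed set
  \<open>?U\<close>.\<close>

lemma PD_borel [measurable]: "PD \<in> sets borel"
proof -
  let ?U = "{A :: real^'n^'n. \<exists>v. v \<in> sphere 0 1 \<and> (v, A) \<in> {p. fst p \<bullet> (snd p *v fst p) \<le> 0}}"
  have "closed {p :: (real^'n) \<times> (real^'n^'n). fst p \<bullet> (snd p *v fst p) \<le> 0}"
    unfolding matrix_vector_mult_def by (intro closed_Collect_le continuous_intros)
  then have cl: "closed ?U"
    by (intro closed_compact_projection) auto
  have "(\<forall>v. v \<noteq> 0 \<longrightarrow> v \<bullet> (A *v v) > 0) \<longleftrightarrow> A \<notin> ?U" for A :: "real^'n^'n"
  proof
    assume *: "A \<notin> ?U"
    show "\<forall>v. v \<noteq> 0 \<longrightarrow> v \<bullet> (A *v v) > 0"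
    proof safe
      fix v :: "real^'n" assume v: "v \<noteq> 0"
      then have "(v /\<^sub>R norm v) \<bullet> (A *v (v /\<^sub>R norm v)) > 0"
        using * by (auto simp: not_le simp del: inner_scaleR_left inner_scaleR_right)
      then show "v \<bullet> (A *v v) > 0"
        using v by (simp add: linear_cmul[OF matrix_vector_mul_linear] zero_less_mult_iff)
    qed
  next
    assume *: "\<forall>v. v \<noteq> 0 \<longrightarrow> v \<bullet> (A *v v) > 0"
    have "v \<noteq> 0" if "v \<in> sphere 0 1" for v :: "real^'n"
      using that by auto
    then show "A \<notin> ?U"
      using * by (auto simp: not_le simp del: mem_sphere_0)
  qed
  then have "PD = {A. transpose A = A} \<inter> - ?U"
    by (auto simp: PD_def)
  also have "\<dots> \<in> sets borel"
  proof -
    have "closed {A :: real^'n^'n. transpose A = A}"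
      by (intro closed_Collect_eq continuous_intros)
    then show ?thesis
      using cl by (intro sets.Int borel_closed borel_comp)
  qed
  finally show ?thesis .
qed

lemma orthogonal_matrix_invertible:
  fixes k :: "real^'n^'n"
  shows "orthogonal_matrix k \<Longrightarrow> invertible k"
  by (auto simp: orthogonal_matrix_def invertible_def)

lemma abs_det_orthogonal:
  fixes k :: "real^'n^'n"
  shows "orthogonal_matrix k \<Longrightarrow> \<bar>det k\<bar> = 1"
  using det_orthogonal_matrix[of k] by auto

section \<open>Lebesgue measure on symmetric matrices\<close>

text \<open>The uniqueness argument for translation invariant measures, applied to \<open>N\<close> and its image under
  \<open>L\<close>: both agree up to the factor obtained from one test function \<open>g\<close>.\<close>

lemma nn_integral_linear_ratio:
  fixes N :: "'a::euclidean_space measure" and L :: "'a \<Rightarrow> 'a"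
  assumes "sigma_finite_measure N" and N [measurable_cong]: "sets N = sets borel"
    and S: "subspace S" and AE_S: "AE x in N. x \<in> S"
    and trans: "\<And>f s. f \<in> borel_measurable borel \<Longrightarrow> s \<in> S \<Longrightarrow> (\<integral>\<^sup>+x. f (s + x) \<partial>N) = (\<integral>\<^sup>+x. f x \<partial>N)"
    and refl: "\<And>f. f \<in> borel_measurable borel \<Longrightarrow> (\<integral>\<^sup>+x. f (- x) \<partial>N) = (\<integral>\<^sup>+x. f x \<partial>N)"
    and L: "linear L" "L ` S = S"
    and f [measurable]: "f \<in> borel_measurable borel" and g [measurable]: "g \<in> borel_measurable borel"
  shows "(\<integral>\<^sup>+x. f (L x) \<partial>N) * (\<integral>\<^sup>+x. g x \<partial>N) = (\<integral>\<^sup>+x. g (L x) \<partial>N) * (\<integral>\<^sup>+x. f x \<partial>N)"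
proof -
  interpret N: sigma_finite_measure N by fact
  interpret NN: pair_sigma_finite N N ..
  have [measurable]: "L \<in> borel_measurable borel"
    using L(1) by (intro borel_measurable_continuous_onI linear_continuous_on)
      (simp add: linear_conv_bounded_linear)
  have "(\<integral>\<^sup>+x. f (L x) \<partial>N) * (\<integral>\<^sup>+x. g x \<partial>N) = (\<integral>\<^sup>+x. \<integral>\<^sup>+y. f (L x) * g y \<partial>N \<partial>N)"
    by (simp add: nn_integral_cmult nn_integral_multc)
  also have "\<dots> = (\<integral>\<^sup>+x. \<integral>\<^sup>+y. f (L x) * g (L x + y) \<partial>N \<partial>N)"
  proof (rule nn_integral_cong_AE, use AE_S in eventually_elim)
    fix x assume "x \<in> S"
    then have "L x \<in> S"
      using L by auto
    then show "(\<integral>\<^sup>+y. f (L x) * g y \<partial>N) = (\<integral>\<^sup>+y. f (L x) * g (L x + y) \<partial>N)"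
      using trans[of "\<lambda>y. f (L x) * g y" "L x"] by simp
  qed
  also have "\<dots> = (\<integral>\<^sup>+y. \<integral>\<^sup>+x. f (L x) * g (L x + y) \<partial>N \<partial>N)"
    by (rule NN.Fubini') measurable
  \<comment> \<open>Translation of \<open>x\<close> by a preimage of \<open>- y\<close> under
    \<open>L\<close> moves \<open>y\<close> from the argument of \<open>g\<close> to that of
    \<open>f\<close>.\<close>
  also have "\<dots> = (\<integral>\<^sup>+y. \<integral>\<^sup>+x. f (L x - y) * g (L x) \<partial>N \<partial>N)"
  proof (rule nn_integral_cong_AE, use AE_S in eventually_elim)
    fix y assume "y \<in> S"
    then have "- y \<in> L ` S"
      using S L by (simp add: subspace_neg)
    then obtain s where s: "s \<in> S" "L s = - y"
      by auto
    show "(\<integral>\<^sup>+x. f (L x) * g (L x + y) \<partial>N) = (\<integral>\<^sup>+x. f (L x - y) * g (L x) \<partial>N)"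
      using trans[of "\<lambda>x. f (L x) * g (L x + y)" s] s by (simp add: linear_add[OF L(1)])
  qed
  also have "\<dots> = (\<integral>\<^sup>+x. \<integral>\<^sup>+y. f (L x - y) * g (L x) \<partial>N \<partial>N)"
    by (rule NN.Fubini') measurable
  \<comment> \<open>Reflection followed by translation by \<open>L x\<close> removes
    \<open>L x\<close> from the argument of \<open>f\<close>, and the two integrals
    separate.\<close>
  also have "\<dots> = (\<integral>\<^sup>+x. \<integral>\<^sup>+y. f y * g (L x) \<partial>N \<partial>N)"
  proof (rule nn_integral_cong_AE, use AE_S in eventually_elim)
    fix x assume "x \<in> S"
    then have "L x \<in> S"
      using L by auto
    then show "(\<integral>\<^sup>+y. f (L x - y) * g (L x) \<partial>N) = (\<integral>\<^sup>+y. f y * g (L x) \<partial>N)"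
      using refl[of "\<lambda>y. f (L x + y) * g (L x)"] trans[of "\<lambda>y. f y * g (L x)" "L x"] by simp
  qed
  also have "\<dots> = (\<integral>\<^sup>+x. g (L x) \<partial>N) * (\<integral>\<^sup>+x. f x \<partial>N)"
    by (simp add: nn_integral_cmult nn_integral_multc mult.commute)
  finally show ?thesis .
qed

text \<open>Product measures are determined by boxes, and on a box the claim splits into the
  one-dimensional affine substitution in each coordinate. The constant density is the
  Jacobian.\<close>

lemma PiM_lborel_affine:
  fixes c t :: "'i \<Rightarrow> real"
  assumes I: "finite I" and c: "\<And>i. i \<in> I \<Longrightarrow> c i \<noteq> 0"
  shows "density (distr (\<Pi>\<^sub>M i\<in>I. lborel) (\<Pi>\<^sub>M i\<in>I. lborel) (\<lambda>y. \<lambda>i\<in>I. t i + c i * y i))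
      (\<lambda>_. \<Prod>i\<in>I. ennreal \<bar>c i\<bar>) = (\<Pi>\<^sub>M i\<in>I. lborel)" (is "density ?D _ = ?P")
proof -
  interpret product_sigma_finite "\<lambda>_::'i. lborel :: real measure" ..
  show ?thesis
  proof (rule PiM_eqI)
    fix A :: "'i \<Rightarrow> real set" assume A: "\<And>i. i \<in> I \<Longrightarrow> A i \<in> sets lborel"
    let ?T = "\<lambda>y. \<lambda>i\<in>I. t i + c i * y i"
    have T [measurable]: "?T \<in> ?P \<rightarrow>\<^sub>M ?P"
      by measurable
    have PA: "Pi\<^sub>E I A \<in> sets ?P"
      using A I by (intro sets_PiM_I_finite) auto
    have B: "(\<lambda>x. t i + c i * x) -` A i \<in> sets lborel" if "i \<in> I" for i
    proof -
      have "(\<lambda>x. t i + c i * x) \<in> lborel \<rightarrow>\<^sub>M lborel" by measurable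
      from measurable_sets[OF this A[OF that]] show ?thesis by simp
    qed
    have "emeasure ?D (Pi\<^sub>E I A) = emeasure ?P (?T -` Pi\<^sub>E I A \<inter> space ?P)"
      by (intro emeasure_distr T PA)
    also have "?T -` Pi\<^sub>E I A \<inter> space ?P = Pi\<^sub>E I (\<lambda>i. (\<lambda>x. t i + c i * x) -` A i)"
      by (auto simp: space_PiM PiE_iff)
    also have "emeasure ?P \<dots> = (\<Prod>i\<in>I. emeasure lborel ((\<lambda>x. t i + c i * x) -` A i))"
      using B I by (intro emeasure_PiM) auto
    finally have D: "emeasure ?D (Pi\<^sub>E I A) = \<dots>" .
    have "emeasure (density ?D (\<lambda>_. \<Prod>i\<in>I. ennreal \<bar>c i\<bar>)) (Pi\<^sub>E I A) =
        (\<Prod>i\<in>I. ennreal \<bar>c i\<bar>) * emeasure ?D (Pi\<^sub>E I A)"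
      using PA by (subst emeasure_density) (auto simp: nn_integral_cmult_indicator)
    also have "\<dots> = (\<Prod>i\<in>I. ennreal \<bar>c i\<bar> * emeasure lborel ((\<lambda>x. t i + c i * x) -` A i))"
      by (simp add: D prod.distrib)
    also have "\<dots> = (\<Prod>i\<in>I. emeasure lborel (A i))"
    proof (rule prod.cong)
      fix i assume i: "i \<in> I"
      have "emeasure lborel (A i) = ennreal \<bar>c i\<bar> * (\<integral>\<^sup>+x. indicator (A i) (t i + c i * x) \<partial>lborel)"
        using A[OF i] c[OF i] by (subst nn_integral_real_affine[symmetric]) auto
      also have "(\<integral>\<^sup>+x. indicator (A i) (t i + c i * x) \<partial>lborel) =
          (\<integral>\<^sup>+x. indicator ((\<lambda>x. t i + c i * x) -` A i) x \<partial>lborel)"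
        by (intro nn_integral_cong) (auto split: split_indicator)
      finally show "ennreal \<bar>c i\<bar> * emeasure lborel ((\<lambda>x. t i + c i * x) -` A i) = emeasure lborel (A i)"
        using B[OF i] by simp
    qed simp
    finally show "emeasure (density ?D (\<lambda>_. \<Prod>i\<in>I. ennreal \<bar>c i\<bar>)) (Pi\<^sub>E I A) =
        (\<Prod>i\<in>I. emeasure lborel (A i))" .
  qed (use I in auto)
qed

section \<open>Coordinates on the symmetric matrices\<close>

abbreviation upper :: "('n::{finite,linorder} \<times> 'n) set" where
  "upper \<equiv> {(i, j). i \<le> j}"

definition sym_of :: "('n::{finite,linorder} \<times> 'n \<Rightarrow> real) \<Rightarrow> 'n sqmat" where
  "sym_of f = (\<chi> i j. if i \<le> j then f (i, j) else f (j, i))"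

abbreviation PiU :: "('n::{finite,linorder} \<times> 'n \<Rightarrow> real) measure" where
  "PiU \<equiv> (\<Pi>\<^sub>M p\<in>upper. lborel)"

lemma sym_of_measurable [measurable]:
  "(sym_of :: _ \<Rightarrow> 'n::{finite,linorder} sqmat) \<in> PiU \<rightarrow>\<^sub>M borel"
proof (rule borel_measurable_matrixI)
  fix i j :: 'n
  show "(\<lambda>f. (sym_of f :: 'n sqmat) $ i $ j) \<in> borel_measurable PiU"
    by (cases "i \<le> j") (auto simp: sym_of_def)
qed

lemma sym_lborel_eq: "sym_lborel = distr PiU borel sym_of"
  by (simp add: sym_lborel_def flip: sym_of_def)

lemma sets_sym_lborel [simp, measurable_cong]: "sets sym_lborel = sets borel"
  by (simp add: sym_lborel_eq)

lemma space_sym_lborel [simp]: "space sym_lborel = UNIV"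
  by (simp add: sym_lborel_eq)

lemma nn_integral_sym_lborel:
  fixes f :: "'n::{finite,linorder} sqmat \<Rightarrow> ennreal"
  assumes "f \<in> borel_measurable borel"
  shows "(\<integral>\<^sup>+x. f x \<partial>sym_lborel) = (\<integral>\<^sup>+y. f (sym_of y) \<partial>PiU)"
  unfolding sym_lborel_eq using assms by (intro nn_integral_distr) auto

lemma AE_sym_lborel:
  "AE x in (sym_lborel :: ('n::{finite,linorder} sqmat) measure). transpose x = x"
proof -
  have [measurable]: "{x::'n sqmat. transpose x = x} \<in> sets borel"
    by (intro borel_closed closed_Collect_eq continuous_intros)
  have *: "transpose (sym_of y) = (sym_of y :: 'n sqmat)" for y
    by (auto simp: sym_of_def transpose_def vec_eq_iff)
  show ?thesis
    unfolding sym_lborel_eq by (subst AE_distr_iff) (auto simp: *)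
qed

text \<open>In the coordinates on \<open>upper\<close> the map acts on each coordinate alone; the
  symmetry of \<open>s\<close> and \<open>c\<close> keeps the images symmetric. Constant
  \<open>c\<close> equal to 1 or -1 gives translations and the reflection, products of diagonal
  entries give diagonal congruences.\<close>

lemma nn_integral_sym_lborel_affine:
  fixes c :: "'n::{finite,linorder} \<Rightarrow> 'n \<Rightarrow> real"
  assumes c: "\<And>i j. c i j \<noteq> 0" "\<And>i j. c i j = c j i" and s: "transpose s = s"
    and f [measurable]: "f \<in> borel_measurable borel"
  shows "(\<integral>\<^sup>+x. f x \<partial>sym_lborel) =
    ennreal (\<Prod>(i, j)\<in>upper. \<bar>c i j\<bar>) * (\<integral>\<^sup>+x. f (\<chi> i j. s $ i $ j + c i j * x $ i $ j) \<partial>sym_lborel)"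
proof -
  have ss: "s $ j $ i = s $ i $ j" for i j
    using arg_cong[OF s, of "\<lambda>x. x $ i $ j"] by (simp add: transpose_def)
  let ?T = "\<lambda>y. \<lambda>p\<in>upper. s $ fst p $ snd p + c (fst p) (snd p) * y p"
  have [measurable]: "?T \<in> PiU \<rightarrow>\<^sub>M PiU" by measurable
  have "(\<integral>\<^sup>+x. f x \<partial>sym_lborel) = (\<integral>\<^sup>+y. f (sym_of y) \<partial>PiU)"
    by (simp add: nn_integral_sym_lborel)
  also have "\<dots> = (\<integral>\<^sup>+y. f (sym_of y) \<partial>density (distr PiU PiU ?T)
      (\<lambda>_. \<Prod>p\<in>upper. ennreal \<bar>c (fst p) (snd p)\<bar>))"
    by (subst PiM_lborel_affine) (auto simp: c)
  also have "\<dots> = (\<Prod>p\<in>upper. ennreal \<bar>c (fst p) (snd p)\<bar>) * (\<integral>\<^sup>+y. f (sym_of (?T y)) \<partial>PiU)"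
    by (simp add: nn_integral_density nn_integral_distr nn_integral_cmult)
  also have "(\<lambda>y. sym_of (?T y)) = (\<lambda>y. \<chi> i j. s $ i $ j + c i j * sym_of y $ i $ j)"
    using ss c(2) by (intro ext) (auto simp: sym_of_def vec_eq_iff)
  also have "(\<integral>\<^sup>+y. f (\<chi> i j. s $ i $ j + c i j * sym_of y $ i $ j) \<partial>PiU) =
     (\<integral>\<^sup>+x. f (\<chi> i j. s $ i $ j + c i j * x $ i $ j) \<partial>sym_lborel)"
  proof -
    have [measurable]: "(\<lambda>x::'n sqmat. \<chi> i j. s $ i $ j + c i j * x $ i $ j) \<in> borel_measurable borel"
      by (intro borel_measurable_continuous_onI continuous_intros)
    show ?thesis
      by (subst nn_integral_sym_lborel) measurable
  qed
  also have "(\<Prod>p\<in>upper. ennreal \<bar>c (fst p) (snd p)\<bar>) = ennreal (\<Prod>(i, j)\<in>upper. \<bar>c i j\<bar>)"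
    by (simp add: prod_ennreal case_prod_beta)
  finally show ?thesis .
qed

text \<open>Bounds on entries rather than on the norm: the preimage under \<open>sym_of\<close> is
  then a box, so its measure has a closed form.\<close>

definition cube :: "real \<Rightarrow> 'n::finite sqmat set" where
  "cube r = {x. \<forall>i j. \<bar>x $ i $ j\<bar> \<le> r}"

lemma cube_borel [measurable]: "(cube r :: 'n::finite sqmat set) \<in> sets borel"
proof -
  have "closed (cube r :: 'n sqmat set)"
    unfolding cube_def by (intro closed_Collect_all closed_Collect_le continuous_intros)
  then show ?thesis by simp
qed

lemma emeasure_sym_lborel_cube:
  assumes "0 \<le> r"
  shows "emeasure (sym_lborel :: ('n::{finite,linorder} sqmat) measure) (cube r) =
    ennreal ((2 * r) ^ card (upper :: ('n \<times> 'n) set))"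
proof -
  interpret product_sigma_finite "\<lambda>_::('n \<times> 'n). lborel :: real measure" ..
  have "emeasure (sym_lborel :: ('n::{finite,linorder} sqmat) measure) (cube r) =
    emeasure PiU ((sym_of :: _ \<Rightarrow> 'n sqmat) -` cube r \<inter> space PiU)"
    by (simp add: sym_lborel_eq emeasure_distr)
  also have "(sym_of :: _ \<Rightarrow> 'n sqmat) -` cube r \<inter> space PiU = (PiE (upper :: ('n \<times> 'n) set) (\<lambda>_. {-r..r}))"
  proof -
    have "(\<forall>i j. \<bar>(if i \<le> j then y (i, j) else y (j, i))\<bar> \<le> r) \<longleftrightarrow> (\<forall>i j. i \<le> j \<longrightarrow> \<bar>y (i, j)\<bar> \<le> r)"
      for y :: "'n \<times> 'n \<Rightarrow> real"
    proof safe
      fix i j :: 'n assume "\<forall>i j. \<bar>(if i \<le> j then y (i, j) else y (j, i))\<bar> \<le> r" "i \<le> j"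
      from this(1)[rule_format, of i j] this(2) show "\<bar>y (i, j)\<bar> \<le> r" by simp
    qed (auto simp: not_le less_imp_le)
    moreover have "\<bar>t\<bar> \<le> r \<longleftrightarrow> t \<in> {-r..r}" for t
      by auto
    ultimately show ?thesis
      by (simp add: space_PiM PiE_def cube_def sym_of_def set_eq_iff Pi_iff conj_commute
          del: atLeastAtMost_iff)
  qed
  also have "emeasure PiU \<dots> = (\<Prod>p\<in>(upper :: ('n \<times> 'n) set). ennreal (2 * r))"
    using assms by (subst emeasure_PiM) auto
  also have "\<dots> = ennreal ((2 * r) ^ card (upper :: ('n \<times> 'n) set))"
    using assms by (simp add: ennreal_power)
  finally show ?thesis .
qed

lemma norm_le_cube: "norm x \<le> r \<Longrightarrow> x \<in> cube r" for x :: "'n::finite sqmat"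
  unfolding cube_def using component_le_norm_cart Finite_Cartesian_Product.norm_nth_le by (blast intro: order_trans)

lemma bounded_cube: "bounded (cube r :: 'n::finite sqmat set)"
proof (rule boundedI)
  fix x :: "'n sqmat" assume x: "x \<in> cube r"
  have "norm x \<le> (\<Sum>i\<in>UNIV. norm (x $ i))"
    by (simp add: norm_vec_def L2_set_le_sum)
  also have "\<dots> \<le> (\<Sum>i\<in>(UNIV :: 'n set). \<Sum>j\<in>(UNIV :: 'n set). r)"
    using x by (intro sum_mono order.trans[OF norm_le_l1_cart]) (auto simp: cube_def)
  finally show "norm x \<le> (\<Sum>i\<in>(UNIV :: 'n set). \<Sum>j\<in>(UNIV :: 'n set). r)" .
qed

lemma sigma_finite_sym_lborel:
  "sigma_finite_measure (sym_lborel :: ('n::{finite,linorder} sqmat) measure)"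
proof
  have "x \<in> (\<Union>n. cube (real n))" for x :: "'n sqmat"
    using real_arch_simple[of "norm x"] norm_le_cube by blast
  then have U: "(\<Union>n. cube (real n)) = (UNIV :: 'n sqmat set)"
    by blast
  show "\<exists>A. countable A \<and> A \<subseteq> sets (sym_lborel :: 'n sqmat measure) \<and>
      \<Union> A = space (sym_lborel :: 'n sqmat measure) \<and>
      (\<forall>a\<in>A. emeasure (sym_lborel :: 'n sqmat measure) a \<noteq> \<infinity>)"
    by (intro exI[of _ "range (\<lambda>n. cube (real n))"] conjI)
      (simp_all add: U emeasure_sym_lborel_cube image_subset_iff)
qed

section \<open>Invariance of mu under congruence\<close>

lemma nn_integral_sym_lborel_translate:
  fixes s :: "'n::{finite,linorder} sqmat"
  assumes "f \<in> borel_measurable borel" "transpose s = s"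
  shows "(\<integral>\<^sup>+x. f (s + x) \<partial>sym_lborel) = (\<integral>\<^sup>+x. f x \<partial>sym_lborel)"
proof -
  have "(\<chi> i j. s $ i $ j + 1 * x $ i $ j) = s + x" for x
    by (simp add: vec_eq_iff)
  with nn_integral_sym_lborel_affine[of "\<lambda>_ _. 1" s f] assms show ?thesis
    by simp
qed

lemma nn_integral_sym_lborel_uminus:
  fixes f :: "'n::{finite,linorder} sqmat \<Rightarrow> ennreal"
  assumes "f \<in> borel_measurable borel"
  shows "(\<integral>\<^sup>+x. f (- x) \<partial>sym_lborel) = (\<integral>\<^sup>+x. f x \<partial>sym_lborel)"
proof -
  have "(\<chi> i j. (0 :: 'n sqmat) $ i $ j + (-1) * x $ i $ j) = - x" for x
    by (simp add: vec_eq_iff)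
  moreover have "transpose (0 :: 'n sqmat) = 0"
    by (simp add: transpose_def vec_eq_iff)
  ultimately show ?thesis
    using nn_integral_sym_lborel_affine[of "\<lambda>_ _. -1" 0 f] assms by simp
qed

section \<open>The Jacobian factor of a congruence\<close>

lemma matrix_add_rdistrib: "(A + B) ** C = A ** C + B ** (C :: real^'k^'n)"
  by (simp add: matrix_matrix_mult_def vec_eq_iff algebra_simps sum.distrib)

lemma linear_congruence: "linear (\<lambda>x. transpose a ** x ** (a :: real^'n^'n))"
  by (intro linearI) (simp_all add: matrix_add_ldistrib matrix_add_rdistrib
      scalar_matrix_assoc matrix_scalar_ac)

text \<open>The Jacobian of the congruence by \<open>a\<close> on symmetric matrices, kept as a
  relation: existence, uniqueness and multiplicativity are proved before the value is known.\<close>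

definition scales :: "'n::{finite,linorder} sqmat \<Rightarrow> real \<Rightarrow> bool" where
  "scales a c \<longleftrightarrow> c > 0 \<and> (\<forall>f \<in> borel_measurable borel.
     (\<integral>\<^sup>+x. f x \<partial>sym_lborel) = ennreal c * (\<integral>\<^sup>+x. f (congr a x) \<partial>sym_lborel))"

lemma scales_pos: "scales a c \<Longrightarrow> c > 0"
  by (simp add: scales_def)

lemma scalesD:
  "scales a c \<Longrightarrow> f \<in> borel_measurable borel \<Longrightarrow>
     (\<integral>\<^sup>+x. f x \<partial>sym_lborel) = ennreal c * (\<integral>\<^sup>+x. f (congr a x) \<partial>sym_lborel)"
  unfolding scales_def by blast

lemma scales_mult:
  fixes a b :: "'n::{finite,linorder} sqmat"
  assumes "scales a c" "scales b e"
  shows "scales (a ** b) (c * e)"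
  unfolding scales_def
proof (intro conjI ballI)
  fix f :: "'n sqmat \<Rightarrow> ennreal" assume [measurable]: "f \<in> borel_measurable borel"
  have "(\<integral>\<^sup>+x. f x \<partial>sym_lborel) = ennreal e * (\<integral>\<^sup>+x. f (congr b x) \<partial>sym_lborel)"
    by (rule scalesD[OF assms(2)]) measurable
  also have "(\<integral>\<^sup>+x. f (congr b x) \<partial>sym_lborel) =
      ennreal c * (\<integral>\<^sup>+x. f (congr b (congr a x)) \<partial>sym_lborel)"
    by (rule scalesD[OF assms(1)]) measurable
  also have "(\<lambda>x. congr b (congr a x)) = (\<lambda>x. congr (a ** b) x)"
    by (simp only: congr_congr)
  finally show "(\<integral>\<^sup>+x. f x \<partial>sym_lborel) =
      ennreal (c * e) * (\<integral>\<^sup>+x. f (congr (a ** b) x) \<partial>sym_lborel)"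
    using assms[THEN scales_pos] by (simp add: ennreal_mult mult_ac)
qed (use assms[THEN scales_pos] in simp)

lemma scales_mat_1: "scales (mat 1) 1"
  by (simp add: scales_def)

lemma nn_integral_cube:
  "(\<integral>\<^sup>+x. indicator (cube 1) x \<partial>(sym_lborel :: 'n::{finite,linorder} sqmat measure)) =
    ennreal (2 ^ card (upper :: ('n \<times> 'n) set))"
  using emeasure_sym_lborel_cube[of 1, where 'n='n] by simp

text \<open>The unit cube has finite positive measure \<open>G\<close>, so testing on its indicator
  determines the constant.\<close>

lemma scales_unique:
  fixes a :: "'n::{finite,linorder} sqmat"
  assumes "scales a c" "scales a e"
  shows "c = e"
proof -
  define I where "I = (\<integral>\<^sup>+x. indicator (cube 1) (congr a x) \<partial>(sym_lborel :: 'n sqmat measure))"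
  define G where "G = (2::real) ^ card (upper :: ('n \<times> 'n) set)"
  have G: "ennreal G = ennreal c * I" "ennreal G = ennreal e * I"
    unfolding I_def G_def nn_integral_cube[symmetric] by (intro scalesD assms; measurable)+
  have "G > 0" by (simp add: G_def)
  have "c > 0" "e > 0"
    using assms by (auto dest: scales_pos)
  have "I \<noteq> top"
    using G(1) \<open>c > 0\<close> by (auto simp: ennreal_mult_top)
  then obtain r where r: "I = ennreal r" "r \<ge> 0"
    by (cases I) auto
  have "G = c * r" "G = e * r"
    using G r \<open>c > 0\<close> \<open>e > 0\<close> \<open>G > 0\<close> by (simp_all flip: ennreal_mult)
  then show ?thesis
    using \<open>G > 0\<close> by auto
qed

text \<open>The ratio lemma with the indicator of the cube as second function yields the constant G
  / I, once I is known to be neither 0 nor infinite.\<close>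

lemma scales_exists:
  fixes a :: "'n::{finite,linorder} sqmat"
  assumes a: "invertible a"
  obtains c where "scales a c"
proof -
  let ?L = "\<lambda>x. congr a x" and ?S = "{x :: 'n sqmat. transpose x = x}"
  obtain b where b: "a ** b = mat 1" "b ** a = mat 1"
    using a by (auto simp: invertible_def)
  have Lb: "congr a (congr b x) = x" "congr b (congr a x) = x" for x
    by (simp_all add: congr_congr b)
  have S: "subspace ?S"
    by (auto simp: subspace_def transpose_add transpose_scalar) (simp add: transpose_def vec_eq_iff)
  have LS: "?L ` ?S = ?S"
  proof safe
    fix x :: "'n sqmat" assume "transpose x = x"
    then show "x \<in> ?L ` ?S"
      using Lb by (intro image_eqI[where x="congr b x"]) (simp_all add: transpose_congr)
  qed (simp add: transpose_congr)
  define G where "G = (2::real) ^ card (upper :: ('n \<times> 'n) set)"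
  define I where "I = (\<integral>\<^sup>+x. indicator (cube 1) (?L x) \<partial>(sym_lborel :: 'n sqmat measure))"
  have "G > 0" by (simp add: G_def)
  have ratio: "(\<integral>\<^sup>+x. f (?L x) \<partial>sym_lborel) * ennreal G = I * (\<integral>\<^sup>+x. f x \<partial>sym_lborel)"
    if "f \<in> borel_measurable borel" for f
    unfolding G_def nn_integral_cube[symmetric] I_def
    using that by (intro nn_integral_linear_ratio[OF sigma_finite_sym_lborel _ S])
      (auto simp: AE_sym_lborel nn_integral_sym_lborel_translate nn_integral_sym_lborel_uminus
        linear_congruence LS)
  \<comment> \<open>If I vanished, the ratio applied to the constant function 1 would give the whole
    space measure 0.\<close>
  have "I \<noteq> 0"
  proof
    assume "I = 0"
    then have "(\<integral>\<^sup>+x. 1 \<partial>(sym_lborel :: 'n sqmat measure)) = 0"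
      using ratio[of "\<lambda>_. 1"] \<open>G > 0\<close> by simp
    then have "emeasure (sym_lborel :: 'n sqmat measure) UNIV = 0"
      by simp
    then have "emeasure (sym_lborel :: 'n sqmat measure) (cube 1) = 0"
      by (metis emeasure_mono le_zero_eq sets.top space_sym_lborel top_greatest)
    then show False
      using zero_less_power[of "2::real" "card (upper :: ('n \<times> 'n) set)"]
      by (simp add: emeasure_sym_lborel_cube ennreal_eq_0_iff del: zero_less_power)
  qed
  \<comment> \<open>The preimage of the cube is its image under the inverse congruence, hence
    bounded and contained in a larger cube.\<close>
  have "I \<noteq> top"
  proof -
    have "bounded_linear (\<lambda>x. transpose b ** x ** b)"
      using linear_congruence by (simp add: linear_conv_bounded_linear)
    from bounded_linear_image[OF bounded_cube this, of 1]
    obtain R where R: "\<And>y. y \<in> cube 1 \<Longrightarrow> norm (transpose b ** y ** b) \<le> R"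
      unfolding bounded_iff by blast
    have "x \<in> cube \<bar>R\<bar>" if "?L x \<in> cube 1" for x
      using R[OF that] unfolding Lb by (intro norm_le_cube) linarith
    then have "I \<le> (\<integral>\<^sup>+x. indicator (cube \<bar>R\<bar>) x \<partial>(sym_lborel :: 'n sqmat measure))"
      unfolding I_def by (intro nn_integral_mono) (auto split: split_indicator)
    also have "\<dots> < top"
      by (simp add: emeasure_sym_lborel_cube)
    finally show ?thesis by simp
  qed
  with \<open>I \<noteq> 0\<close> obtain r where r: "I = ennreal r" "r > 0"
    by (cases I) (auto simp: ennreal_eq_0_iff not_le)
  have "scales a (G / r)"
    unfolding scales_def
  proof (intro conjI ballI)
    fix f :: "'n sqmat \<Rightarrow> ennreal" assume f: "f \<in> borel_measurable borel"
    have "ennreal (G / r) * (\<integral>\<^sup>+x. f (?L x) \<partial>sym_lborel) =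
        ennreal (1 / r) * ((\<integral>\<^sup>+x. f (?L x) \<partial>sym_lborel) * ennreal G)"
      using r \<open>G > 0\<close> by (simp add: mult_ac flip: ennreal_mult mult.assoc)
    also have "\<dots> = (ennreal (1 / r) * ennreal r) * (\<integral>\<^sup>+x. f x \<partial>sym_lborel)"
      unfolding ratio[OF f] r(1) by (simp add: mult.assoc)
    also have "ennreal (1 / r) * ennreal r = 1"
      using r by (simp flip: ennreal_mult)
    finally show "(\<integral>\<^sup>+x. f x \<partial>sym_lborel) = ennreal (G / r) * (\<integral>\<^sup>+x. f (?L x) \<partial>sym_lborel)"
      by simp
  qed (use r \<open>G > 0\<close> in auto)
  then show ?thesis ..
qed

text \<open>The index i is the first component of \<open>card {i..}\<close> pairs and the second
  component of \<open>card {..i}\<close> pairs; the diagonal pair counts twice, hence the exponent d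
  + 1.\<close>

lemma prod_upper:
  fixes t :: "'n::{finite,linorder} \<Rightarrow> real"
  shows "(\<Prod>(i, j)\<in>upper. t i * t j) = (\<Prod>i\<in>UNIV. t i) ^ (CARD('n) + 1)"
proof -
  have U: "upper = (SIGMA i:UNIV. {i..})" by auto
  have U': "upper = (\<lambda>(j, i). (i, j)) ` (SIGMA j:UNIV. {..j::'n})" by force
  have "(\<Prod>(i, j)\<in>upper. t i) = (\<Prod>i\<in>UNIV. t i ^ card {i..})"
    unfolding U by (subst prod.Sigma[symmetric]) auto
  moreover have "(\<Prod>(i, j)\<in>upper. t j) = (\<Prod>j\<in>UNIV. t j ^ card {..j})"
    unfolding U' using prod.Sigma[of UNIV atMost "\<lambda>j i. t j"]
    by (subst prod.reindex) (auto simp: inj_on_def case_prod_beta)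
  moreover have "card {i..} + card {..i} = CARD('n) + 1" for i :: 'n
  proof -
    have "{i..} \<union> {..i} = UNIV" "{i..} \<inter> {..i} = {i}"
      by auto
    then show ?thesis
      using card_Un_Int[of "{i..}" "{..i}"] by simp
  qed
  moreover have "(\<Prod>(i, j)\<in>upper. t i * t j) = (\<Prod>(i, j)\<in>upper. t i) * (\<Prod>(i, j)\<in>upper. t j)"
    by (simp add: case_prod_beta prod.distrib)
  ultimately have "(\<Prod>(i, j)\<in>upper. t i * t j) = (\<Prod>i\<in>UNIV. t i ^ (CARD('n) + 1))"
    by (simp only: prod.distrib[symmetric] power_add[symmetric])
  then show ?thesis
    by (simp only: prod_power_distrib)
qed

text \<open>A diagonal congruence multiplies the entry (i, j) by
  \<open>a $ i $ i * a $ j $ j\<close>, so it is one of the entrywise affine maps.\<close>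

lemma scales_diagonal:
  fixes a :: "'n::{finite,linorder} sqmat"
  assumes d: "\<And>i j. i \<noteq> j \<Longrightarrow> a $ i $ j = 0" and nz: "det a \<noteq> 0"
  shows "scales a (\<bar>det a\<bar> ^ (CARD('n) + 1))"
  unfolding scales_def
proof (intro conjI ballI)
  fix f :: "'n sqmat \<Rightarrow> ennreal" assume [measurable]: "f \<in> borel_measurable borel"
  have det: "det a = (\<Prod>i\<in>UNIV. a $ i $ i)"
    using d by (intro det_diagonal)
  with nz have t: "a $ i $ i \<noteq> 0" for i
    by auto
  have eq: "(\<chi> i j. (0 :: 'n sqmat) $ i $ j + (a $ i $ i * a $ j $ j) * x $ i $ j) = congr a x" for x
  proof -
    have "(transpose a ** x) $ i $ j = a $ i $ i * x $ i $ j" for i j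
    proof -
      have "(\<Sum>k\<in>UNIV. a $ k $ i * x $ k $ j) = (\<Sum>k\<in>{i}. a $ k $ i * x $ k $ j)"
        using d by (intro sum.mono_neutral_right) auto
      then show ?thesis
        by (simp add: matrix_matrix_mult_def transpose_def)
    qed
    moreover have "(y ** a) $ i $ j = y $ i $ j * a $ j $ j" for y :: "'n sqmat" and i j
    proof -
      have "(\<Sum>k\<in>UNIV. y $ i $ k * a $ k $ j) = (\<Sum>k\<in>{j}. y $ i $ k * a $ k $ j)"
        using d by (intro sum.mono_neutral_right) auto
      then show ?thesis
        by (simp add: matrix_matrix_mult_def)
    qed
    ultimately show ?thesis
      by (simp add: vec_eq_iff mult_ac)
  qed
  have "transpose (0 :: 'n sqmat) = 0"
    by (simp add: transpose_def vec_eq_iff)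
  then have "(\<integral>\<^sup>+x. f x \<partial>sym_lborel) = ennreal (\<Prod>(i, j)\<in>upper. \<bar>a $ i $ i * a $ j $ j\<bar>) *
      (\<integral>\<^sup>+x. f (\<chi> i j. (0 :: 'n sqmat) $ i $ j + (a $ i $ i * a $ j $ j) * x $ i $ j) \<partial>sym_lborel)"
    using t by (intro nn_integral_sym_lborel_affine) (auto simp: mult.commute)
  also have "(\<Prod>(i, j)\<in>upper. \<bar>a $ i $ i * a $ j $ j\<bar>) = \<bar>det a\<bar> ^ (CARD('n) + 1)"
    by (simp only: abs_mult prod_upper det abs_prod)
  finally show "(\<integral>\<^sup>+x. f x \<partial>sym_lborel) = ennreal (\<bar>det a\<bar> ^ (CARD('n) + 1)) *
      (\<integral>\<^sup>+x. f (congr a x) \<partial>sym_lborel)"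
    unfolding eq .
qed (use nz in simp)

lemma abs_det_involution:
  fixes a :: "real^'n^'n"
  assumes "a ** a = mat 1"
  shows "\<bar>det a\<bar> = 1"
proof -
  have "det a * det a = 1"
    using assms by (metis det_I det_mul)
  then show ?thesis
    by (metis abs_1 abs_mult_self_eq abs_square_eq_1 power2_eq_square)
qed

text \<open>The scaling factor is multiplicative. A transvection is conjugate to its square by a diagonal
  matrix and a transposition is an involution, so the factor of both is \<open>1\<close>; only diagonal matrices
  have to be computed.\<close>

theorem scales_det:
  fixes a :: "'n::{finite,linorder} sqmat"
  assumes "det a \<noteq> 0"
  shows "scales a (\<bar>det a\<bar> ^ (CARD('n) + 1))"
proof -
  have "det a \<noteq> 0 \<longrightarrow> scales a (\<bar>det a\<bar> ^ (CARD('n) + 1))"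
  proof (rule induct_matrix_elementary)
    fix A B :: "'n sqmat"
    assume "det A \<noteq> 0 \<longrightarrow> scales A (\<bar>det A\<bar> ^ (CARD('n) + 1))"
      and "det B \<noteq> 0 \<longrightarrow> scales B (\<bar>det B\<bar> ^ (CARD('n) + 1))"
    then show "det (A ** B) \<noteq> 0 \<longrightarrow> scales (A ** B) (\<bar>det (A ** B)\<bar> ^ (CARD('n) + 1))"
      using scales_mult[of A _ B] by (simp only: det_mul abs_mult power_mult_distrib) auto
  next
    fix A :: "'n sqmat" and i assume "row i A = 0"
    then show "det A \<noteq> 0 \<longrightarrow> scales A (\<bar>det A\<bar> ^ (CARD('n) + 1))"
      using det_zero_row(2)[of i A] by simp
  next
    fix A :: "'n sqmat" assume "\<And>i j. i \<noteq> j \<Longrightarrow> A $ i $ j = 0"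
    then show "det A \<noteq> 0 \<longrightarrow> scales A (\<bar>det A\<bar> ^ (CARD('n) + 1))"
      using scales_diagonal by blast
  next
    fix m n :: 'n assume "m \<noteq> n"
    define P :: "'n sqmat" where "P = (\<chi> i j. mat 1 $ i $ Transposition.transpose m n j)"
    have PP: "P ** P = mat 1"
    proof -
      have "(\<Sum>k\<in>UNIV. P $ i $ k * P $ k $ j) =
          (\<Sum>k\<in>{Transposition.transpose m n j}. P $ i $ k * P $ k $ j)" for i j
        by (intro sum.mono_neutral_right) (auto simp: P_def mat_def)
      then show ?thesis
        by (simp add: matrix_matrix_mult_def vec_eq_iff P_def mat_def)
    qed
    then have "invertible P"
      by (auto simp: invertible_def)
    then obtain c where c: "scales P c"
      by (rule scales_exists)
    have "c * c = 1"
      using scales_mult[OF c c] scales_unique[OF _ scales_mat_1] unfolding PP by blast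
    then have "c = 1"
      using scales_pos[OF c] by (metis abs_of_pos abs_square_eq_1 power2_eq_square)
    then show "det P \<noteq> 0 \<longrightarrow> scales P (\<bar>det P\<bar> ^ (CARD('n) + 1))"
      using c by (simp add: abs_det_involution[OF PP])
  next
    fix m n :: 'n and t :: real assume mn: "m \<noteq> n"
    define E :: "real \<Rightarrow> 'n sqmat" where "E t = (\<chi> i j. if i = m \<and> j = n then t else of_bool (i = j))" for t
    define D :: "real \<Rightarrow> 'n sqmat" where "D r = (\<chi> i j. if i = j then (if j = n then r else 1) else 0)" for r
    have EE: "E s ** E t = E (s + t)" for s t
    proof -
      have "(E s ** E t) $ i $ j = E (s + t) $ i $ j" for i j
      proof -
        have "(\<Sum>k\<in>UNIV. E s $ i $ k * E t $ k $ j) = (\<Sum>k\<in>{i, j}. E s $ i $ k * E t $ k $ j)"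
          using mn by (intro sum.mono_neutral_right) (auto simp: E_def split: if_splits)
        then show ?thesis
          using mn by (cases "i = j") (auto simp: E_def matrix_matrix_mult_def)
      qed
      then show ?thesis by (simp add: vec_eq_iff)
    qed
    have Dl: "(D r ** A) $ i $ j = (if i = n then r else 1) * A $ i $ j" for r A i j
    proof -
      have "(\<Sum>k\<in>UNIV. D r $ i $ k * A $ k $ j) = (\<Sum>k\<in>{i}. D r $ i $ k * A $ k $ j)"
        by (intro sum.mono_neutral_right) (auto simp: D_def)
      then show ?thesis by (simp add: D_def matrix_matrix_mult_def)
    qed
    have Dr: "(A ** D r) $ i $ j = A $ i $ j * (if j = n then r else 1)" for r A i j
    proof -
      have "(\<Sum>k\<in>UNIV. A $ i $ k * D r $ k $ j) = (\<Sum>k\<in>{j}. A $ i $ k * D r $ k $ j)"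
        by (intro sum.mono_neutral_right) (auto simp: D_def)
      then show ?thesis by (simp add: D_def matrix_matrix_mult_def)
    qed
    \<comment> \<open>Halving row n and doubling column n leaves the diagonal unchanged and doubles
      the entry at (m, n).\<close>
    have conj: "D (1 / 2) ** E t ** D 2 = E (2 * t)"
      using mn by (auto simp: vec_eq_iff Dl Dr E_def split: if_splits)
    have DD: "D (1 / 2) ** D 2 = mat 1"
      by (auto simp: vec_eq_iff Dl) (auto simp: D_def mat_def)
    have "E t ** E (- t) = mat 1" "E (- t) ** E t = mat 1"
      unfolding EE using mn by (auto simp: E_def mat_def vec_eq_iff)
    then have inv: "invertible (E t)"
      by (auto simp: invertible_def)
    then obtain c where c: "scales (E t) c"
      by (rule scales_exists)
    \<comment> \<open>The same conjugation also yields the determinant: it is nonzero and equal to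
      its square.\<close>
    have "det (E t) * det (E t) = det (D (1 / 2)) * det (E t) * det (D 2)"
      unfolding det_mul[symmetric] EE conj by simp
    also have "\<dots> = det (E t)"
      using arg_cong[OF DD, of det] by (simp add: det_mul)
    finally have det: "det (E t) = 1"
      using inv by (simp add: invertible_det_nz)
    have "invertible (D (1 / 2))" "invertible (D 2)"
      using DD by (metis invertible_def matrix_left_right_inverse)+
    then obtain p q where pq: "scales (D (1 / 2)) p" "scales (D 2) q"
      using scales_exists by metis
    have "p * q = 1"
      using scales_mult[OF pq] scales_unique[OF _ scales_mat_1] unfolding DD by blast
    have "c * c = p * c * q"
      using scales_mult[OF c c] scales_mult[OF scales_mult[OF pq(1) c] pq(2)]
      unfolding EE conj by (metis mult_2 scales_unique)
    also have "\<dots> = c"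
      using \<open>p * q = 1\<close> by (simp add: mult_ac)
    finally have "c = 1"
      using scales_pos[OF c] by simp
    then show "det (E t) \<noteq> 0 \<longrightarrow> scales (E t) (\<bar>det (E t)\<bar> ^ (CARD('n) + 1))"
      using c by (simp add: det)
  qed
  with assms show ?thesis by blast
qed

section \<open>Integration against \<open>mu\<close>\<close>

lemma sets_mu [simp, measurable_cong]: "sets mu = sets PD_space"
  by (simp add: mu_def sets_restrict_space cong: sets_restrict_space_cong)

lemma space_mu [simp]: "space mu = PD"
  by (simp add: mu_def space_restrict_space)

lemma nn_integral_mu:
  fixes f :: "'n::{finite,linorder} sqmat \<Rightarrow> ennreal"
  assumes [measurable]: "f \<in> borel_measurable PD_space"
  shows "(\<integral>\<^sup>+x. f x \<partial>mu) =
    (\<integral>\<^sup>+x. ennreal (det x powr (- (real CARD('n) + 1) / 2)) * f x * indicator PD x \<partial>sym_lborel)"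
proof -
  have f: "f \<in> borel_measurable (restrict_space sym_lborel PD)"
    using assms by (simp cong: measurable_cong_sets sets_restrict_space_cong)
  have [measurable]: "(\<lambda>x :: 'n sqmat. det x powr c) \<in> borel_measurable (restrict_space sym_lborel PD)" for c
    by (intro measurable_restrict_space1) measurable
  show ?thesis
    unfolding mu_def using f
    by (subst nn_integral_density) (auto simp: nn_integral_restrict_space)
qed

lemma restricted_measurable:
  assumes "f \<in> borel_measurable PD_space"
  shows "(\<lambda>x. f x * indicator PD x :: ennreal) \<in> borel_measurable borel"
  using assms by (subst (asm) borel_measurable_restrict_space_iff_ennreal) auto

lemma measurable_congruence:
  fixes a :: "real^'n^'n"
  assumes "invertible a"
  shows "(\<lambda>x. congr a x) \<in> PD_space \<rightarrow>\<^sub>M PD_space"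
proof (rule measurable_restrict_space2)
  show "(\<lambda>x. congr a x) \<in> borel_measurable PD_space"
    by (intro measurable_restrict_space1) measurable
qed (use assms in \<open>auto simp: space_restrict_space PD_congruence\<close>)

text \<open>The congruence multiplies det x by (det a)^2, so the weight of exponent -(d + 1) / 2
  contributes the power -(d + 1) of |det a|, which cancels the Jacobian.\<close>

theorem nn_integral_mu_congruence:
  fixes f :: "'n::{finite,linorder} sqmat \<Rightarrow> ennreal"
    and a :: "'n sqmat"
  assumes f [measurable]: "f \<in> borel_measurable PD_space" and a: "invertible a"
  shows "(\<integral>\<^sup>+x. f (congr a x) \<partial>mu) = (\<integral>\<^sup>+x. f x \<partial>mu)"
proof -
  let ?s = "- (real CARD('n) + 1) / 2" and ?L = "\<lambda>x. congr a x"
  let ?F = "\<lambda>x :: 'n sqmat. ennreal (det x powr ?s) * f x * indicator PD x"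
  have nz: "det a \<noteq> 0"
    using a by (simp add: invertible_det_nz)
  have F [measurable]: "?F \<in> borel_measurable borel"
    using restricted_measurable[OF f] by (simp add: mult.assoc)
  have fL: "(\<lambda>x. f (?L x)) \<in> borel_measurable PD_space"
    using measurable_compose[OF measurable_congruence[OF a] f] .
  have "(\<integral>\<^sup>+x. f x \<partial>mu) = (\<integral>\<^sup>+x. ?F x \<partial>sym_lborel)"
    by (rule nn_integral_mu) fact
  also have "\<dots> = ennreal (\<bar>det a\<bar> ^ (CARD('n) + 1)) * (\<integral>\<^sup>+x. ?F (?L x) \<partial>sym_lborel)"
    by (rule scalesD[OF scales_det[OF nz]]) measurable
  also have "\<dots> = (\<integral>\<^sup>+x. ennreal (\<bar>det a\<bar> ^ (CARD('n) + 1)) * ?F (?L x) \<partial>sym_lborel)"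
    by (rule nn_integral_cmult[symmetric]) measurable
  also have "\<dots> = (\<integral>\<^sup>+x. ennreal (det x powr ?s) * f (?L x) * indicator PD x \<partial>sym_lborel)"
  proof (rule nn_integral_cong)
    fix x :: "'n sqmat"
    show "ennreal (\<bar>det a\<bar> ^ (CARD('n) + 1)) * ?F (?L x) = ennreal (det x powr ?s) * f (?L x) * indicator PD x"
    proof (cases "x \<in> PD")
      case True
      have "det (?L x) = \<bar>det a\<bar> powr 2 * det x"
        using nz by (simp add: det_mul power2_eq_square)
      then have "\<bar>det a\<bar> ^ (CARD('n) + 1) * det (?L x) powr ?s =
          \<bar>det a\<bar> powr (real CARD('n) + 1) * \<bar>det a\<bar> powr (2 * ?s) * det x powr ?s"
        using nz PD_det_pos[OF True] powr_realpow[of "\<bar>det a\<bar>" "CARD('n) + 1"]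
        by (simp only: powr_mult powr_powr of_nat_add of_nat_1 mult.assoc)
      also have "\<dots> = det x powr ?s"
      proof -
        have "\<bar>det a\<bar> powr (real CARD('n) + 1) * \<bar>det a\<bar> powr (2 * ?s) = \<bar>det a\<bar> powr (real CARD('n) + 1 + 2 * ?s)"
          by (rule powr_add[symmetric])
        also have "real CARD('n) + 1 + 2 * ?s = 0" by (simp add: field_simps)
        finally show ?thesis using nz by simp
      qed
      finally have "ennreal (\<bar>det a\<bar> ^ (CARD('n) + 1)) * ennreal (det (?L x) powr ?s) = ennreal (det x powr ?s)"
        by (simp flip: ennreal_mult)
      then show ?thesis
        using True a by (simp add: PD_congruence_iff flip: mult.assoc)
    qed (use a in \<open>simp add: PD_congruence_iff\<close>)
  qed
  also have "\<dots> = (\<integral>\<^sup>+x. f (?L x) \<partial>mu)"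
    by (rule nn_integral_mu[OF fL, symmetric])
  finally show ?thesis ..
qed

section \<open>Stationary laws of kernels with positive densities\<close>

text \<open>Let \<open>m\<close> be the minimum of the two invariant densities. \<open>P m\<close>
  lies below both, hence below \<open>m\<close>, and has the same mass, so \<open>m\<close> is
  invariant. If \<open>f - m\<close> had positive mass, so would \<open>g - m\<close>, and
  positivity of \<open>p\<close> would make both positive almost everywhere, while at each point one
  of them vanishes.\<close>

lemma unique_invariant_density:
  fixes p :: "'a \<Rightarrow> 'a \<Rightarrow> ennreal"
  assumes "sigma_finite_measure N"
    and p [measurable]: "case_prod p \<in> borel_measurable (N \<Otimes>\<^sub>M N)"
    and pos: "\<And>x y. x \<in> space N \<Longrightarrow> y \<in> space N \<Longrightarrow> p x y > 0"
    and mass: "\<And>x. x \<in> space N \<Longrightarrow> (\<integral>\<^sup>+y. p x y \<partial>N) = 1"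
    and f [measurable]: "f \<in> borel_measurable N" and g [measurable]: "g \<in> borel_measurable N"
    and int: "(\<integral>\<^sup>+x. f x \<partial>N) = 1" "(\<integral>\<^sup>+x. g x \<partial>N) = 1"
    and inv: "AE y in N. f y = (\<integral>\<^sup>+x. f x * p x y \<partial>N)" "AE y in N. g y = (\<integral>\<^sup>+x. g x * p x y \<partial>N)"
  shows "AE x in N. f x = g x"
proof -
  interpret N: sigma_finite_measure N by fact
  interpret NN: pair_sigma_finite N N ..
  define P where "P h y = (\<integral>\<^sup>+x. h x * p x y \<partial>N)" for h y
  have P_meas [measurable]: "P h \<in> borel_measurable N" if [measurable]: "h \<in> borel_measurable N" for h
    unfolding P_def by measurable
  have P_int: "(\<integral>\<^sup>+y. P h y \<partial>N) = (\<integral>\<^sup>+x. h x \<partial>N)" if [measurable]: "h \<in> borel_measurable N" for h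
  proof -
    have "(\<integral>\<^sup>+y. P h y \<partial>N) = (\<integral>\<^sup>+x. \<integral>\<^sup>+y. h x * p x y \<partial>N \<partial>N)"
      unfolding P_def by (rule NN.Fubini') measurable
    also have "\<dots> = (\<integral>\<^sup>+x. h x \<partial>N)"
      by (rule nn_integral_cong) (simp add: nn_integral_cmult mass)
    finally show ?thesis .
  qed
  have P_mono: "P h y \<le> P k y" if "\<And>x. h x \<le> k x" for h k y
    unfolding P_def by (intro nn_integral_mono mult_right_mono that) simp
  define m where "m x = min (f x) (g x)" for x
  have m [measurable]: "m \<in> borel_measurable N"
    unfolding m_def by measurable
  have "(\<integral>\<^sup>+x. m x \<partial>N) \<le> (\<integral>\<^sup>+x. f x \<partial>N)"
    by (intro nn_integral_mono) (simp add: m_def)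
  then have m_fin: "(\<integral>\<^sup>+x. m x \<partial>N) \<noteq> \<infinity>"
    using int by (auto simp: top_unique)
  have m_AE_fin: "AE x in N. m x \<noteq> \<infinity>"
    using m_fin by (intro nn_integral_noteq_infinite) auto
  have "AE y in N. P m y \<le> m y"
    using inv
  proof eventually_elim
    case (elim y)
    then show ?case
      using P_mono[of m f y] P_mono[of m g y] by (simp add: m_def P_def)
  qed
  \<comment> \<open>\<open>P\<close> preserves the integral, and that of \<open>m\<close> is finite,
    so the nonnegative difference integrates to 0.\<close>
  moreover have "(\<integral>\<^sup>+y. m y - P m y \<partial>N) = 0"
    using calculation m_fin by (subst nn_integral_diff) (auto simp: P_int)
  then have "AE y in N. m y - P m y = 0"
    by (subst (asm) nn_integral_0_iff_AE) auto
  ultimately have Pm: "AE y in N. P m y = m y"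
    using m_AE_fin by eventually_elim (simp add: diff_eq_0_iff_ennreal antisym less_top)
  have excess: "(\<integral>\<^sup>+x. h x - m x \<partial>N) = 0 \<or> (AE y in N. h y > m y)"
    if [measurable]: "h \<in> borel_measurable N" and mh: "\<And>x. m x \<le> h x"
      and hP: "AE y in N. h y = P h y" for h
  proof (rule disjCI)
    assume "\<not> (AE y in N. m y < h y)"
    \<comment> \<open>Since \<open>m\<close> lies below \<open>h\<close>, the truncated subtraction
      of \<open>ennreal\<close> is exact here and \<open>P\<close> splits additively.\<close>
    have split: "P h y = P m y + P (\<lambda>x. h x - m x) y" if "y \<in> space N" for y
    proof -
      have "h x = m x + (h x - m x)" for x
        using mh by (simp add: add_diff_inverse_ennreal)
      then have "P h y = (\<integral>\<^sup>+x. m x * p x y + (h x - m x) * p x y \<partial>N)"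
        unfolding P_def by (intro nn_integral_cong) (metis distrib_right)
      then show ?thesis
        using that unfolding P_def by (subst (asm) nn_integral_add) auto
    qed
    show "(\<integral>\<^sup>+x. h x - m x \<partial>N) = 0"
    proof (rule ccontr)
      assume nz: "(\<integral>\<^sup>+x. h x - m x \<partial>N) \<noteq> 0"
      have "AE y in N. m y < h y"
        using hP Pm m_AE_fin AE_space
      proof eventually_elim
        case (elim y)
        have "P (\<lambda>x. h x - m x) y \<noteq> 0"
        proof
          assume "P (\<lambda>x. h x - m x) y = 0"
          then have "AE x in N. (h x - m x) * p x y = 0"
            using elim unfolding P_def by (subst (asm) nn_integral_0_iff_AE) auto
          then have "AE x in N. h x - m x = 0"
            using AE_space by eventually_elim (use pos elim in \<open>auto simp: less_le\<close>)
          then show False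
            using nz by (subst (asm) nn_integral_0_iff_AE) auto
        qed
        then have "0 < P (\<lambda>x. h x - m x) y"
          by (simp add: zero_less_iff_neq_zero)
        then show ?case
          using elim split[of y] by (metis add.right_neutral ennreal_add_left_cancel_less infinity_ennreal_def)
      qed
      with \<open>\<not> (AE y in N. m y < h y)\<close> show False by blast
    qed
  qed
  have diff: "(\<integral>\<^sup>+x. h x - m x \<partial>N) = 1 - (\<integral>\<^sup>+x. m x \<partial>N)"
    if [measurable]: "h \<in> borel_measurable N" and "\<And>x. m x \<le> h x" "(\<integral>\<^sup>+x. h x \<partial>N) = 1" for h
    using that m_fin by (subst nn_integral_diff) auto
  have "(\<integral>\<^sup>+x. f x - m x \<partial>N) = 0"
  proof (rule ccontr)
    assume *: "\<not> ?thesis"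
    have "AE y in N. m y < f y"
      using excess[of f] inv * by (auto simp: m_def P_def)
    moreover have "AE y in N. m y < g y"
      using excess[of g] inv * diff[of f] diff[of g] int by (auto simp: m_def P_def)
    ultimately have "AE y in N. False"
      by eventually_elim (auto simp: m_def min_def split: if_splits)
    then have "(\<integral>\<^sup>+x. f x \<partial>N) = 0"
      by (subst nn_integral_0_iff_AE) auto
    then show False
      using int by simp
  qed
  moreover from this have "(\<integral>\<^sup>+x. g x - m x \<partial>N) = 0"
    using diff[of f] diff[of g] int by (simp add: m_def)
  ultimately have "AE x in N. f x - m x = 0" "AE x in N. g x - m x = 0"
    by (subst (asm) (1 2) nn_integral_0_iff_AE; auto)+
  with m_AE_fin show ?thesis
  proof eventually_elim
    case (elim x)
    then have "f x \<le> m x" "g x \<le> m x"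
      by (auto simp: diff_eq_0_iff_ennreal less_top)
    then show ?case
      by (auto simp: m_def min_def split: if_splits)
  qed
qed

section \<open>Chains driven by independent innovations\<close>

primrec orbit :: "('s \<Rightarrow> 'e \<Rightarrow> 's) \<Rightarrow> (nat \<Rightarrow> 'e) \<Rightarrow> 's \<Rightarrow> nat \<Rightarrow> 's" where
  "orbit F h x 0 = x"
| "orbit F h x (Suc n) = F (orbit F h x n) (h (Suc n))"

text \<open>Only the innovations 1 to \<open>n\<close> are read and never \<open>h 0\<close>. This
  makes the state at time \<open>n\<close> a function of a block of innovations that is independent
  of the next one.\<close>

lemma orbit_cong: "(\<And>k. 1 \<le> k \<Longrightarrow> k \<le> n \<Longrightarrow> h k = h' k) \<Longrightarrow> orbit F h x n = orbit F h' x n"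
  by (induction n) auto

lemma orbit_measurable:
  assumes F: "case_prod F \<in> S \<Otimes>\<^sub>M E \<rightarrow>\<^sub>M S" and x: "x \<in> L \<rightarrow>\<^sub>M S"
    and h: "\<And>k. 1 \<le> k \<Longrightarrow> k \<le> n \<Longrightarrow> h k \<in> L \<rightarrow>\<^sub>M E"
  shows "(\<lambda>l. orbit F (\<lambda>k. h k l) (x l) n) \<in> L \<rightarrow>\<^sub>M S"
  using h
proof (induction n)
  case (Suc n)
  have "(\<lambda>l. (orbit F (\<lambda>k. h k l) (x l) n, h (Suc n) l)) \<in> L \<rightarrow>\<^sub>M S \<Otimes>\<^sub>M E"
    using Suc by (intro measurable_Pair) auto
  from measurable_compose[OF this F] show ?case
    by simp
qed (simp add: x)

text \<open>Tonelli turns the joint law of independent arguments into sampling the first and then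
  the second; this is how a step of the chain becomes the application of a kernel.\<close>

lemma distr_pair_measure_eq_bind:
  assumes F: "case_prod F \<in> S \<Otimes>\<^sub>M E \<rightarrow>\<^sub>M R" and "prob_space A" "prob_space B"
    and A: "sets A = sets S" and B: "sets B = sets E"
  shows "distr (A \<Otimes>\<^sub>M B) R (case_prod F) = A \<bind> (\<lambda>a. distr B R (F a))"
proof -
  interpret A: prob_space A by fact
  interpret B: prob_space B by fact
  interpret AB: pair_prob_space A B ..
  note [measurable_cong] = A B
  note F [measurable]
  have B_sub: "B \<in> space (subprob_algebra E)"
    using B.M_in_subprob subprob_algebra_cong[OF B] by simp
  have K [measurable]: "(\<lambda>a. distr B R (F a)) \<in> A \<rightarrow>\<^sub>M subprob_algebra R"
    by (rule measurable_distr2[where M=E]) (use B_sub in measurable)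
  show ?thesis
  proof (rule measure_eqI)
    show "sets (distr (A \<Otimes>\<^sub>M B) R (case_prod F)) = sets (A \<bind> (\<lambda>a. distr B R (F a)))"
      using A.not_empty by (subst sets_bind) auto
  next
    fix Y assume "Y \<in> sets (distr (A \<Otimes>\<^sub>M B) R (case_prod F))"
    then have Y [measurable]: "Y \<in> sets R" by simp
    have "emeasure (distr (A \<Otimes>\<^sub>M B) R (case_prod F)) Y = (\<integral>\<^sup>+z. indicator Y (case_prod F z) \<partial>(A \<Otimes>\<^sub>M B))"
      using Y by (simp add: nn_integral_distr flip: nn_integral_indicator)
    also have "\<dots> = (\<integral>\<^sup>+a. \<integral>\<^sup>+b. indicator Y (F a b) \<partial>B \<partial>A)"
      by (subst B.nn_integral_fst[symmetric]) auto
    also have "\<dots> = (\<integral>\<^sup>+a. emeasure (distr B R (F a)) Y \<partial>A)"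
    proof (rule nn_integral_cong)
      fix a assume [simp]: "a \<in> space A"
      then have [measurable]: "F a \<in> B \<rightarrow>\<^sub>M R"
        using measurable_compose_Pair1[OF _ F, of a] measurable_cong_sets[OF B refl]
        by (simp add: sets_eq_imp_space_eq[OF A])
      show "(\<integral>\<^sup>+b. indicator Y (F a b) \<partial>B) = emeasure (distr B R (F a)) Y"
        using Y by (simp add: nn_integral_distr flip: nn_integral_indicator)
    qed
    also have "\<dots> = emeasure (A \<bind> (\<lambda>a. distr B R (F a))) Y"
      using A.not_empty by (subst emeasure_bind[OF _ K]) auto
    finally show "emeasure (distr (A \<Otimes>\<^sub>M B) R (case_prod F)) Y = emeasure (A \<bind> (\<lambda>a. distr B R (F a))) Y" .
  qed
qed

text \<open>Started at a point, the chain at time n is independent of the next innovation, so its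
  law at time n + 1 is its law at time n followed by the kernel \<open>K\<close>. Invariance under
  \<open>K\<close> then propagates by induction; times 0 and 1 give the converse.\<close>

theorem stationary_distribution_iff_one_step:
  fixes S E :: "'s measure"
  assumes M: "prob_space M" and F: "case_prod F \<in> S \<Otimes>\<^sub>M E \<rightarrow>\<^sub>M S"
    and ind: "prob_space.indep_vars M (\<lambda>_. E) X {1..}"
    and law: "\<And>n. n \<ge> 1 \<Longrightarrow> distr M E (X n) = \<rho>"
    and Z0: "\<And>x \<omega>. Z x 0 \<omega> = x"
    and ZSuc: "\<And>x n \<omega>. Z x (Suc n) \<omega> = F (Z x n \<omega>) (X (Suc n) \<omega>)"
  shows "stationary_distribution M S Z \<pi> \<longleftrightarrow>
    prob_space \<pi> \<and> sets \<pi> = sets S \<and> \<pi> \<bind> (\<lambda>z. distr \<rho> S (F z)) = \<pi>"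
proof -
  interpret M: prob_space M by fact
  have X: "X n \<in> M \<rightarrow>\<^sub>M E" if "n \<ge> 1" for n
    using ind that by (auto simp: M.indep_vars_def)
  have \<rho>: "prob_space \<rho>" "sets \<rho> = sets E"
    using M.prob_space_distr[OF X[of 1]] law[of 1] by auto
  have Z_eq: "Z x n \<omega> = orbit F (\<lambda>k. X k \<omega>) x n" for x n \<omega>
    by (induction n) (auto simp: Z0 ZSuc)
  have Z_meas: "case_prod (\<lambda>x. Z x n) \<in> S \<Otimes>\<^sub>M M \<rightarrow>\<^sub>M S" for n
  proof -
    have "(\<lambda>l. orbit F (\<lambda>k. X k (snd l)) (fst l) n) \<in> S \<Otimes>\<^sub>M M \<rightarrow>\<^sub>M S"
      by (rule orbit_measurable[OF F]) (auto intro: measurable_compose[OF _ X])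
    then show ?thesis
      by (simp add: Z_eq case_prod_beta')
  qed
  have Z_meas1: "Z x n \<in> M \<rightarrow>\<^sub>M S" if "x \<in> space S" for x n
    using measurable_compose_Pair1[OF that Z_meas[of n]] by simp
  define K where "K z = distr \<rho> S (F z)" for z
  have K: "K \<in> S \<rightarrow>\<^sub>M subprob_algebra S"
    unfolding K_def
  proof (rule measurable_distr2[OF F])
    show "(\<lambda>_. \<rho>) \<in> S \<rightarrow>\<^sub>M subprob_algebra E"
      using prob_space.M_in_subprob[OF \<rho>(1)] subprob_algebra_cong[OF \<rho>(2)] by simp
  qed
  have Zn: "(\<lambda>x. distr M S (Z x n)) \<in> S \<rightarrow>\<^sub>M subprob_algebra S" for n
    by (rule measurable_distr2[OF Z_meas]) (simp add: M.M_in_subprob)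
  have step: "distr M S (Z x (Suc n)) = distr M S (Z x n) \<bind> K" if x: "x \<in> space S" for x n
  proof -
    let ?P = "\<lambda>J. PiM J (\<lambda>_::nat. E)" and ?R = "\<lambda>J \<omega>. \<lambda>i\<in>J. X i \<omega>"
    have "M.indep_var (?P {1..n}) (?R {1..n}) (?P {Suc n}) (?R {Suc n})"
      by (rule M.indep_var_restrict[OF ind]) auto
    moreover have "(\<lambda>h. orbit F h x n) \<in> ?P {1..n} \<rightarrow>\<^sub>M S"
      using x by (intro orbit_measurable[OF F]) auto
    moreover have "(\<lambda>h. h (Suc n)) \<in> ?P {Suc n} \<rightarrow>\<^sub>M E"
      by measurable
    ultimately have "M.indep_var S ((\<lambda>h. orbit F h x n) \<circ> ?R {1..n}) E ((\<lambda>h. h (Suc n)) \<circ> ?R {Suc n})"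
      by (rule M.indep_var_compose)
    also have "(\<lambda>h. orbit F h x n) \<circ> ?R {1..n} = Z x n"
      by (auto simp: fun_eq_iff Z_eq intro!: orbit_cong)
    also have "(\<lambda>h. h (Suc n)) \<circ> ?R {Suc n} = X (Suc n)"
      by (auto simp: fun_eq_iff)
    finally have "distr M S (Z x n) \<Otimes>\<^sub>M distr M E (X (Suc n)) = distr M (S \<Otimes>\<^sub>M E) (\<lambda>\<omega>. (Z x n \<omega>, X (Suc n) \<omega>))"
      by (simp add: M.indep_var_distribution_eq)
    then have "distr (distr M S (Z x n) \<Otimes>\<^sub>M \<rho>) S (case_prod F) =
        distr (distr M (S \<Otimes>\<^sub>M E) (\<lambda>\<omega>. (Z x n \<omega>, X (Suc n) \<omega>))) S (case_prod F)"
      by (simp add: law)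
    also have "\<dots> = distr M S (Z x (Suc n))"
      using Z_meas1[OF x] X[of "Suc n"] by (subst distr_distr[OF F]) (auto simp: comp_def ZSuc[abs_def] fun_eq_iff)
    finally show ?thesis
      using distr_pair_measure_eq_bind[OF F M.prob_space_distr[OF Z_meas1[OF x]] \<rho>(1)] \<rho>(2)
      by (simp add: K_def[abs_def])
  qed
  have "(\<forall>n. \<pi> \<bind> (\<lambda>x. distr M S (Z x n)) = \<pi>) \<longleftrightarrow> \<pi> \<bind> K = \<pi>"
    if \<pi>: "prob_space \<pi>" and S: "sets \<pi> = sets S"
  proof -
    interpret \<pi>: prob_space \<pi> by fact
    have sp: "space \<pi> = space S" by (rule sets_eq_imp_space_eq[OF S])
    note meas = measurable_cong_sets[OF S refl]
    \<comment> \<open>At time 0 the chain sits at its starting point, so mixing the point masses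
      over \<pi> returns \<pi>.\<close>
    have zero: "\<pi> \<bind> (\<lambda>x. distr M S (Z x 0)) = \<pi>"
    proof -
      have "\<pi> \<bind> (\<lambda>x. distr M S (Z x 0)) = \<pi> \<bind> return \<pi>"
        using S Z0[abs_def] by (intro bind_cong_All) (auto simp: M.distr_const sp return_cong[OF S] return_sets_cong[OF S])
      then show ?thesis
        by (simp add: bind_return')
    qed
    have suc: "\<pi> \<bind> (\<lambda>x. distr M S (Z x (Suc n))) = (\<pi> \<bind> (\<lambda>x. distr M S (Z x n))) \<bind> K" for n
    proof -
      have "\<pi> \<bind> (\<lambda>x. distr M S (Z x (Suc n))) = \<pi> \<bind> (\<lambda>x. distr M S (Z x n) \<bind> K)"
        by (intro bind_cong_All) (auto simp: step sp)
      also have "\<dots> = (\<pi> \<bind> (\<lambda>x. distr M S (Z x n))) \<bind> K"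
        by (rule bind_assoc[symmetric, where N=S and R=S]) (use Zn K meas in auto)
      finally show ?thesis .
    qed
    show ?thesis
    proof
      assume *: "\<forall>n. \<pi> \<bind> (\<lambda>x. distr M S (Z x n)) = \<pi>"
      show "\<pi> \<bind> K = \<pi>"
        using suc[of 0] * by simp
    next
      assume "\<pi> \<bind> K = \<pi>"
      then have "\<pi> \<bind> (\<lambda>x. distr M S (Z x n)) = \<pi>" for n
        by (induction n) (auto simp only: zero suc)
      then show "\<forall>n. \<pi> \<bind> (\<lambda>x. distr M S (Z x n)) = \<pi>" ..
    qed
  qed
  then show ?thesis
    unfolding stationary_distribution_def K_def by blast
qed

section \<open>Polar decomposition\<close>

lemma compact_orthogonal_matrices: "compact {k :: real^'n^'n. orthogonal_matrix k}"
proof -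
  have "closed {k :: real^'n^'n. transpose k ** k = mat 1}"
    by (intro closed_Collect_eq continuous_intros)
  moreover have "bounded {k :: real^'n^'n. transpose k ** k = mat 1}"
  proof (rule boundedI)
    fix k :: "real^'n^'n" assume "k \<in> {k. transpose k ** k = mat 1}"
    then have "orthogonal_matrix k"
      by (simp add: orthogonal_matrix)
    then have "norm (row i k) = 1" for i
      by (simp add: orthogonal_matrix_orthonormal_rows)
    then have "norm (k $ i) = 1" for i
      by (simp add: row_def)
    moreover have "norm k \<le> (\<Sum>i\<in>UNIV. norm (k $ i))"
      by (simp add: norm_vec_def L2_set_le_sum)
    ultimately show "norm k \<le> CARD('n)"
      by simp
  qed
  ultimately show ?thesis
    by (simp add: orthogonal_matrix compact_eq_bounded_closed)
qed

text \<open>\<open>f\<close> rotates the plane of the coordinates i and j with cosine c and sine s;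
  only the two diagonal entries of the product in this plane change.\<close>

lemma plane_rotation:
  fixes N :: "real^'n^'n"
  assumes "i \<noteq> j" and cs: "c\<^sup>2 + s\<^sup>2 = 1"
  obtains u where "orthogonal_matrix u"
    "trace (u ** N) = trace N + (c - 1) * (N $ i $ i + N $ j $ j) + s * (N $ j $ i - N $ i $ j)"
proof
  define f :: "real^'n \<Rightarrow> real^'n" where "f v = (\<chi> a. if a = i then c * v $ i + s * v $ j
    else if a = j then c * v $ j - s * v $ i else v $ a)" for v
  have split: "sum g UNIV = g i + g j + sum g (UNIV - {i, j})" for g :: "'n \<Rightarrow> real"
    using \<open>i \<noteq> j\<close> by (simp add: sum.remove[of UNIV i] sum.remove[of "UNIV - {i}" j] Diff_insert2[symmetric] insert_commute)
  have lin: "linear f"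
    by (intro linearI) (auto simp: f_def vec_eq_iff algebra_simps)
  have "f v \<bullet> f v = v \<bullet> v" for v
  proof -
    have "(c * v $ i + s * v $ j)\<^sup>2 + (c * v $ j - s * v $ i)\<^sup>2 = (c\<^sup>2 + s\<^sup>2) * ((v $ i)\<^sup>2 + (v $ j)\<^sup>2)"
      by (simp add: power2_eq_square algebra_simps)
    then show ?thesis
      using \<open>i \<noteq> j\<close> by (simp add: inner_vec_def split f_def cs flip: power2_eq_square)
  qed
  then have "orthogonal_transformation f"
    using lin by (simp add: orthogonal_transformation norm_eq_sqrt_inner)
  then show "orthogonal_matrix (matrix f)"
    by (simp add: orthogonal_transformation_matrix)
  have "(matrix f ** N) $ a $ a = f (column a N) $ a" for a
  proof -
    have "(matrix f ** N) $ a $ a = (matrix f *v column a N) $ a"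
      by (simp add: matrix_matrix_mult_def matrix_vector_mult_def column_def)
    then show ?thesis
      by (simp add: matrix_works lin)
  qed
  then show "trace (matrix f ** N) = trace N + (c - 1) * (N $ i $ i + N $ j $ j) + s * (N $ j $ i - N $ i $ j)"
    using \<open>i \<noteq> j\<close> by (simp add: trace_def split f_def column_def algebra_simps)
qed

text \<open>A maximiser \<open>k\<close> of the trace of \<open>k ** m\<close> over the orthogonal group makes \<open>k ** m\<close> symmetric:
  otherwise a small rotation in a coordinate plane would increase the trace.\<close>

lemma polar_decomposition:
  fixes m :: "real^'n^'n"
  obtains k where "orthogonal_matrix k" "transpose (k ** m) = k ** m"
proof -
  have "\<exists>k\<in>{k. orthogonal_matrix k}. \<forall>l\<in>{k. orthogonal_matrix k}. trace (l ** m) \<le> trace (k ** m)"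
    using orthogonal_matrix_id
    by (intro continuous_attains_sup compact_orthogonal_matrices continuous_intros) auto
  then obtain k where k: "orthogonal_matrix k"
    and max: "\<And>l. orthogonal_matrix l \<Longrightarrow> trace (l ** m) \<le> trace (k ** m)"
    by auto
  define N where "N = k ** m"
  have maxN: "trace (u ** N) \<le> trace N" if "orthogonal_matrix u" for u
    using max[OF orthogonal_matrix_mul[OF that k]] by (simp add: N_def matrix_mul_assoc)
  have "N $ j $ i = N $ i $ j" for i j
  proof (rule ccontr)
    assume ne: "N $ j $ i \<noteq> N $ i $ j"
    then have "i \<noteq> j" by auto
    define p where "p = N $ i $ i + N $ j $ j"
    define q where "q = N $ j $ i - N $ i $ j"
    \<comment> \<open>This choice makes t * q equal to t^2 * (|p| + 1), which exceeds t^2 * p: the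
      first-order gain beats the second-order loss.\<close>
    define t where "t = q / (\<bar>p\<bar> + 1)"
    have "q \<noteq> 0"
      using ne by (simp add: q_def)
    moreover have p: "\<bar>p\<bar> + 1 \<noteq> 0"
      by linarith
    ultimately have "t \<noteq> 0"
      by (simp add: t_def)
    \<comment> \<open>The rational parametrisation of the circle: the cosine is (1 - t^2) / (1 +
      t^2) and the sine is 2 t / (1 + t^2).\<close>
    define r where "r = 1 / (1 + t\<^sup>2)"
    have "1 + t\<^sup>2 > 0"
      by (simp add: add_pos_nonneg)
    then have r: "r > 0" "r * (1 + t\<^sup>2) = 1"
      by (simp_all add: r_def)
    have "(1 - 2 * t\<^sup>2 * r)\<^sup>2 + (2 * t * r)\<^sup>2 = 1 - 4 * t\<^sup>2 * r + 4 * t\<^sup>2 * r * (r * (1 + t\<^sup>2))"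
      by (simp add: power2_eq_square algebra_simps)
    then have "(1 - 2 * t\<^sup>2 * r)\<^sup>2 + (2 * t * r)\<^sup>2 = 1"
      unfolding r(2) by simp
    from plane_rotation[OF \<open>i \<noteq> j\<close> this, of N] obtain u where u: "orthogonal_matrix u"
      "trace (u ** N) = trace N + (1 - 2 * t\<^sup>2 * r - 1) * p + 2 * t * r * q"
      unfolding p_def q_def by blast
    then have "(1 - 2 * t\<^sup>2 * r - 1) * p + 2 * t * r * q \<le> 0"
      using maxN[of u] by linarith
    also have "(1 - 2 * t\<^sup>2 * r - 1) * p + 2 * t * r * q = 2 * r * (t * q - t\<^sup>2 * p)"
      by (simp add: algebra_simps)
    finally have "t * q \<le> t\<^sup>2 * p"
      using r(1) by (simp add: mult_le_0_iff)
    moreover have "q = t * (\<bar>p\<bar> + 1)"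
      using p by (simp add: t_def)
    ultimately have "t * (t * (\<bar>p\<bar> + 1)) \<le> t\<^sup>2 * p"
      by metis
    then have "t\<^sup>2 * (\<bar>p\<bar> + 1) \<le> t\<^sup>2 * p"
      by (simp only: power2_eq_square mult.assoc)
    then show False
      using \<open>t \<noteq> 0\<close> by (simp add: mult_le_cancel_left)
  qed
  then have "transpose N = N"
    by (simp add: transpose_def vec_eq_iff)
  with k show ?thesis
    unfolding N_def by (rule that)
qed

text \<open>With \<open>m = transpose k ** N\<close> for an orthogonal \<open>k\<close> and a
  symmetric \<open>N\<close>, the two products are \<open>N ** N\<close> and its conjugate by
  \<open>k\<close>.\<close>

lemma gram_conjugate:
  fixes m :: "real^'n^'n"
  obtains u where "orthogonal_matrix u" "m ** transpose m = congr u (transpose m ** m)"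
proof -
  obtain k where k: "orthogonal_matrix k" and sym: "transpose (k ** m) = k ** m"
    by (rule polar_decomposition)
  define N where "N = k ** m"
  have kk: "transpose k ** k = mat 1" "k ** transpose k = mat 1"
    using k by (auto simp: orthogonal_matrix_def)
  have m: "m = transpose k ** N"
    by (simp add: N_def matrix_mul_assoc kk)
  have tm: "transpose m = N ** k"
    using sym by (subst m) (simp add: matrix_transpose_mul flip: N_def)
  have "N ** k ** (transpose k ** N) = N ** (k ** transpose k) ** N"
    by (simp add: matrix_mul_assoc)
  then have "transpose m ** m = N ** N"
    unfolding tm m[symmetric] by (simp add: kk)
  moreover have "transpose k ** N ** (N ** k) = congr k (N ** N)"
    by (simp add: matrix_mul_assoc)
  then have "m ** transpose m = congr k (N ** N)"
    unfolding tm m[symmetric] .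
  ultimately show ?thesis
    using that[OF k] by simp
qed

text \<open>The quotient of \<open>a\<close> by \<open>b\<close> has Gram matrix 1. This is applied
  wherever \<open>w\<close> or its transpose is compared with another root of the same
  matrix.\<close>

lemma equal_gram:
  fixes a b :: "real^'n^'n"
  assumes "invertible b" and eq: "transpose a ** a = transpose b ** b"
  obtains u where "orthogonal_matrix u" "a = u ** b"
proof -
  obtain c where c: "b ** c = mat 1" "c ** b = mat 1"
    using assms by (auto simp: invertible_def)
  have "transpose (a ** c) ** (a ** c) = congr c (transpose a ** a)"
    by (simp add: matrix_transpose_mul matrix_mul_assoc)
  also have "\<dots> = transpose (b ** c) ** (b ** c)"
    unfolding eq by (simp add: matrix_transpose_mul matrix_mul_assoc)
  finally have "orthogonal_matrix (a ** c)"
    by (simp add: orthogonal_matrix c)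
  moreover have "a = (a ** c) ** b"
    by (simp add: matrix_mul_assoc[symmetric] c)
  ultimately show ?thesis
    by (rule that)
qed

section \<open>Finiteness of the matrix Gamma integral\<close>

lemma nn_integral_even_finite:
  fixes h :: "real \<Rightarrow> ennreal"
  assumes [measurable]: "h \<in> borel_measurable borel"
    and half: "(\<integral>\<^sup>+t. h t * indicator {0..} t \<partial>lborel) < \<infinity>"
  shows "(\<integral>\<^sup>+t. h \<bar>t\<bar> \<partial>lborel) < \<infinity>"
proof -
  let ?h = "\<lambda>t. h t * indicator {0..} t"
  have "(\<integral>\<^sup>+t. h \<bar>t\<bar> \<partial>lborel) \<le> (\<integral>\<^sup>+t. ?h t + ?h (- t) \<partial>lborel)"
    by (intro nn_integral_mono) (auto split: split_indicator)
  also have "\<dots> = (\<integral>\<^sup>+t. ?h t \<partial>lborel) + (\<integral>\<^sup>+t. ?h (- t) \<partial>lborel)"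
    by (rule nn_integral_add) auto
  also have "(\<integral>\<^sup>+t. ?h (- t) \<partial>lborel) = (\<integral>\<^sup>+t. ?h t \<partial>lborel)"
    using nn_integral_real_affine[of ?h "-1" 0] by simp
  finally show ?thesis
    using half by (auto simp: le_less_trans)
qed

lemma nn_integral_exp_abs_finite:
  assumes "\<epsilon> > (0::real)"
  shows "(\<integral>\<^sup>+t. ennreal (exp (- \<epsilon> * \<bar>t\<bar>)) \<partial>lborel) < \<infinity>"
proof (rule nn_integral_even_finite)
  have "(\<integral>\<^sup>+t. ennreal (exp (- \<epsilon> * t)) * indicator {0..} t \<partial>lborel) = ennreal (0 - (- exp (- \<epsilon> * 0) / \<epsilon>))"
  proof (rule nn_integral_FTC_atLeast)
    show "DERIV (\<lambda>t. - exp (- \<epsilon> * t) / \<epsilon>) t :> exp (- \<epsilon> * t)" for t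
      using assms by (auto intro!: derivative_eq_intros)
    show "((\<lambda>t. - exp (- \<epsilon> * t) / \<epsilon>) \<longlongrightarrow> 0) at_top"
      using assms by real_asymp
  qed auto
  then show "(\<integral>\<^sup>+t. ennreal (exp (- \<epsilon> * t)) * indicator {0..} t \<partial>lborel) < \<infinity>"
    by simp
qed measurable

lemma nn_integral_powr_unit_finite:
  assumes "s < (1::real)"
  shows "(\<integral>\<^sup>+u. ennreal (\<bar>u\<bar> powr (- s)) * indicator {-1..1} u \<partial>lborel) < \<infinity>"
proof -
  have "((\<lambda>x. x powr (- s)) has_integral (1 powr (- s + 1) / (- s + 1))) {0..1}"
    using assms by (intro has_integral_powr_from_0) auto
  moreover have "(\<lambda>u. ennreal (u powr (- s)) * indicator {..1} u * indicator {0..} u) =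
      (\<lambda>u. ennreal (indicat_real {0..1} u * u powr (- s)))"
    by (auto split: split_indicator)
  ultimately have "(\<integral>\<^sup>+u. ennreal (u powr (- s)) * indicator {..1} u * indicator {0..} u \<partial>lborel) < \<infinity>"
    using nn_integral_has_integral_lebesgue[of "{0..1}" "\<lambda>u. u powr (- s)"] by simp
  then have "(\<integral>\<^sup>+u. ennreal (\<bar>u\<bar> powr (- s)) * indicator {..1} \<bar>u\<bar> \<partial>lborel) < \<infinity>"
    by (intro nn_integral_even_finite[of "\<lambda>u. ennreal (u powr (- s)) * indicator {..1} u"]) measurable
  moreover have "indicator {..1} \<bar>u\<bar> = (indicator {-1..1} u :: ennreal)" for u :: real
    by (auto split: split_indicator)
  ultimately show ?thesis
    by simp
qed

text \<open>Where |t + c| \<le> 1 the exponential is at most 1, elsewhere the power is. Translation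
  invariance removes c from the singular part, so one bound serves all c.\<close>

lemma uniform_singular_bound:
  assumes "0 \<le> s" "s < (1::real)" "\<epsilon> > 0"
  obtains K where "K < \<infinity>"
    "\<And>c. (\<integral>\<^sup>+t. ennreal (\<bar>t + c\<bar> powr (- s)) * ennreal (exp (- \<epsilon> * \<bar>t\<bar>)) \<partial>lborel) \<le> K"
proof
  let ?h = "\<lambda>u. ennreal (\<bar>u\<bar> powr (- s)) * indicator {-1..1} u"
  let ?K = "(\<integral>\<^sup>+u. ?h u \<partial>lborel) + (\<integral>\<^sup>+t. ennreal (exp (- \<epsilon> * \<bar>t\<bar>)) \<partial>lborel)"
  show "?K < \<infinity>"
    using nn_integral_powr_unit_finite[OF assms(2)] nn_integral_exp_abs_finite[OF assms(3)] by simp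
  fix c
  have "(\<integral>\<^sup>+t. ennreal (\<bar>t + c\<bar> powr (- s)) * ennreal (exp (- \<epsilon> * \<bar>t\<bar>)) \<partial>lborel) \<le>
    (\<integral>\<^sup>+t. ?h (c + 1 * t) + ennreal (exp (- \<epsilon> * \<bar>t\<bar>)) \<partial>lborel)"
  proof (intro nn_integral_mono)
    fix t
    show "ennreal (\<bar>t + c\<bar> powr (- s)) * ennreal (exp (- \<epsilon> * \<bar>t\<bar>)) \<le> ?h (c + 1 * t) + ennreal (exp (- \<epsilon> * \<bar>t\<bar>))"
    proof (cases "\<bar>t + c\<bar> \<le> 1")
      case True
      have "exp (- \<epsilon> * \<bar>t\<bar>) \<le> 1"
        using assms by simp
      then have "ennreal (\<bar>t + c\<bar> powr (- s)) * ennreal (exp (- \<epsilon> * \<bar>t\<bar>)) \<le> ennreal (\<bar>t + c\<bar> powr (- s)) * 1"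
        by (intro mult_left_mono) auto
      also have "\<dots> \<le> ?h (c + 1 * t) + ennreal (exp (- \<epsilon> * \<bar>t\<bar>))"
        using True by (auto simp: add.commute abs_le_iff split: split_indicator)
      finally show ?thesis .
    next
      case False
      then have "\<bar>t + c\<bar> powr (- s) \<le> \<bar>t + c\<bar> powr 0"
        using assms by (intro powr_mono) auto
      then have "\<bar>t + c\<bar> powr (- s) \<le> 1"
        using False by (simp split: if_splits)
      then have "ennreal (\<bar>t + c\<bar> powr (- s)) * ennreal (exp (- \<epsilon> * \<bar>t\<bar>)) \<le> 1 * ennreal (exp (- \<epsilon> * \<bar>t\<bar>))"
        by (intro mult_right_mono) auto
      then show ?thesis
        by (simp add: add_increasing)
    qed
  qed
  also have "\<dots> = (\<integral>\<^sup>+t. ?h (c + 1 * t) \<partial>lborel) + (\<integral>\<^sup>+t. ennreal (exp (- \<epsilon> * \<bar>t\<bar>)) \<partial>lborel)"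
    by (rule nn_integral_add) auto
  also have "(\<integral>\<^sup>+t. ?h (c + 1 * t) \<partial>lborel) = (\<integral>\<^sup>+u. ?h u \<partial>lborel)"
    using nn_integral_real_affine[of ?h 1 c] by simp
  finally show "(\<integral>\<^sup>+t. ennreal (\<bar>t + c\<bar> powr (- s)) * ennreal (exp (- \<epsilon> * \<bar>t\<bar>)) \<partial>lborel) \<le> ?K" .
qed

text \<open>In the Leibniz formula the entry (k, k) occurs exactly for the permutations fixing k.
  Its coefficient is the minor without k, written at full size with row and column k of the
  identity.\<close>

lemma det_affine_diagonal:
  fixes A :: "real^'n^'n"
  shows "det A = A $ k $ k * det (\<chi> i j. if i = k \<or> j = k then of_bool (i = j) else A $ i $ j) +
    det (\<chi> i j. if i = k \<and> j = k then 0 else A $ i $ j)" (is "_ = _ * det ?A1 + det ?A0")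
proof -
  have "(\<Prod>i\<in>UNIV. A $ i $ p i) = A $ k $ k * (\<Prod>i\<in>UNIV. ?A1 $ i $ p i) + (\<Prod>i\<in>UNIV. ?A0 $ i $ p i)"
    if p: "p permutes UNIV" for p
  proof -
    have split: "(\<Prod>i\<in>UNIV. B $ i $ p i) = B $ k $ p k * (\<Prod>i\<in>UNIV - {k}. B $ i $ p i)" for B :: "real^'n^'n"
      by (simp add: prod.remove)
    show ?thesis
    proof (cases "p k = k")
      case True
      then have "p i \<noteq> k" if "i \<noteq> k" for i
        using p that by (metis permutes_inj injD)
      then have "(\<Prod>i\<in>UNIV - {k}. ?A1 $ i $ p i) = (\<Prod>i\<in>UNIV - {k}. A $ i $ p i)"
        by (intro prod.cong) auto
      then show ?thesis
        unfolding split using True by simp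
    next
      case False
      then have "(\<Prod>i\<in>UNIV - {k}. ?A0 $ i $ p i) = (\<Prod>i\<in>UNIV - {k}. A $ i $ p i)"
        by (intro prod.cong) auto
      then show ?thesis
        unfolding split using False by simp
    qed
  qed
  then have "(\<Sum>p | p permutes UNIV. of_int (sign p) * (\<Prod>i\<in>UNIV. A $ i $ p i)) =
      (\<Sum>p | p permutes UNIV. A $ k $ k * (of_int (sign p) * (\<Prod>i\<in>UNIV. ?A1 $ i $ p i)) +
        of_int (sign p) * (\<Prod>i\<in>UNIV. ?A0 $ i $ p i))"
    by (intro sum.cong refl) (simp only: mem_Collect_eq ring_distribs mult.left_commute)
  then show ?thesis
    unfolding det_def by (simp only: sum.distrib sum_distrib_left)
qed

text \<open>The principal submatrix on \<open>J\<close> is padded with the identity, so that principal minors of all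
  sizes are determinants of one matrix type.\<close>

definition minor_of :: "'n::{finite,linorder} set \<Rightarrow> ('n \<times> 'n \<Rightarrow> real) \<Rightarrow> 'n sqmat" where
  "minor_of J y = (\<chi> i j. if i \<in> J \<and> j \<in> J then sym_of y $ i $ j else of_bool (i = j))"

lemma minor_of_empty: "minor_of {} y = mat 1"
  by (simp add: minor_of_def mat_def vec_eq_iff)

lemma minor_of_UNIV: "minor_of UNIV y = sym_of y"
  by (simp add: minor_of_def vec_eq_iff)

lemma minor_of_measurable [measurable]:
  "(minor_of J :: _ \<Rightarrow> 'n::{finite,linorder} sqmat) \<in> PiU \<rightarrow>\<^sub>M borel"
proof (rule borel_measurable_matrixI)
  fix i j :: 'n
  show "(\<lambda>y. (minor_of J y :: 'n sqmat) $ i $ j) \<in> borel_measurable PiU"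
    by (cases "i \<in> J \<and> j \<in> J"; cases "i \<le> j") (auto simp: minor_of_def sym_of_def)
qed

lemma minor_of_sym: "transpose (minor_of J y) = minor_of J y"
  by (auto simp: minor_of_def sym_of_def transpose_def vec_eq_iff)

lemma inner_matrix_vector_sum: "v \<bullet> (A *v v) = (\<Sum>i\<in>UNIV. \<Sum>j\<in>UNIV. v $ i * A $ i $ j * v $ j)"
  for v :: "real^'n"
  by (simp add: inner_vec_def matrix_vector_mult_def sum_distrib_left mult.assoc)

text \<open>The quadratic form of the padded J-minor at v is that of the L-minor at v cut off
  outside J, plus the squares of the removed coordinates.\<close>

lemma minor_of_PD_mono:
  assumes "J \<subseteq> L" "minor_of L y \<in> PD"
  shows "minor_of J y \<in> PD"
proof -
  have "0 < v \<bullet> (minor_of J y *v v)" if v: "v \<noteq> 0" for v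
  proof -
    define u where "u = (\<chi> i. if i \<in> J then v $ i else 0)"
    have "v \<bullet> (minor_of J y *v v) = (\<Sum>i\<in>UNIV. \<Sum>j\<in>UNIV.
        u $ i * minor_of L y $ i $ j * u $ j + (if i = j then of_bool (i \<notin> J) * v $ i * v $ i else 0))"
      unfolding inner_matrix_vector_sum using assms(1)
      by (intro sum.cong refl) (auto simp: u_def minor_of_def)
    also have "\<dots> = u \<bullet> (minor_of L y *v u) + (\<Sum>i\<in>UNIV. of_bool (i \<notin> J) * (v $ i)\<^sup>2)"
      by (simp add: inner_matrix_vector_sum sum.distrib power2_eq_square mult.assoc)
    also have "\<dots> > 0"
    proof (cases "u = 0")
      case True
      from v obtain i where i: "v $ i \<noteq> 0"
        by (auto simp: vec_eq_iff)
      then have "i \<notin> J"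
        using arg_cong[OF True, of "\<lambda>u. u $ i"] by (auto simp: u_def)
      then have "0 < (\<Sum>i\<in>UNIV. of_bool (i \<notin> J) * (v $ i)\<^sup>2)"
        using i by (intro sum_pos2[where i=i]) auto
      then show ?thesis
        using True by simp
    next
      case False
      then show ?thesis
        using assms(2) by (intro add_pos_nonneg sum_nonneg) (auto simp: PD_iff)
    qed
    finally show ?thesis .
  qed
  then show ?thesis
    by (simp add: PD_iff minor_of_sym)
qed

lemma minor_of_upd:
  assumes "k \<notin> J"
  shows "minor_of J (y((k, k) := t)) = minor_of J y"
  using assms by (auto simp: minor_of_def sym_of_def vec_eq_iff)

lemma det_minor_of_insert:
  assumes "k \<notin> J"
  obtains b where "\<And>t. det (minor_of (insert k J) (y((k, k) := t))) = t * det (minor_of J y) + b"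
proof
  fix t
  let ?A = "minor_of (insert k J) (y((k, k) := t))"
  have "?A $ k $ k = t"
    by (simp add: minor_of_def sym_of_def)
  moreover have "(\<chi> i j. if i = k \<or> j = k then of_bool (i = j) else ?A $ i $ j) = minor_of J y"
    using assms by (auto simp: minor_of_def sym_of_def vec_eq_iff)
  moreover have "(\<chi> i j. if i = k \<and> j = k then 0 else ?A $ i $ j) = minor_of (insert k J) (y((k, k) := 0))"
    by (auto simp: minor_of_def sym_of_def vec_eq_iff)
  ultimately show "det ?A = t * det (minor_of J y) + det (minor_of (insert k J) (y((k, k) := 0)))"
    using det_affine_diagonal[of ?A k] by simp
qed

text \<open>Integrating out the diagonal entry \<open>y (k, k)\<close>, in which the determinant is affine with slope the
  next smaller principal minor, reduces the exponent \<open>- s\<close> of the determinant to that of the minor.\<close>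

lemma minor_integral_finite:
  fixes J :: "'n::{finite,linorder} set"
  assumes s: "0 \<le> s" "s < 1" and \<epsilon>: "\<epsilon> > 0"
  shows "(\<integral>\<^sup>+y. indicator PD (minor_of J y) * ennreal (\<bar>det (minor_of J y)\<bar> powr (- s)) *
    (\<Prod>p\<in>upper. ennreal (exp (- \<epsilon> * \<bar>y p\<bar>))) \<partial>PiU) < \<infinity>"
proof -
  interpret product_sigma_finite "\<lambda>_::('n \<times> 'n). lborel :: real measure" ..
  define w where "w t = ennreal (exp (- \<epsilon> * \<bar>t\<bar>))" for t
  have [measurable]: "w \<in> borel_measurable borel"
    unfolding w_def by measurable
  have w_fin: "(\<integral>\<^sup>+t. w t \<partial>lborel) < \<infinity>"
    unfolding w_def by (rule nn_integral_exp_abs_finite[OF \<epsilon>])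
  have "(\<integral>\<^sup>+t. ennreal (exp (- \<epsilon>)) * indicator {0..1::real} t \<partial>lborel) \<le> (\<integral>\<^sup>+t. w t \<partial>lborel)"
    by (rule nn_integral_mono) (use \<epsilon> in \<open>auto simp: w_def split: split_indicator\<close>)
  then have w_pos: "(\<integral>\<^sup>+t. w t \<partial>lborel) \<noteq> 0"
    by (auto simp: nn_integral_cmult_indicator)
  obtain K where K: "K < \<infinity>"
    "\<And>c. (\<integral>\<^sup>+t. ennreal (\<bar>t + c\<bar> powr (- s)) * w t \<partial>lborel) \<le> K"
    using uniform_singular_bound[OF s \<epsilon>] unfolding w_def by blast
  define g where "g J y = indicator PD (minor_of J y) * ennreal (\<bar>det (minor_of J y)\<bar> powr (- s))"
    for J :: "'n set" and y
  have g_meas [measurable]: "g J \<in> borel_measurable PiU" for J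
    unfolding g_def by measurable
  have "finite J" by simp
  then have "(\<integral>\<^sup>+y. g J y * (\<Prod>p\<in>upper. w (y p)) \<partial>PiU) < \<infinity>"
  proof induction
    case empty
    have "(\<integral>\<^sup>+y. (\<Prod>p\<in>upper. w (y p)) \<partial>(PiU :: ('n \<times> 'n \<Rightarrow> real) measure)) = (\<Prod>p\<in>(upper :: ('n \<times> 'n) set). \<integral>\<^sup>+t. w t \<partial>lborel)"
      by (rule product_nn_integral_prod) auto
    then show ?case
      using w_fin by (simp add: g_def minor_of_empty PD_mat_1 power_less_top_ennreal)
  next
    case (insert k J)
    define U where "U = upper - {(k, k)}"
    have U: "upper = insert (k, k) U" "(k, k) \<notin> U" "finite U"
      by (auto simp: U_def)
    define W where "W y = (\<Prod>p\<in>U. w (y p))" for y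
    have W_upd: "(\<Prod>p\<in>upper. w ((y((k, k) := t)) p)) = w t * W y" for y t
    proof -
      have "(\<Prod>p\<in>U. w ((y((k, k) := t)) p)) = W y"
        unfolding W_def using U by (intro prod.cong) auto
      then show ?thesis
        unfolding U(1) using U(2,3) by (subst prod.insert) auto
    qed
    have Fub: "(\<integral>\<^sup>+y. g L y * (\<Prod>p\<in>upper. w (y p)) \<partial>PiU) =
      (\<integral>\<^sup>+y. \<integral>\<^sup>+t. g L (y((k, k) := t)) * (w t * W y) \<partial>lborel \<partial>(\<Pi>\<^sub>M p\<in>U. lborel))" for L
    proof -
      have "(\<lambda>y. g L y * (\<Prod>p\<in>upper. w (y p))) \<in> borel_measurable PiU"
        by measurable
      from product_nn_integral_insert[OF U(3,2) this[unfolded U(1)]]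
      show ?thesis
        unfolding U(1)[symmetric] W_upd .
    qed
    have meas: "(\<lambda>y. g J (y((k, k) := 0)) * W y) \<in> borel_measurable (\<Pi>\<^sub>M p\<in>U. lborel)"
    proof -
      have "(\<lambda>y. y((k, k) := 0)) \<in> (\<Pi>\<^sub>M p\<in>U. lborel) \<rightarrow>\<^sub>M PiU"
        unfolding U(1) by measurable
      from measurable_compose[OF this g_meas] show ?thesis
        unfolding W_def by measurable
    qed
    have gJ: "g J (y((k, k) := t)) = g J y" for y t
      using insert by (simp add: g_def minor_of_upd)
    \<comment> \<open>\<open>g J\<close> does not read the entry (k, k), so the integral in the
      induction hypothesis contains the integral of \<open>w\<close> as a factor. This factor is
      nonzero, and finiteness descends to the remaining coordinates.\<close>
    have "(\<integral>\<^sup>+y. g J y * (\<Prod>p\<in>upper. w (y p)) \<partial>PiU) =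
        (\<integral>\<^sup>+y. (\<integral>\<^sup>+t. w t \<partial>lborel) * (g J y * W y) \<partial>(\<Pi>\<^sub>M p\<in>U. lborel))"
      unfolding Fub gJ
    proof (rule nn_integral_cong)
      fix y
      have "(\<integral>\<^sup>+t. g J y * (w t * W y) \<partial>lborel) = (\<integral>\<^sup>+t. w t * (g J y * W y) \<partial>lborel)"
        by (simp add: mult_ac)
      also have "\<dots> = (\<integral>\<^sup>+t. w t \<partial>lborel) * (g J y * W y)"
        by (rule nn_integral_multc) measurable
      finally show "(\<integral>\<^sup>+t. g J y * (w t * W y) \<partial>lborel) = (\<integral>\<^sup>+t. w t \<partial>lborel) * (g J y * W y)" .
    qed
    also have "\<dots> = (\<integral>\<^sup>+t. w t \<partial>lborel) * (\<integral>\<^sup>+y. g J y * W y \<partial>(\<Pi>\<^sub>M p\<in>U. lborel))"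
      using meas by (intro nn_integral_cmult) (simp add: gJ)
    finally have fin: "(\<integral>\<^sup>+y. g J y * W y \<partial>(\<Pi>\<^sub>M p\<in>U. lborel)) < \<infinity>"
      using insert.IH w_pos by (auto simp: ennreal_mult_less_top)
    have inner: "(\<integral>\<^sup>+t. g (insert k J) (y((k, k) := t)) * (w t * W y) \<partial>lborel) \<le> K * (g J y * W y)" for y
    proof (cases "minor_of J y \<in> PD")
      case False
      then have "g (insert k J) (y((k, k) := t)) = 0" for t
        using minor_of_PD_mono[OF subset_insertI, of k J "y((k, k) := t)"] insert(2)
        by (auto simp: g_def minor_of_upd split: split_indicator)
      then show ?thesis by simp
    next
      case True
      define a where "a = det (minor_of J y)"
      have a: "a > 0"
        unfolding a_def by (rule PD_det_pos[OF True])
      obtain b where b: "\<And>t. det (minor_of (insert k J) (y((k, k) := t))) = t * a + b"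
        unfolding a_def using det_minor_of_insert[OF insert(2)] by blast
      \<comment> \<open>The slope \<open>a\<close> is factored out of the affine determinant: its
        power is \<open>g J y\<close>, and the rest is the singular integrand that \<open>K\<close>
        bounds uniformly in the shift b / a.\<close>
      have le: "g (insert k J) (y((k, k) := t)) \<le> g J y * ennreal (\<bar>t + b / a\<bar> powr (- s))" for t
      proof -
        have "t * a + b = a * (t + b / a)"
          using a by (simp add: field_simps)
        then have "\<bar>t * a + b\<bar> powr (- s) = a powr (- s) * \<bar>t + b / a\<bar> powr (- s)"
          using a by (simp add: abs_mult powr_mult)
        then show ?thesis
          using True a by (simp add: g_def b ennreal_mult a_def[symmetric] split: split_indicator)
      qed
      have "(\<integral>\<^sup>+t. g (insert k J) (y((k, k) := t)) * (w t * W y) \<partial>lborel) \<le>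
          (\<integral>\<^sup>+t. (g J y * W y) * (ennreal (\<bar>t + b / a\<bar> powr (- s)) * w t) \<partial>lborel)"
      proof (rule nn_integral_mono)
        fix t
        have "g (insert k J) (y((k, k) := t)) * (w t * W y) \<le>
            g J y * ennreal (\<bar>t + b / a\<bar> powr (- s)) * (w t * W y)"
          using le by (rule mult_right_mono) simp
        then show "g (insert k J) (y((k, k) := t)) * (w t * W y) \<le>
            (g J y * W y) * (ennreal (\<bar>t + b / a\<bar> powr (- s)) * w t)"
          by (simp add: mult_ac)
      qed
      also have "\<dots> = (g J y * W y) * (\<integral>\<^sup>+t. ennreal (\<bar>t + b / a\<bar> powr (- s)) * w t \<partial>lborel)"
        by (rule nn_integral_cmult) measurable
      also have "\<dots> \<le> K * (g J y * W y)"
        using K(2)[of "b / a"] by (subst mult.commute) (rule mult_right_mono, auto)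
      finally show ?thesis .
    qed
    have "(\<integral>\<^sup>+y. g (insert k J) y * (\<Prod>p\<in>upper. w (y p)) \<partial>PiU) \<le>
        (\<integral>\<^sup>+y. K * (g J y * W y) \<partial>(\<Pi>\<^sub>M p\<in>U. lborel))"
      unfolding Fub by (intro nn_integral_mono inner)
    also have "\<dots> = K * (\<integral>\<^sup>+y. g J y * W y \<partial>(\<Pi>\<^sub>M p\<in>U. lborel))"
      using meas by (intro nn_integral_cmult) (simp add: gJ)
    also have "\<dots> < \<infinity>"
      using fin K(1) by (simp add: ennreal_mult_less_top)
    finally show ?case .
  qed
  then show ?thesis
    by (simp add: g_def w_def)
qed


section \<open>Domination of the Gamma integrand\<close>

lemma det_abs_le:
  fixes A :: "real^'n^'n"
  assumes "\<And>i j. \<bar>A $ i $ j\<bar> \<le> m"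
  shows "\<bar>det A\<bar> \<le> fact CARD('n) * m ^ CARD('n)"
proof -
  have "\<bar>det A\<bar> \<le> (\<Sum>p | p permutes (UNIV :: 'n set). \<bar>of_int (sign p) * (\<Prod>i\<in>UNIV. A $ i $ p i)\<bar>)"
    unfolding det_def by (rule sum_abs)
  also have "\<dots> \<le> (\<Sum>p | p permutes (UNIV :: 'n set). m ^ CARD('n))"
  proof (rule sum_mono)
    fix p
    have "\<bar>of_int (sign p) * (\<Prod>i\<in>UNIV. A $ i $ p i)\<bar> = (\<Prod>i\<in>UNIV. \<bar>A $ i $ p i\<bar>)"
      by (simp add: abs_mult sign_def abs_prod)
    also have "\<dots> \<le> (\<Prod>i\<in>(UNIV :: 'n set). m)"
      using assms by (intro prod_mono) auto
    finally show "\<bar>of_int (sign p) * (\<Prod>i\<in>UNIV. A $ i $ p i)\<bar> \<le> m ^ CARD('n)"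
      by simp
  qed
  also have "\<dots> = fact CARD('n) * m ^ CARD('n)"
    by (simp add: card_permutations[of _ "CARD('n)"])
  finally show ?thesis .
qed

lemma borel_measurable_entry [measurable (raw)]:
  fixes f :: "'a \<Rightarrow> real^'n^'m"
  assumes "f \<in> borel_measurable M"
  shows "(\<lambda>x. f x $ i $ j) \<in> borel_measurable M"
  by (rule borel_measurable_continuous_on[OF _ assms]) (intro continuous_intros)

lemma PD_diagonal_pos:
  fixes x :: "real^'n^'n"
  assumes "x \<in> PD"
  shows "x $ i $ i > 0"
proof -
  have "axis i 1 \<bullet> (x *v axis i 1) = x $ i $ i"
    by (simp add: inner_axis' matrix_vector_mult_basis column_def)
  moreover have "axis i (1::real) \<noteq> 0"
    by simp
  ultimately show ?thesis
    using assms by (metis PD_iff)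
qed

text \<open>The quadratic form is evaluated at e_i + e_j and at e_i - e_j.\<close>

lemma PD_entry_le:
  fixes x :: "real^'n^'n"
  assumes x: "x \<in> PD"
  shows "\<bar>x $ i $ j\<bar> \<le> (x $ i $ i + x $ j $ j) / 2"
proof (cases "i = j")
  case False
  have sym: "x $ j $ i = x $ i $ j"
    using x by (metis PD_iff transpose_def vec_lambda_beta)
  have "0 < x $ i $ i + x $ j $ j + 2 * r * x $ i $ j" if r: "r = 1 \<or> r = -1" for r :: real
  proof -
    let ?v = "axis i 1 + r *\<^sub>R axis j 1 :: real^'n"
    have "?v $ i \<noteq> 0"
      using False by (simp add: axis_def)
    then have "?v \<noteq> 0"
      by (metis zero_index)
    then have "0 < ?v \<bullet> (x *v ?v)"
      using x unfolding PD_iff by blast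
    also have "?v \<bullet> (x *v ?v) = x $ i $ i + r * x $ i $ j + r * (x $ j $ i + r * x $ j $ j)"
      by (simp add: matrix_vector_right_distrib matrix_vector_mult_scaleR inner_add_left inner_add_right
          inner_axis' matrix_vector_mult_basis column_def algebra_simps)
    also have "\<dots> = x $ i $ i + x $ j $ j + 2 * r * x $ i $ j"
      using r by (auto simp: sym)
    finally show ?thesis .
  qed
  from this[of 1] this[of "-1"] show ?thesis
    by (simp add: abs_le_iff)
qed (use PD_diagonal_pos[OF x, of i] in simp)

lemma PD_entry_le_trace:
  fixes x :: "real^'n^'n"
  assumes x: "x \<in> PD"
  shows "\<bar>x $ i $ j\<bar> \<le> trace x"
proof -
  have "x $ k $ k \<le> trace x" for k
    unfolding trace_def using PD_diagonal_pos[OF x]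
    by (intro member_le_sum) (auto intro: less_imp_le)
  from this[of i] this[of j] have "(x $ i $ i + x $ j $ j) / 2 \<le> trace x"
    by simp
  with PD_entry_le[OF x, of i j] show ?thesis
    by (rule order.trans)
qed

lemma PD_sum_upper_le:
  fixes x :: "'n::{finite,linorder} sqmat"
  assumes x: "x \<in> PD"
  shows "(\<Sum>(i, j)\<in>upper. \<bar>x $ i $ j\<bar>) \<le> CARD('n) * trace x"
proof -
  have "(\<Sum>(i, j)\<in>upper. \<bar>x $ i $ j\<bar>) \<le> (\<Sum>(i, j)\<in>UNIV. \<bar>x $ i $ j\<bar>)"
    by (rule sum_mono2) auto
  also have "\<dots> = (\<Sum>i\<in>UNIV. \<Sum>j\<in>UNIV. \<bar>x $ i $ j\<bar>)"
    by (simp add: sum.cartesian_product)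
  also have "\<dots> \<le> (\<Sum>i\<in>UNIV. \<Sum>j\<in>UNIV. (x $ i $ i + x $ j $ j) / 2)"
    by (intro sum_mono PD_entry_le x)
  also have "\<dots> = CARD('n) * trace x"
    by (simp add: trace_def sum.distrib add_divide_distrib sum_divide_distrib[symmetric]
        sum_distrib_left[symmetric])
  finally show ?thesis .
qed

text \<open>The bound u \<le> exp u at u = \<tau> / c with c = 2 (r + 1), raised to the power r,
  leaves the exponent r \<tau> / c, at most \<tau> / 2. The added 1 keeps c positive when r =
  0.\<close>

lemma powr_le_exp:
  assumes "\<tau> > 0" "r \<ge> (0::real)"
  shows "\<tau> powr r \<le> (2 * (r + 1)) powr r * exp (\<tau> / 2)"
proof -
  let ?c = "2 * (r + 1)"
  have "\<tau> / ?c \<le> exp (\<tau> / ?c)"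
    using exp_ge_add_one_self[of "\<tau> / ?c"] by linarith
  then have "\<tau> \<le> ?c * exp (\<tau> / ?c)"
    using assms by (simp add: divide_le_eq mult.commute)
  then have "\<tau> powr r \<le> (?c * exp (\<tau> / ?c)) powr r"
    using assms by (intro powr_mono2) auto
  also have "\<dots> = ?c powr r * exp (r * \<tau> / ?c)"
    using assms by (simp add: powr_mult exp_powr_real mult_ac)
  also have "\<dots> \<le> ?c powr r * exp (\<tau> / 2)"
    using assms by (intro mult_left_mono) (auto simp: field_simps)
  finally show ?thesis .
qed

text \<open>Extended-valued, so that Tonelli can be applied before finiteness is known.\<close>

definition nn_Gamma :: "'n::{finite,linorder} itself \<Rightarrow> real \<Rightarrow> ennreal" where
  "nn_Gamma _ a = (\<integral>\<^sup>+x. ennreal (det x powr a * exp (- trace x)) \<partial>(mu :: 'n sqmat measure))"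

lemma measurable_PD_spaceI:
  "f \<in> borel_measurable borel \<Longrightarrow> f \<in> borel_measurable PD_space"
  by (rule measurable_restrict_space1)

text \<open>The bound on \<open>a\<close> says exactly that the total exponent q = a - (d + 1) / 2
  of the determinant exceeds -1. The negative part of q is left to the recursion over minors, the
  positive part is absorbed by half of the exponential, and the other half is dominated by a product
  of one-dimensional exponentials.\<close>

theorem nn_Gamma_finite:
  assumes a: "a > (real CARD('n::{finite,linorder}) - 1) / 2"
  shows "nn_Gamma TYPE('n) a < \<infinity>"
proof -
  define d where "d = real CARD('n)"
  have "d > 0" by (simp add: d_def)
  define q where "q = a - (d + 1) / 2"
  define s where "s = max 0 (- q)"
  define r where "r = max 0 q"
  have s: "0 \<le> s" "s < 1" and r: "r \<ge> 0" and rs: "q = r - s"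
    using a by (auto simp: s_def r_def q_def d_def max_def field_simps)
  \<comment> \<open>The entries on and above the diagonal sum in absolute value to at most d * trace
    x, so this rate costs at most half of the trace.\<close>
  define \<epsilon> where "\<epsilon> = 1 / (2 * d)"
  have \<epsilon>: "\<epsilon> > 0"
    using \<open>d > 0\<close> by (simp add: \<epsilon>_def)
  \<comment> \<open>From det x \<le> d! * (trace x)^d raised to the power r, followed by
    \<open>powr_le_exp\<close> with exponent d * r.\<close>
  define C where "C = fact CARD('n) powr r * (2 * (d * r + 1)) powr (d * r)"
  have bound: "det x powr q * exp (- trace x) \<le>
      C * (\<bar>det x\<bar> powr (- s) * (\<Prod>(i, j)\<in>upper. exp (- \<epsilon> * \<bar>x $ i $ j\<bar>)))"
    if x: "x \<in> PD" for x :: "'n sqmat"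
  proof -
    have det: "det x > 0" by (rule PD_det_pos[OF x])
    have tr: "trace x > 0"
      unfolding trace_def using PD_diagonal_pos[OF x] by (intro sum_pos) auto
    have "det x \<le> fact CARD('n) * trace x ^ CARD('n)"
      using det_abs_le[of x "trace x"] PD_entry_le_trace[OF x] by simp
    then have "det x powr r \<le> (fact CARD('n) * trace x powr d) powr r"
      using det r tr by (intro powr_mono2) (auto simp: d_def powr_realpow)
    also have "\<dots> = fact CARD('n) powr r * trace x powr (d * r)"
      using tr by (simp add: powr_mult powr_powr)
    also have "\<dots> \<le> fact CARD('n) powr r * ((2 * (d * r + 1)) powr (d * r) * exp (trace x / 2))"
      using tr r \<open>d > 0\<close> by (intro mult_left_mono powr_le_exp) auto
    finally have A: "det x powr r \<le> C * exp (trace x / 2)"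
      by (simp add: C_def mult.assoc)
    have "\<epsilon> * (\<Sum>(i, j)\<in>upper. \<bar>x $ i $ j\<bar>) \<le> \<epsilon> * (d * trace x)"
      using PD_sum_upper_le[OF x] \<epsilon> by (intro mult_left_mono) (auto simp: d_def)
    also have "\<dots> = trace x / 2"
      using \<open>d > 0\<close> by (simp add: \<epsilon>_def)
    finally have "exp (- (trace x / 2)) \<le> exp (- \<epsilon> * (\<Sum>(i, j)\<in>upper. \<bar>x $ i $ j\<bar>))"
      by simp
    also have "\<dots> = (\<Prod>(i, j)\<in>upper. exp (- \<epsilon> * \<bar>x $ i $ j\<bar>))"
      by (simp add: sum_distrib_left case_prod_beta flip: exp_sum sum_negf)
    finally have B: "exp (- (trace x / 2)) \<le> (\<Prod>(i, j)\<in>upper. exp (- \<epsilon> * \<bar>x $ i $ j\<bar>))" .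
    have "det x powr q * exp (- trace x) = det x powr (- s) * (det x powr r * exp (- trace x))"
      by (simp add: rs flip: powr_add mult.assoc)
    also have "\<dots> \<le> det x powr (- s) * (C * exp (trace x / 2) * exp (- trace x))"
      using A by (intro mult_left_mono mult_right_mono) auto
    also have "C * exp (trace x / 2) * exp (- trace x) = C * exp (- (trace x / 2))"
      by (simp add: mult.assoc flip: exp_add)
    also have "det x powr (- s) * \<dots> \<le> det x powr (- s) * (C * (\<Prod>(i, j)\<in>upper. exp (- \<epsilon> * \<bar>x $ i $ j\<bar>)))"
      using B by (intro mult_left_mono) (auto simp: C_def)
    finally show ?thesis
      using det by (simp add: mult_ac)
  qed
  have "C \<ge> 0"
    by (simp add: C_def)
  define H :: "'n sqmat \<Rightarrow> ennreal" where
    "H x = indicator PD x * ennreal (\<bar>det x\<bar> powr (- s)) *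
      (\<Prod>p\<in>upper. ennreal (exp (- \<epsilon> * \<bar>x $ fst p $ snd p\<bar>)))" for x
  have H [measurable]: "H \<in> borel_measurable borel"
    unfolding H_def by measurable
  let ?e = "- (real CARD('n) + 1) / 2" and ?h = "\<lambda>x :: 'n sqmat. det x powr a * exp (- trace x)"
  have "nn_Gamma TYPE('n) a = (\<integral>\<^sup>+x. ennreal (det x powr ?e) * ennreal (?h x) * indicator PD x \<partial>sym_lborel)"
    unfolding nn_Gamma_def by (intro nn_integral_mu measurable_PD_spaceI) measurable
  also have "\<dots> \<le> (\<integral>\<^sup>+x. ennreal C * H x \<partial>sym_lborel)"
  proof (rule nn_integral_mono)
    fix x :: "'n sqmat"
    show "ennreal (det x powr ?e) * ennreal (?h x) * indicator PD x \<le> ennreal C * H x"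
    proof (cases "x \<in> PD")
      case True
      have "q = ?e + a"
        by (simp add: q_def d_def field_simps)
      then have "det x powr ?e * ?h x = det x powr q * exp (- trace x)"
        by (simp only: powr_add mult.assoc)
      then have "ennreal (det x powr ?e) * ennreal (?h x) = ennreal (det x powr q * exp (- trace x))"
        by (metis ennreal_mult' powr_ge_zero)
      also have "\<dots> \<le> ennreal (C * (\<bar>det x\<bar> powr (- s) * (\<Prod>(i, j)\<in>upper. exp (- \<epsilon> * \<bar>x $ i $ j\<bar>))))"
        by (intro ennreal_leI bound True)
      also have "\<dots> = ennreal C * H x"
        using \<open>C \<ge> 0\<close> True by (simp add: H_def ennreal_mult' prod_ennreal case_prod_beta prod_nonneg)
      finally show ?thesis
        using True by simp
    qed simp
  qed
  also have "\<dots> = ennreal C * (\<integral>\<^sup>+x. H x \<partial>sym_lborel)"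
    by (rule nn_integral_cmult) measurable
  also have "(\<integral>\<^sup>+x. H x \<partial>sym_lborel) = (\<integral>\<^sup>+y. H (sym_of y) \<partial>PiU)"
    by (rule nn_integral_sym_lborel[OF H])
  also have "(\<lambda>y. H (sym_of y)) = (\<lambda>y. indicator PD (minor_of UNIV y :: 'n sqmat) *
    ennreal (\<bar>det (minor_of UNIV y :: 'n sqmat)\<bar> powr (- s)) * (\<Prod>p\<in>upper. ennreal (exp (- \<epsilon> * \<bar>y p\<bar>))))"
  proof
    fix y :: "'n \<times> 'n \<Rightarrow> real"
    have "(\<Prod>p\<in>upper. ennreal (exp (- \<epsilon> * \<bar>(sym_of y :: 'n sqmat) $ fst p $ snd p\<bar>))) =
      (\<Prod>p\<in>upper. ennreal (exp (- \<epsilon> * \<bar>y p\<bar>)))"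
      by (rule prod.cong) (auto simp: sym_of_def)
    then show "H (sym_of y) = indicator PD (minor_of UNIV y :: 'n sqmat) *
      ennreal (\<bar>det (minor_of UNIV y :: 'n sqmat)\<bar> powr (- s)) * (\<Prod>p\<in>upper. ennreal (exp (- \<epsilon> * \<bar>y p\<bar>)))"
      by (simp add: H_def minor_of_UNIV)
  qed
  also have "ennreal C * (\<integral>\<^sup>+y. \<dots> y \<partial>PiU) < \<infinity>"
    using minor_integral_finite[OF s \<epsilon>, of "UNIV :: 'n set"] by (simp add: ennreal_mult_less_top)
  finally show ?thesis .
qed

section \<open>The matrix Beta integral\<close>

lemma PD_space_ident_measurable [measurable (raw)]: "(\<lambda>x. x) \<in> borel_measurable PD_space"
  by (rule measurable_restrict_space1) measurable

lemma PD_space_fst_measurable [measurable (raw)]: "fst \<in> borel_measurable (PD_space \<Otimes>\<^sub>M N)"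
  by (rule measurable_compose[OF measurable_fst PD_space_ident_measurable])

lemma PD_space_snd_measurable [measurable (raw)]: "snd \<in> borel_measurable (N \<Otimes>\<^sub>M PD_space)"
  by (rule measurable_compose[OF measurable_snd PD_space_ident_measurable])

lemma mu_ident_measurable [measurable (raw)]: "(\<lambda>x. x) \<in> borel_measurable mu"
  using PD_space_ident_measurable by (simp cong: measurable_cong_sets)

lemma mu_fst_measurable [measurable (raw)]: "fst \<in> borel_measurable (mu \<Otimes>\<^sub>M N)"
  by (rule measurable_compose[OF measurable_fst mu_ident_measurable])

lemma mu_snd_measurable [measurable (raw)]: "snd \<in> borel_measurable (N \<Otimes>\<^sub>M mu)"
  by (rule measurable_compose[OF measurable_snd mu_ident_measurable])

section \<open>Sigma-finiteness and positivity of \<open>mu\<close>\<close>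

lemma sigma_finite_mu: "sigma_finite_measure (mu :: 'n::{finite,linorder} sqmat measure)"
proof -
  interpret S: sigma_finite_measure "restrict_space (sym_lborel :: 'n sqmat measure) PD"
    by (rule sigma_finite_measure_restrict_space[OF sigma_finite_sym_lborel]) simp
  have "(\<lambda>x :: 'n sqmat. ennreal (det x powr c)) \<in> borel_measurable (restrict_space sym_lborel PD)" for c
    by (intro measurable_restrict_space1) measurable
  then show ?thesis
    unfolding mu_def by (subst S.sigma_finite_iff_density_finite) auto
qed

text \<open>Every symmetric matrix enters \<open>PD\<close> after adding n times the identity, with
  n above its operator bound \<open>B\<close>. Countably many translates of \<open>PD\<close> thus
  cover the symmetric matrices, and if \<open>PD\<close> were null, so would be all of them.\<close>

lemma emeasure_mu_PD_nz: "emeasure (mu :: 'n::{finite,linorder} sqmat measure) PD \<noteq> 0"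
proof
  assume "emeasure (mu :: 'n sqmat measure) PD = 0"
  then have "(\<integral>\<^sup>+x. 1 \<partial>(mu :: 'n sqmat measure)) = 0"
    by simp
  then have "(\<integral>\<^sup>+x. ennreal (det x powr (- (real CARD('n) + 1) / 2)) * indicator PD x
      \<partial>(sym_lborel :: 'n sqmat measure)) = 0"
    using nn_integral_mu[of "\<lambda>_ :: 'n sqmat. 1"] by simp
  then have "AE x in (sym_lborel :: 'n sqmat measure).
      ennreal (det x powr (- (real CARD('n) + 1) / 2)) * indicator PD x = 0"
    by (subst (asm) nn_integral_0_iff_AE) auto
  then have "AE x in (sym_lborel :: 'n sqmat measure). x \<notin> PD"
    by eventually_elim (auto dest: PD_det_nz)
  then have "(\<integral>\<^sup>+x. indicator PD x \<partial>(sym_lborel :: 'n sqmat measure)) = 0"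
    by (subst nn_integral_0_iff_AE) auto
  moreover have "transpose (real n *\<^sub>R mat 1) = (real n *\<^sub>R mat 1 :: 'n sqmat)" for n
    by (simp add: transpose_scalar)
  ultimately have "(\<integral>\<^sup>+x. indicator PD (real n *\<^sub>R mat 1 + x) \<partial>(sym_lborel :: 'n sqmat measure)) = 0" for n
    by (subst nn_integral_sym_lborel_translate) auto
  note zero = this
  have "AE x in (sym_lborel :: 'n sqmat measure). real n *\<^sub>R mat 1 + x \<notin> PD" for n
  proof -
    have "AE x in (sym_lborel :: 'n sqmat measure). (indicator PD (real n *\<^sub>R mat 1 + x) :: ennreal) = 0"
      using zero[of n] by (subst (asm) nn_integral_0_iff_AE) auto
    then show ?thesis
      by eventually_elim (simp add: indicator_eq_0_iff)
  qed
  then have "AE x in (sym_lborel :: 'n sqmat measure). \<forall>n. real n *\<^sub>R mat 1 + x \<notin> PD"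
    by (simp add: AE_all_countable)
  with AE_sym_lborel have "AE x in (sym_lborel :: 'n sqmat measure). False"
  proof eventually_elim
    case (elim x)
    obtain B where B: "\<And>v. norm (x *v v) \<le> norm v * B"
      using bounded_linear.bounded[OF matrix_vector_mul_bounded_linear[of x]] by blast
    obtain n where n: "B < real n"
      using reals_Archimedean2 by blast
    have "0 < v \<bullet> ((real n *\<^sub>R mat 1 + x) *v v)" if "v \<noteq> 0" for v
    proof -
      have "\<bar>v \<bullet> (x *v v)\<bar> \<le> norm v * (norm v * B)"
        by (intro order.trans[OF Cauchy_Schwarz_ineq2] mult_left_mono B) simp
      also have "\<dots> < norm v * (norm v * real n)"
        using that n by (intro mult_strict_left_mono) auto
      also have "\<dots> = real n * (v \<bullet> v)"
        by (simp add: dot_square_norm power2_eq_square)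
      finally show ?thesis
        by (simp add: matrix_vector_mult_add_rdistrib inner_add_right scaleR_matrix_vector_assoc[symmetric])
    qed
    then have "real n *\<^sub>R mat 1 + x \<in> PD"
      using elim(1) by (simp add: PD_iff transpose_add transpose_scalar)
    with elim(2) show ?case by blast
  qed
  then have "AE x in (sym_lborel :: 'n sqmat measure). x \<notin> cube 1"
    by eventually_elim simp
  then have "emeasure (sym_lborel :: 'n sqmat measure) (cube 1) = 0"
    by (subst (asm) AE_iff_measurable[where N="cube 1"]) auto
  then show False
    using zero_less_power[of "2::real" "card (upper :: ('n \<times> 'n) set)"]
    by (simp add: emeasure_sym_lborel_cube ennreal_eq_0_iff del: zero_less_power)
qed

lemma nn_integral_mu_pos:
  fixes f :: "'n::{finite,linorder} sqmat \<Rightarrow> ennreal"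
  assumes [measurable]: "f \<in> borel_measurable PD_space" and pos: "\<And>x. x \<in> PD \<Longrightarrow> f x \<noteq> 0"
  shows "(\<integral>\<^sup>+x. f x \<partial>mu) \<noteq> 0"
proof
  assume "(\<integral>\<^sup>+x. f x \<partial>mu) = 0"
  then have "AE x in (mu :: 'n sqmat measure). f x = 0"
    by (subst (asm) nn_integral_0_iff_AE) auto
  then have "AE x in (mu :: 'n sqmat measure). x \<notin> PD"
    using AE_space by eventually_elim (use pos in auto)
  then have "emeasure (mu :: 'n sqmat measure) PD = 0"
    by (subst (asm) AE_iff_measurable[where N=PD]) (auto simp: sets_restrict_space)
  with emeasure_mu_PD_nz show False by blast
qed

lemma nn_Gamma_nonzero: "nn_Gamma d a \<noteq> 0"
  unfolding nn_Gamma_def by (rule nn_integral_mu_pos) (auto simp: ennreal_eq_0_iff not_le zero_less_mult_iff PD_det_nz)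

text \<open>The Lebesgue integral of a nonnegative function is \<open>enn2real\<close> of the
  extended one, which sends infinity to 0; finiteness excludes this default value.\<close>

lemma matrix_Gamma_eq_nn_Gamma:
  assumes "a > (real CARD('n::{finite,linorder}) - 1) / 2"
  shows "ennreal (matrix_Gamma TYPE('n) a) = nn_Gamma TYPE('n) a"
proof -
  have "matrix_Gamma TYPE('n) a = enn2real (nn_Gamma TYPE('n) a)"
    unfolding matrix_Gamma_def nn_Gamma_def by (rule integral_eq_nn_integral) auto
  then show ?thesis
    using nn_Gamma_finite[OF assms] by simp
qed

section \<open>The Beta weight and its normalisation\<close>

definition Beta_weight :: "real \<Rightarrow> real \<Rightarrow> 'n::{finite,linorder} sqmat \<Rightarrow> real" where
  "Beta_weight a b x = det x powr a * det (mat 1 + x) powr (- (a + b))"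

lemma Beta_weight_measurable [measurable]: "Beta_weight a b \<in> borel_measurable PD_space"
  unfolding Beta_weight_def by measurable

lemma Beta_weight_pos: "x \<in> PD \<Longrightarrow> Beta_weight a b x > 0"
  using PD_det_pos[of x] PD_det_pos[OF PD_mat_1_add, of x] by (simp add: Beta_weight_def)

lemma matrix_Gamma_pos:
  assumes "a > (real CARD('n::{finite,linorder}) - 1) / 2"
  shows "matrix_Gamma TYPE('n) a > 0"
  using matrix_Gamma_eq_nn_Gamma[OF assms] nn_Gamma_nonzero[of "TYPE('n)" a] by (metis ennreal_neg not_le)

lemma parameter_sum:
  assumes "a > (real CARD('n::finite) - 1) / 2" "b > (real CARD('n) - 1) / 2"
  shows "a + b > (real CARD('n) - 1) / 2"
proof -
  define c where "c = (real CARD('n) - 1) / 2"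
  have "c \<ge> 0"
    using zero_less_card_finite[where 'a='n] by (simp add: c_def)
  with assms show ?thesis
    unfolding c_def[symmetric] by linarith
qed

lemma matrix_Beta_pos:
  assumes "a > (real CARD('n::{finite,linorder}) - 1) / 2" "b > (real CARD('n) - 1) / 2"
  shows "matrix_Beta TYPE('n) a b > 0"
proof -
  have "a + b > (real CARD('n) - 1) / 2"
    using assms by (rule parameter_sum)
  then show ?thesis
    using assms by (simp add: matrix_Beta_def matrix_Gamma_pos)
qed

locale gram_root =
  fixes w :: "'n::{finite,linorder} sqmat \<Rightarrow> 'n sqmat"
  assumes w_measurable: "w \<in> PD_space \<rightarrow>\<^sub>M GL_space"
    and gram_w: "x \<in> PD \<Longrightarrow> transpose (w x) ** w x = x"
begin

lemma w_borel [measurable]: "w \<in> borel_measurable PD_space"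
  by (rule measurable_compose[OF w_measurable measurable_restrict_space1]) simp

lemma invertible_w: "x \<in> PD \<Longrightarrow> invertible (w x)"
  using measurable_space[OF w_measurable, of x] by (simp add: space_restrict_space GLd_def)

lemma det_w: "x \<in> PD \<Longrightarrow> det (w x) * det (w x) = det x"
  using arg_cong[OF gram_w, of x det] by (simp add: det_mul)

text \<open>Substitution by the congruence with \<open>transpose (w y)\<close>: it preserves
  \<open>mu\<close>, multiplies the determinant by det y, and turns trace x into the trace of
  \<open>x ** y\<close> by cyclicity.\<close>

lemma nn_integral_laplace:
  fixes y :: "'n sqmat"
  assumes y: "y \<in> PD"
  shows "(\<integral>\<^sup>+x. ennreal (det x powr a * exp (- trace (x ** y))) \<partial>mu) = ennreal (det y powr - a) * nn_Gamma TYPE('n) a"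
proof -
  let ?g = "transpose (w y)"
  have inv: "invertible ?g"
    using invertible_w[OF y] by (simp add: invertible_det_nz)
  have "nn_Gamma TYPE('n) a = (\<integral>\<^sup>+x. ennreal (det (congr ?g x) powr a * exp (- trace (congr ?g x))) \<partial>mu)"
    unfolding nn_Gamma_def by (rule nn_integral_mu_congruence[symmetric, OF _ inv]) measurable
  also have "\<dots> = (\<integral>\<^sup>+x. ennreal (det y powr a) * ennreal (det x powr a * exp (- trace (x ** y))) \<partial>mu)"
  proof (rule nn_integral_cong)
    fix x :: "'n sqmat" assume "x \<in> space mu"
    then have x: "x \<in> PD" by simp
    have "det (congr ?g x) = det y * det x"
      using det_w[OF y] by (simp add: det_mul mult_ac)
    moreover have "trace (congr ?g x) = trace (x ** y)"
    proof -
      have "trace (congr ?g x) = trace (w y ** (x ** ?g))"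
        by (simp add: matrix_mul_assoc)
      also have "\<dots> = trace (x ** ?g ** w y)"
        by (rule trace_mul_sym)
      also have "\<dots> = trace (x ** y)"
        using gram_w[OF y] by (simp flip: matrix_mul_assoc)
      finally show ?thesis .
    qed
    ultimately show "ennreal (det (congr ?g x) powr a * exp (- trace (congr ?g x))) =
        ennreal (det y powr a) * ennreal (det x powr a * exp (- trace (x ** y)))"
      using PD_det_pos[OF x] PD_det_pos[OF y] by (simp add: powr_mult mult.assoc flip: ennreal_mult)
  qed
  also have "\<dots> = ennreal (det y powr a) * (\<integral>\<^sup>+x. ennreal (det x powr a * exp (- trace (x ** y))) \<partial>mu)"
    by (rule nn_integral_cmult) measurable
  finally have "ennreal (det y powr - a) * nn_Gamma TYPE('n) a = (ennreal (det y powr - a) * ennreal (det y powr a)) *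
      (\<integral>\<^sup>+x. ennreal (det x powr a * exp (- trace (x ** y))) \<partial>mu)"
    by (simp add: mult.assoc)
  also have "ennreal (det y powr - a) * ennreal (det y powr a) = 1"
    using PD_det_pos[OF y] by (simp flip: ennreal_mult powr_add)
  finally show ?thesis by simp
qed

text \<open>Splitting the power b of det y into a + b and -a turns the factor Gamma(a) into a
  Laplace integral at y; after Tonelli the integral over y is the Laplace integral with parameter a
  + b at I + x. The product form keeps division out of \<open>ennreal\<close>.\<close>

lemma nn_integral_Beta_weight:
  "(\<integral>\<^sup>+x. ennreal (Beta_weight a b x) \<partial>(mu :: 'n sqmat measure)) * nn_Gamma TYPE('n) (a + b) = nn_Gamma TYPE('n) a * nn_Gamma TYPE('n) b"
proof -
  interpret sigma_finite_measure "mu :: 'n sqmat measure" by (rule sigma_finite_mu)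
  interpret pair_sigma_finite "mu :: 'n sqmat measure" "mu :: 'n sqmat measure" ..
  let ?f = "\<lambda>x y :: 'n sqmat. ennreal (det y powr (a + b) * exp (- trace y)) * ennreal (det x powr a * exp (- trace (x ** y)))"
  have "nn_Gamma TYPE('n) a * nn_Gamma TYPE('n) b =
      (\<integral>\<^sup>+y. nn_Gamma TYPE('n) a * ennreal (det y powr b * exp (- trace y)) \<partial>(mu :: 'n sqmat measure))"
    unfolding nn_Gamma_def[of _ b] by (rule nn_integral_cmult[symmetric]) measurable
  also have "\<dots> = (\<integral>\<^sup>+y. \<integral>\<^sup>+x. ?f x y \<partial>mu \<partial>mu)"
  proof (rule nn_integral_cong)
    fix y :: "'n sqmat" assume "y \<in> space mu"
    then have y: "y \<in> PD" by simp
    have "det y powr b = det y powr (a + b) * det y powr - a"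
      by (simp flip: powr_add)
    then have "nn_Gamma TYPE('n) a * ennreal (det y powr b * exp (- trace y)) =
        ennreal (det y powr (a + b) * exp (- trace y)) * (ennreal (det y powr - a) * nn_Gamma TYPE('n) a)"
      by (simp add: ennreal_mult mult_ac)
    also have "\<dots> = (\<integral>\<^sup>+x. ?f x y \<partial>mu)"
      unfolding nn_integral_laplace[OF y, symmetric] by (rule nn_integral_cmult[symmetric]) measurable
    finally show "nn_Gamma TYPE('n) a * ennreal (det y powr b * exp (- trace y)) = (\<integral>\<^sup>+x. ?f x y \<partial>mu)" .
  qed
  also have "\<dots> = (\<integral>\<^sup>+x. \<integral>\<^sup>+y. ?f x y \<partial>mu \<partial>mu)"
    by (rule Fubini'[symmetric]) measurable
  also have "\<dots> = (\<integral>\<^sup>+x. ennreal (Beta_weight a b x) * nn_Gamma TYPE('n) (a + b) \<partial>(mu :: 'n sqmat measure))"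
  proof (rule nn_integral_cong)
    fix x :: "'n sqmat" assume "x \<in> space mu"
    then have x: "x \<in> PD" by simp
    have "(\<integral>\<^sup>+y. ?f x y \<partial>mu) = (\<integral>\<^sup>+y. ennreal (det x powr a) *
        ennreal (det y powr (a + b) * exp (- trace (y ** (mat 1 + x)))) \<partial>mu)"
    proof (rule nn_integral_cong)
      fix y :: "'n sqmat"
      have "trace (y ** (mat 1 + x)) = trace y + trace (x ** y)"
        by (simp add: matrix_add_ldistrib trace_add trace_mul_sym[of y x])
      then show "?f x y = ennreal (det x powr a) * ennreal (det y powr (a + b) * exp (- trace (y ** (mat 1 + x))))"
        by (simp add: exp_diff exp_minus field_simps flip: ennreal_mult)
    qed
    also have "\<dots> = ennreal (det x powr a) * (\<integral>\<^sup>+y. ennreal (det y powr (a + b) * exp (- trace (y ** (mat 1 + x)))) \<partial>mu)"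
      by (rule nn_integral_cmult) measurable
    also have "\<dots> = ennreal (Beta_weight a b x) * nn_Gamma TYPE('n) (a + b)"
      unfolding nn_integral_laplace[OF PD_mat_1_add[OF x]] Beta_weight_def by (simp add: ennreal_mult mult.assoc)
    finally show "(\<integral>\<^sup>+y. ?f x y \<partial>mu) = ennreal (Beta_weight a b x) * nn_Gamma TYPE('n) (a + b)" .
  qed
  also have "\<dots> = (\<integral>\<^sup>+x. ennreal (Beta_weight a b x) \<partial>(mu :: 'n sqmat measure)) * nn_Gamma TYPE('n) (a + b)"
    by (rule nn_integral_multc) measurable
  finally show ?thesis ..
qed

lemma nn_integral_BetaII_density:
  assumes a: "a > (real CARD('n) - 1) / 2" and b: "b > (real CARD('n) - 1) / 2"
  shows "(\<integral>\<^sup>+x. ennreal (Beta_weight a b x / matrix_Beta TYPE('n) a b) \<partial>(mu :: 'n sqmat measure)) = 1"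
proof -
  let ?I = "\<integral>\<^sup>+x. ennreal (Beta_weight a b x) \<partial>(mu :: 'n sqmat measure)" and ?G = "matrix_Gamma TYPE('n)"
  have ab: "a + b > (real CARD('n) - 1) / 2"
    using assms by (rule parameter_sum)
  note pos = matrix_Gamma_pos[OF a] matrix_Gamma_pos[OF b] matrix_Gamma_pos[OF ab]
  have B: "matrix_Beta TYPE('n) a b > 0"
    by (rule matrix_Beta_pos[OF a b])
  have "?I * ennreal (?G (a + b)) = ennreal (?G a * ?G b)"
    using nn_integral_Beta_weight[of a b] pos matrix_Gamma_eq_nn_Gamma[OF a] matrix_Gamma_eq_nn_Gamma[OF b] matrix_Gamma_eq_nn_Gamma[OF ab]
    by (simp add: ennreal_mult)
  then have "?I * (ennreal (?G (a + b)) * ennreal (1 / ?G (a + b))) = ennreal (?G a * ?G b) * ennreal (1 / ?G (a + b))"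
    by (simp add: mult.assoc[symmetric])
  also have "ennreal (?G (a + b)) * ennreal (1 / ?G (a + b)) = 1"
    using pos by (simp flip: ennreal_mult)
  also have "ennreal (?G a * ?G b) * ennreal (1 / ?G (a + b)) = ennreal (matrix_Beta TYPE('n) a b)"
    using pos by (simp add: matrix_Beta_def flip: ennreal_mult)
  finally have I: "?I = ennreal (matrix_Beta TYPE('n) a b)"
    by simp
  have "(\<integral>\<^sup>+x. ennreal (Beta_weight a b x / matrix_Beta TYPE('n) a b) \<partial>(mu :: 'n sqmat measure)) =
      (\<integral>\<^sup>+x. ennreal (1 / matrix_Beta TYPE('n) a b) * ennreal (Beta_weight a b x) \<partial>(mu :: 'n sqmat measure))"
    using B by (intro nn_integral_cong) (simp add: Beta_weight_pos less_imp_le flip: ennreal_mult)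
  also have "\<dots> = ennreal (1 / matrix_Beta TYPE('n) a b) * ?I"
    by (rule nn_integral_cmult) measurable
  also have "\<dots> = 1"
    using B unfolding I by (simp flip: ennreal_mult)
  finally show ?thesis .
qed

end

lemma BetaII_eq: "BetaII a b = density mu (\<lambda>x :: 'n::{finite,linorder} sqmat. ennreal (Beta_weight a b x / matrix_Beta TYPE('n) a b))"
  by (simp add: BetaII_def Beta_weight_def)

section \<open>The transition density of the second process\<close>

lemma sets_BetaII [simp, measurable_cong]: "sets (BetaII a b) = sets PD_space"
  by (simp add: BetaII_def)

lemma space_BetaII [simp]: "space (BetaII a b) = PD"
  by (simp add: BetaII_def)

text \<open>Since \<open>mu\<close> is invariant, no Jacobian appears: the density is just composed
  with the inverse congruence.\<close>

lemma distr_density_mu: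
  fixes g c :: "'n::{finite,linorder} sqmat"
  assumes gc: "g ** c = mat 1" and h [measurable]: "h \<in> borel_measurable PD_space"
  shows "distr (density mu h) PD_space (\<lambda>x. congr g x) = density mu (\<lambda>x. h (congr c x))"
proof -
  have cg: "c ** g = mat 1"
    using gc by (simp add: matrix_left_right_inverse)
  then have inv: "invertible g" "invertible c"
    using gc by (auto simp: invertible_def)
  note L [measurable] = measurable_congruence[OF inv(1)] measurable_congruence[OF inv(2)]
  have [measurable]: "(\<lambda>x. congr g x) \<in> mu \<rightarrow>\<^sub>M PD_space" "(\<lambda>x. h (congr c x)) \<in> borel_measurable mu"
    using L(1) measurable_compose[OF L(2) h] by (simp_all cong: measurable_cong_sets)
  have undo: "congr c (congr g x) = x" for x
    by (simp add: congr_congr gc)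
  show ?thesis
  proof (rule measure_eqI)
    fix A assume "A \<in> sets (distr (density mu h) PD_space (\<lambda>x. congr g x))"
    then have A [measurable]: "A \<in> sets PD_space" by simp
    then have A': "A \<in> sets mu" by simp
    have "emeasure (distr (density mu h) PD_space (\<lambda>x. congr g x)) A =
        (\<integral>\<^sup>+x. h x * indicator A (congr g x) \<partial>mu)"
      using A by (simp add: nn_integral_distr nn_integral_density flip: nn_integral_indicator)
    also have "\<dots> = (\<integral>\<^sup>+x. h (congr c (congr g x)) * indicator A (congr g x) \<partial>mu)"
      by (simp only: undo)
    also have "\<dots> = (\<integral>\<^sup>+x. h (congr c x) * indicator A x \<partial>mu)"
      by (rule nn_integral_mu_congruence[OF _ inv(1)]) measurable
    also have "\<dots> = emeasure (density mu (\<lambda>x. h (congr c x))) A"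
      using A' by (intro emeasure_density[symmetric]) auto
    finally show "emeasure (distr (density mu h) PD_space (\<lambda>x. congr g x)) A =
        emeasure (density mu (\<lambda>x. h (congr c x))) A" .
  qed simp
qed

lemma BetaII_O_invariant: "O_invariant (BetaII a b :: 'n::{finite,linorder} sqmat measure)"
  unfolding O_invariant_def
proof (intro allI impI)
  fix k :: "'n sqmat" assume k: "orthogonal_matrix k"
  then have kk: "k ** transpose k = mat 1"
    by (simp add: orthogonal_matrix_def)
  have "Beta_weight a b (transpose (transpose k) ** x ** transpose k) = Beta_weight a b x" for x
  proof -
    have *: "det (k ** y ** transpose k) = det y" for y
      using det_mul[of k "transpose k"] by (simp add: det_mul kk mult_ac)
    have "mat 1 + k ** x ** transpose k = k ** (mat 1 + x) ** transpose k"
      by (simp add: matrix_add_ldistrib matrix_add_rdistrib kk)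
    then show ?thesis
      by (simp add: Beta_weight_def *)
  qed
  then show "distr (BetaII a b) PD_space (\<lambda>x. congr k x) = BetaII a b"
    unfolding BetaII_eq by (subst distr_density_mu[OF kk]) auto
qed

text \<open>By Tonelli a single step gives every initial law a density with respect to
  \<open>N\<close>. An invariant law equals its own image, so it can be treated as a
  density.\<close>

lemma bind_density_kernel:
  fixes p :: "'a \<Rightarrow> 'a \<Rightarrow> ennreal"
  assumes "sigma_finite_measure N" "prob_space \<pi>" and \<pi>: "sets \<pi> = sets N"
    and p: "case_prod p \<in> borel_measurable (N \<Otimes>\<^sub>M N)"
    and K: "K \<in> N \<rightarrow>\<^sub>M subprob_algebra N" "\<And>z. z \<in> space N \<Longrightarrow> K z = density N (p z)"
  shows "\<pi> \<bind> K = density N (\<lambda>x. \<integral>\<^sup>+z. p z x \<partial>\<pi>)"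
proof -
  interpret N: sigma_finite_measure N by fact
  interpret \<pi>: prob_space \<pi> by fact
  interpret pair_sigma_finite \<pi> N ..
  note [measurable_cong] = \<pi>
  note p [measurable]
  have sp: "space \<pi> = space N" by (rule sets_eq_imp_space_eq[OF \<pi>])
  have K': "K \<in> \<pi> \<rightarrow>\<^sub>M subprob_algebra N"
    using K(1) by (simp cong: measurable_cong_sets add: \<pi>)
  show ?thesis
  proof (rule measure_eqI)
    show "sets (\<pi> \<bind> K) = sets (density N (\<lambda>x. \<integral>\<^sup>+z. p z x \<partial>\<pi>))"
      using \<pi>.not_empty by (subst sets_bind) (auto simp: K(2) sp)
  next
    fix A assume "A \<in> sets (\<pi> \<bind> K)"
    then have A [measurable]: "A \<in> sets N"
      using \<pi>.not_empty by (subst (asm) sets_bind[where N=N]) (auto simp: K(2) sp)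
    have "emeasure (\<pi> \<bind> K) A = (\<integral>\<^sup>+z. emeasure (K z) A \<partial>\<pi>)"
      using \<pi>.not_empty by (rule emeasure_bind[OF _ K' A])
    also have "\<dots> = (\<integral>\<^sup>+z. \<integral>\<^sup>+x. p z x * indicator A x \<partial>N \<partial>\<pi>)"
      by (rule nn_integral_cong) (simp add: K(2) sp emeasure_density)
    also have "\<dots> = (\<integral>\<^sup>+x. \<integral>\<^sup>+z. p z x * indicator A x \<partial>\<pi> \<partial>N)"
      by (rule Fubini'[symmetric]) measurable
    also have "\<dots> = (\<integral>\<^sup>+x. (\<integral>\<^sup>+z. p z x \<partial>\<pi>) * indicator A x \<partial>N)"
      by (rule nn_integral_cong) (simp add: nn_integral_multc)
    also have "\<dots> = emeasure (density N (\<lambda>x. \<integral>\<^sup>+z. p z x \<partial>\<pi>)) A"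
      by (rule emeasure_density[symmetric]) measurable
    finally show "emeasure (\<pi> \<bind> K) A = emeasure (density N (\<lambda>x. \<integral>\<^sup>+z. p z x \<partial>\<pi>)) A" .
  qed
qed

text \<open>Detailed balance integrates to invariance of \<open>h\<close>. Conversely an invariant
  \<pi> has a density \<open>q\<close> that solves the same fixed-point equation, and
  \<open>unique_invariant_density\<close> identifies it with \<open>h\<close>.\<close>

theorem invariant_iff_density:
  fixes p :: "'a \<Rightarrow> 'a \<Rightarrow> ennreal"
  assumes "sigma_finite_measure N"
    and p: "case_prod p \<in> borel_measurable (N \<Otimes>\<^sub>M N)"
    and pos: "\<And>x y. x \<in> space N \<Longrightarrow> y \<in> space N \<Longrightarrow> p x y > 0"
    and mass: "\<And>x. x \<in> space N \<Longrightarrow> (\<integral>\<^sup>+y. p x y \<partial>N) = 1"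
    and K: "K \<in> N \<rightarrow>\<^sub>M subprob_algebra N" "\<And>z. z \<in> space N \<Longrightarrow> K z = density N (p z)"
    and h: "h \<in> borel_measurable N" "(\<integral>\<^sup>+x. h x \<partial>N) = 1"
    and reversible: "\<And>x y. x \<in> space N \<Longrightarrow> y \<in> space N \<Longrightarrow> h x * p x y = h y * p y x"
  shows "prob_space \<pi> \<and> sets \<pi> = sets N \<and> \<pi> \<bind> K = \<pi> \<longleftrightarrow> \<pi> = density N h"
proof -
  interpret N: sigma_finite_measure N by fact
  note p [measurable] note h(1) [measurable]
  have hP: "(\<integral>\<^sup>+z. h z * p z x \<partial>N) = h x" if x: "x \<in> space N" for x
  proof -
    have "(\<integral>\<^sup>+z. h z * p z x \<partial>N) = (\<integral>\<^sup>+z. h x * p x z \<partial>N)"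
      using x by (intro nn_integral_cong reversible)
    also have "\<dots> = h x * (\<integral>\<^sup>+z. p x z \<partial>N)"
      using x by (intro nn_integral_cmult) measurable
    finally show ?thesis
      using mass[OF x] by simp
  qed
  show ?thesis
  proof
    assume \<pi>: "\<pi> = density N h"
    have "prob_space \<pi>"
      using h by (intro prob_spaceI) (simp add: \<pi> emeasure_density cong: nn_integral_cong)
    moreover have "\<pi> \<bind> K = \<pi>"
    proof -
      have "\<pi> \<bind> K = density N (\<lambda>x. \<integral>\<^sup>+z. p z x \<partial>\<pi>)"
        by (rule bind_density_kernel[OF assms(1) \<open>prob_space \<pi>\<close> _ p K]) (simp add: \<pi>)
      also have "\<dots> = density N h"
      proof (rule density_cong)
        show "AE x in N. (\<integral>\<^sup>+z. p z x \<partial>\<pi>) = h x"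
          unfolding \<pi> by (rule AE_I2) (simp add: nn_integral_density hP)
        interpret \<pi>: prob_space \<pi> by fact
        have [measurable_cong]: "sets \<pi> = sets N" by (simp add: \<pi>)
        show "(\<lambda>x. \<integral>\<^sup>+z. p z x \<partial>\<pi>) \<in> borel_measurable N"
          by measurable
      qed fact
      finally show ?thesis
        by (simp add: \<pi>)
    qed
    ultimately show "prob_space \<pi> \<and> sets \<pi> = sets N \<and> \<pi> \<bind> K = \<pi>"
      by (simp add: \<pi>)
  next
    assume *: "prob_space \<pi> \<and> sets \<pi> = sets N \<and> \<pi> \<bind> K = \<pi>"
    then interpret \<pi>: prob_space \<pi> by simp
    have [measurable_cong]: "sets \<pi> = sets N" using * by simp
    define q where "q x = (\<integral>\<^sup>+z. p z x \<partial>\<pi>)" for x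
    have [measurable]: "q \<in> borel_measurable N"
      unfolding q_def by measurable
    have \<pi>: "\<pi> = density N q"
      using bind_density_kernel[OF assms(1) \<pi>.prob_space_axioms _ p K] * by (simp add: q_def[abs_def])
    have q_int: "(\<integral>\<^sup>+x. q x \<partial>N) = 1"
    proof -
      have "(\<integral>\<^sup>+x. q x \<partial>N) = emeasure (density N q) (space N)"
        by (simp add: emeasure_density cong: nn_integral_cong)
      also have "\<dots> = emeasure \<pi> (space \<pi>)"
        using \<pi> by simp
      finally show ?thesis
        by (simp add: \<pi>.emeasure_space_1)
    qed
    have "q x = (\<integral>\<^sup>+z. q z * p z x \<partial>N)" if "x \<in> space N" for x
    proof -
      have "q x = (\<integral>\<^sup>+z. p z x \<partial>density N q)"
        unfolding \<pi>[symmetric] by (simp add: q_def)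
      then show ?thesis
        using that by (subst (asm) nn_integral_density) auto
    qed
    then have AE_q: "AE x in N. q x = (\<integral>\<^sup>+z. q z * p z x \<partial>N)"
      by (rule AE_I2)
    have AE_h: "AE x in N. h x = (\<integral>\<^sup>+z. h z * p z x \<partial>N)"
      by (rule AE_I2) (rule hP[symmetric])
    have "AE x in N. q x = h x"
      by (rule unique_invariant_density[OF assms(1) p pos mass \<open>q \<in> borel_measurable N\<close> h(1) q_int h(2) AE_q AE_h])
    then show "\<pi> = density N h"
      unfolding \<pi> by (intro density_cong) auto
  qed
qed

lemma emeasure_density_space:
  assumes "f \<in> borel_measurable N"
  shows "emeasure (density N f) (space N) = (\<integral>\<^sup>+x. f x \<partial>N)"
proof -
  have "emeasure (density N f) (space N) = (\<integral>\<^sup>+x. f x * indicator (space N) x \<partial>N)"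
    using assms by (rule emeasure_density) simp
  also have "\<dots> = (\<integral>\<^sup>+x. f x \<partial>N)"
    by (rule nn_integral_cong) simp
  finally show ?thesis .
qed

lemma emeasure_density_PD:
  "f \<in> borel_measurable mu \<Longrightarrow> emeasure (density mu f) PD = (\<integral>\<^sup>+x. f x \<partial>mu)"
  using emeasure_density_space[of f mu] by simp

text \<open>A matrix Beta type II density rescaled by I + z. The root of I + z affects the law of a
  step only through its Gram matrix, so no \<open>w\<close> appears.\<close>

definition xi'_density :: "real \<Rightarrow> real \<Rightarrow> 'n::{finite,linorder} sqmat \<Rightarrow> 'n sqmat \<Rightarrow> real" where
  "xi'_density a b z x =
    det x powr a * det (mat 1 + z) powr b * det (mat 1 + z + x) powr (- (a + b)) / matrix_Beta TYPE('n) a b"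

context gram_root
begin

lemma prob_space_BetaII:
  assumes "a > (real CARD('n) - 1) / 2" "b > (real CARD('n) - 1) / 2"
  shows "prob_space (BetaII a b :: 'n sqmat measure)"
proof (rule prob_spaceI)
  have "emeasure (BetaII a b :: 'n sqmat measure) PD = 1"
    unfolding BetaII_eq using nn_integral_BetaII_density[OF assms] by (subst emeasure_density_PD) auto
  then show "emeasure (BetaII a b :: 'n sqmat measure) (space (BetaII a b)) = 1"
    by simp
qed

lemma T_in_PD: "y \<in> PD \<Longrightarrow> x \<in> PD \<Longrightarrow> T w y x \<in> PD"
  by (simp add: T_def PD_congruence invertible_w)

lemma T_measurable: "case_prod (T w) \<in> PD_space \<Otimes>\<^sub>M PD_space \<rightarrow>\<^sub>M PD_space"
proof (rule measurable_restrict_space2)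
  show "case_prod (T w) \<in> space (PD_space \<Otimes>\<^sub>M PD_space) \<rightarrow> PD"
    by (auto simp: space_pair_measure space_restrict_space T_in_PD)
  have [measurable]: "(\<lambda>p. w (fst p)) \<in> borel_measurable (PD_space \<Otimes>\<^sub>M PD_space)"
    by (rule measurable_compose[OF measurable_fst w_borel])
  show "case_prod (T w) \<in> borel_measurable (PD_space \<Otimes>\<^sub>M PD_space)"
    unfolding T_def case_prod_beta' by measurable
qed

lemma mat_1_add_measurable: "(\<lambda>z. mat 1 + z) \<in> PD_space \<rightarrow>\<^sub>M PD_space"
  by (rule measurable_restrict_space2) (auto simp: space_restrict_space PD_mat_1_add)

lemma T_flip_measurable: "case_prod (\<lambda>y x. T w x y) \<in> PD_space \<Otimes>\<^sub>M PD_space \<rightarrow>\<^sub>M PD_space"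
  using measurable_compose[OF measurable_pair_swap' T_measurable] by (simp add: case_prod_beta')

lemma step_measurable:
  assumes "case_prod F \<in> PD_space \<Otimes>\<^sub>M PD_space \<rightarrow>\<^sub>M PD_space"
  shows "case_prod (\<lambda>z. F (mat 1 + z)) \<in> PD_space \<Otimes>\<^sub>M PD_space \<rightarrow>\<^sub>M PD_space"
proof -
  have "(\<lambda>p. (mat 1 + fst p, snd p)) \<in> PD_space \<Otimes>\<^sub>M PD_space \<rightarrow>\<^sub>M PD_space \<Otimes>\<^sub>M PD_space"
    using measurable_compose[OF measurable_fst mat_1_add_measurable] by measurable
  from measurable_compose[OF this assms] show ?thesis
    by (simp add: case_prod_beta')
qed

text \<open>If c inverts the root g of I + z, then the congruence by c takes I + z to I, so the
  determinant of I + \<open>congr c x\<close> is det (I + z + x) / det (I + z). The exponents of det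
  (I + z) add up to -a + (a + b) = b.\<close>

lemma xi'_kernel_density:
  assumes z: "z \<in> PD"
  shows "distr (BetaII a b) PD_space (T w (mat 1 + z)) = density mu (\<lambda>x. ennreal (xi'_density a b z x))"
proof -
  let ?y = "mat 1 + z"
  define g where "g = w ?y"
  have y: "?y \<in> PD" by (rule PD_mat_1_add[OF z])
  obtain c where c: "g ** c = mat 1"
    using invertible_w[OF y] by (auto simp: g_def invertible_def)
  have gram: "transpose g ** g = ?y"
    unfolding g_def by (rule gram_w[OF y])
  have detc: "det c * det c * det ?y = 1"
  proof -
    have "det c * det c * det ?y = (det g * det c) * (det g * det c)"
      unfolding gram[symmetric] by (simp add: det_mul)
    also have "det g * det c = 1"
      by (simp add: c flip: det_mul)
    finally show ?thesis by simp
  qed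
  have "Beta_weight a b (congr c x) = det x powr a * det ?y powr b * det (?y + x) powr (- (a + b))"
    if x: "x \<in> PD" for x
  proof -
    have pos: "det x > 0" "det ?y > 0" "det (?y + x) > 0"
      using x y by (auto intro!: PD_det_pos PD_add)
    have dc: "det (congr c u) = det u / det ?y" for u
      using detc pos by (simp add: det_mul field_simps)
    have "congr c ?y = transpose (g ** c) ** (g ** c)"
      unfolding gram[symmetric] by (simp add: matrix_transpose_mul matrix_mul_assoc)
    then have "mat 1 + congr c x = congr c (?y + x)"
      by (simp only: matrix_add_ldistrib matrix_add_rdistrib c) simp
    then have "Beta_weight a b (congr c x) = (det x / det ?y) powr a * (det (?y + x) / det ?y) powr (- (a + b))"
      by (simp add: Beta_weight_def dc)
    also have "\<dots> = det x powr a * det (?y + x) powr (- (a + b)) / (det ?y powr a * det ?y powr (- (a + b)))"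
      using pos by (simp add: powr_divide)
    also have "det ?y powr a * det ?y powr (- (a + b)) = det ?y powr (- b)"
      by (simp flip: powr_add)
    finally show ?thesis
      by (simp add: powr_minus field_simps)
  qed
  note eq = this
  have "distr (BetaII a b) PD_space (T w ?y) = distr (BetaII a b) PD_space (\<lambda>x. congr g x)"
    by (simp add: T_def[abs_def] g_def)
  also have "\<dots> = density mu (\<lambda>x. ennreal (Beta_weight a b (congr c x) / matrix_Beta TYPE('n) a b))"
    unfolding BetaII_eq by (rule distr_density_mu[OF c]) measurable
  also have "\<dots> = density mu (\<lambda>x. ennreal (xi'_density a b z x))"
  proof (rule density_cong)
    have "invertible c"
      using c by (auto simp: invertible_def matrix_left_right_inverse)
    from measurable_compose[OF measurable_congruence[OF this] Beta_weight_measurable]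
    have [measurable]: "(\<lambda>x. Beta_weight a b (congr c x)) \<in> borel_measurable mu"
      by (simp cong: measurable_cong_sets)
    show "(\<lambda>x. ennreal (Beta_weight a b (congr c x) / matrix_Beta TYPE('n) a b)) \<in> borel_measurable mu"
      by measurable
    show "(\<lambda>x. ennreal (xi'_density a b z x)) \<in> borel_measurable mu"
      unfolding xi'_density_def by measurable
  qed (auto simp: eq xi'_density_def)
  finally show ?thesis .
qed

lemma kernel_measurable:
  assumes F: "case_prod F \<in> PD_space \<Otimes>\<^sub>M PD_space \<rightarrow>\<^sub>M PD_space"
    and "prob_space \<rho>" "sets \<rho> = sets PD_space"
  shows "(\<lambda>z. distr \<rho> PD_space (F z)) \<in> PD_space \<rightarrow>\<^sub>M subprob_algebra PD_space"
proof (rule measurable_distr2[OF F])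
  show "(\<lambda>_. \<rho>) \<in> PD_space \<rightarrow>\<^sub>M subprob_algebra PD_space"
    using prob_space.M_in_subprob[OF assms(2)] subprob_algebra_cong[OF assms(3)] by simp
qed

text \<open>For the parameters a and b - a the Beta weight carries the power -b of det (I + z),
  which cancels the power b in the kernel; what remains is symmetric in the two states.\<close>

theorem xi'_one_step_iff:
  assumes a: "a > (real CARD('n) - 1) / 2" and b: "b - a > (real CARD('n) - 1) / 2"
  shows "prob_space \<pi> \<and> sets \<pi> = sets PD_space \<and>
      \<pi> \<bind> (\<lambda>z. distr (BetaII a b) PD_space (T w (mat 1 + z))) = \<pi> \<longleftrightarrow> \<pi> = BetaII a (b - a)"
proof -
  have b': "b > (real CARD('n) - 1) / 2"
    using parameter_sum[OF a b] by simp
  let ?B = "matrix_Beta TYPE('n)" and ?K = "\<lambda>z. distr (BetaII a b) PD_space (T w (mat 1 + z))"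
  interpret prob_space "BetaII a b :: 'n sqmat measure"
    by (rule prob_space_BetaII[OF a b'])
  have B: "?B a b > 0" "?B a (b - a) > 0"
    by (rule matrix_Beta_pos[OF a b'] matrix_Beta_pos[OF a b])+
  have det_pos: "det x > 0" "det (mat 1 + x) > 0" "det (mat 1 + x + y) > 0" if "x \<in> PD" "y \<in> PD" for x y :: "'n sqmat"
    using that by (auto intro!: PD_det_pos PD_add PD_mat_1)
  have K: "?K \<in> PD_space \<rightarrow>\<^sub>M subprob_algebra PD_space"
    using kernel_measurable[OF step_measurable[OF T_measurable] prob_space_axioms] by simp
  have K': "?K \<in> mu \<rightarrow>\<^sub>M subprob_algebra mu"
    using K unfolding measurable_cong_sets[OF sets_mu refl] subprob_algebra_cong[OF sets_mu] .
  show ?thesis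
    unfolding BetaII_eq[of a "b - a"] sets_mu[symmetric]
  proof (rule invariant_iff_density[where p="\<lambda>z x. ennreal (xi'_density a b z x)"])
    show "(\<lambda>(z, x). ennreal (xi'_density a b z x)) \<in> borel_measurable (mu \<Otimes>\<^sub>M mu)"
      unfolding xi'_density_def by measurable
    show "0 < ennreal (xi'_density a b z x)" if "z \<in> space mu" "x \<in> space mu" for z x :: "'n sqmat"
      using det_pos[of z x] det_pos[of x z] that B by (simp add: xi'_density_def)
    show "(\<integral>\<^sup>+x. ennreal (xi'_density a b z x) \<partial>mu) = 1" if z: "z \<in> space mu" for z :: "'n sqmat"
    proof -
      have z': "z \<in> PD" using z by simp
      \<comment> \<open>The density belongs to the image of a probability measure, so its mass is 1
        and no integral has to be computed.\<close>
      have "T w (mat 1 + z) \<in> BetaII a b \<rightarrow>\<^sub>M PD_space"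
        using measurable_compose_Pair1[of z, OF _ step_measurable[OF T_measurable]] z'
        by (simp add: space_restrict_space cong: measurable_cong_sets)
      from prob_space_distr[OF this] have "prob_space (?K z)" .
      then have "emeasure (density mu (\<lambda>x. ennreal (xi'_density a b z x))) PD = 1"
        unfolding xi'_kernel_density[OF z'] using prob_space.emeasure_space_1 by fastforce
      moreover have "(\<lambda>x. ennreal (xi'_density a b z x)) \<in> borel_measurable mu"
        unfolding xi'_density_def by measurable
      ultimately show ?thesis
        by (simp add: emeasure_density_PD)
    qed
    show "?K z = density mu (\<lambda>x. ennreal (xi'_density a b z x))" if "z \<in> space mu" for z
      using that by (simp add: xi'_kernel_density)
    show "(\<lambda>x. ennreal (Beta_weight a (b - a) x / ?B a (b - a))) \<in> borel_measurable (mu :: 'n sqmat measure)"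
      by measurable
    show "(\<integral>\<^sup>+x. ennreal (Beta_weight a (b - a) x / ?B a (b - a)) \<partial>(mu :: 'n sqmat measure)) = 1"
      by (rule nn_integral_BetaII_density[OF a b])
    show "ennreal (Beta_weight a (b - a) x / ?B a (b - a)) * ennreal (xi'_density a b x y) =
        ennreal (Beta_weight a (b - a) y / ?B a (b - a)) * ennreal (xi'_density a b y x)"
      if "x \<in> space mu" "y \<in> space mu" for x y :: "'n sqmat"
    proof -
      have xy: "x \<in> PD" "y \<in> PD" using that by auto
      have eq: "Beta_weight a (b - a) u * xi'_density a b u v =
          det u powr a * det v powr a * det (mat 1 + u + v) powr (- (a + b)) / ?B a b" if "u \<in> PD" "v \<in> PD" for u v :: "'n sqmat"
      proof -
        have "det (mat 1 + u) powr (- b) * det (mat 1 + u) powr b = 1"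
          using det_pos(2)[OF that] by (simp flip: powr_add)
        moreover have "Beta_weight a (b - a) u * xi'_density a b u v = (det (mat 1 + u) powr (- b) * det (mat 1 + u) powr b) *
            (det u powr a * det v powr a * det (mat 1 + u + v) powr (- (a + b)) / ?B a b)"
          by (simp add: Beta_weight_def xi'_density_def)
        ultimately show ?thesis
          by simp
      qed
      have "Beta_weight a (b - a) x * xi'_density a b x y = Beta_weight a (b - a) y * xi'_density a b y x"
        unfolding eq[OF xy] eq[OF xy(2,1)] by (simp add: ac_simps)
      then have "Beta_weight a (b - a) x / ?B a (b - a) * xi'_density a b x y =
          Beta_weight a (b - a) y / ?B a (b - a) * xi'_density a b y x"
        by (simp add: field_simps)
      moreover have "Beta_weight a (b - a) x / ?B a (b - a) \<ge> 0" "Beta_weight a (b - a) y / ?B a (b - a) \<ge> 0"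
        using B xy by (auto simp: Beta_weight_pos less_imp_le)
      ultimately show ?thesis
        by (metis ennreal_mult')
    qed
  qed (rule sigma_finite_mu K')+
qed

end

section \<open>Haar measure on the orthogonal group\<close>

abbreviation O_space :: "(real^'n^'n) measure" where
  "O_space \<equiv> restrict_space borel {k. orthogonal_matrix k}"

text \<open>Cramer's rule gives entries that are quotients of determinants, so Borel measurability
  is immediate; the value at a singular matrix is 0.\<close>

definition cramer_inverse :: "real^'n^'n \<Rightarrow> real^'n^'n" where
  "cramer_inverse A = (\<chi> k j. det (\<chi> i l. if l = k then mat 1 $ i $ j else A $ i $ l) / det A)"

lemma cramer_inverse:
  assumes "det A \<noteq> 0"
  shows "A ** cramer_inverse A = mat 1"
proof -
  have "A *v column j (cramer_inverse A) = column j (mat 1)" for j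
    unfolding cramer[OF assms] by (simp add: column_def cramer_inverse_def cong: if_cong)
  moreover have "column j (A ** B) = A *v column j B" for B :: "real^'a^'a" and j
    by (simp add: column_def matrix_matrix_mult_def matrix_vector_mult_def)
  ultimately have "column j (A ** cramer_inverse A) = column j (mat 1)" for j
    by simp
  then have "(A ** cramer_inverse A) $ i $ j = mat 1 $ i $ j" for i j
    by (simp add: column_def vec_eq_iff)
  then show ?thesis
    by (simp add: vec_eq_iff)
qed

lemma cramer_inverse_measurable [measurable (raw)]:
  fixes f :: "'a \<Rightarrow> real^'n^'n"
  assumes [measurable]: "f \<in> borel_measurable M"
  shows "(\<lambda>x. cramer_inverse (f x)) \<in> borel_measurable M"
proof (rule borel_measurable_matrixI)
  fix k j
  have [measurable]: "(\<lambda>x. (\<chi> i l. if l = k then mat 1 $ i $ j else f x $ i $ l) :: real^'n^'n) \<in> borel_measurable M"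
  proof (rule borel_measurable_matrixI)
    fix i l
    show "(\<lambda>x. ((\<chi> i l. if l = k then mat 1 $ i $ j else f x $ i $ l) :: real^'n^'n) $ i $ l) \<in> borel_measurable M"
      by (cases "l = k") auto
  qed
  show "(\<lambda>x. cramer_inverse (f x) $ k $ j) \<in> borel_measurable M"
    unfolding cramer_inverse_def vec_lambda_beta by measurable
qed

section \<open>Left multiplication by orthogonal matrices\<close>

lemma trace_gram: "trace (transpose g ** g) = (norm g)\<^sup>2" for g :: "real^'n^'n"
  unfolding power2_norm_eq_inner
  by (simp add: trace_def matrix_matrix_mult_def transpose_def inner_vec_def) (rule sum.swap)

lemma orthogonal_gram:
  fixes u g :: "real^'n^'n"
  assumes "orthogonal_matrix u"
  shows "transpose (u ** g) ** (u ** g) = transpose g ** g"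
proof -
  have "transpose (u ** g) ** (u ** g) = congr g (transpose u ** u)"
    by (simp add: matrix_transpose_mul matrix_mul_assoc)
  then show ?thesis
    using assms by (simp add: orthogonal_matrix_def)
qed

lemma norm_orthogonal_mult:
  fixes u g :: "real^'n^'n"
  assumes "orthogonal_matrix u"
  shows "norm (u ** g) = norm g"
  using orthogonal_gram[OF assms, of g] by (metis norm_ge_zero power2_eq_imp_eq trace_gram)

text \<open>The ratio lemma with the unit ball as reference set: left multiplication by
  \<open>u\<close> preserves the Euclidean norm of matrices, hence the ball, so the factor is
  1.\<close>

lemma nn_integral_lborel_orthogonal:
  fixes u :: "real^'n^'n" and f :: "real^'n^'n \<Rightarrow> ennreal"
  assumes u: "orthogonal_matrix u" and f: "f \<in> borel_measurable borel"
  shows "(\<integral>\<^sup>+g. f (u ** g) \<partial>lborel) = (\<integral>\<^sup>+g. f g \<partial>lborel)"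
proof -
  let ?b = "\<lambda>g::real^'n^'n. indicator (ball 0 1) g :: ennreal"
  have b_meas: "?b \<in> borel_measurable borel"
    by (intro borel_measurable_indicator) simp
  have uu: "u ** transpose u = mat 1"
    using u by (simp add: orthogonal_matrix_def)
  have lin: "linear (\<lambda>g. u ** g)"
    by (intro linearI) (simp_all add: matrix_add_ldistrib scalar_matrix_assoc matrix_scalar_ac)
  have "range (\<lambda>g. u ** g) = UNIV"
    using uu by (metis matrix_mul_assoc matrix_mul_lid surjI)
  moreover have "(\<integral>\<^sup>+x. f (s + x) \<partial>lborel) = (\<integral>\<^sup>+x. f x \<partial>lborel)"
    if "f \<in> borel_measurable borel" for f :: "real^'n^'n \<Rightarrow> ennreal" and s
    using that by (subst (2) lborel_distr_plus[of s, symmetric]) (simp add: nn_integral_distr)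
  moreover have "(\<integral>\<^sup>+x. f (- x) \<partial>lborel) = (\<integral>\<^sup>+x. f x \<partial>lborel)"
    if "f \<in> borel_measurable borel" for f :: "real^'n^'n \<Rightarrow> ennreal"
    using that by (subst (2) lborel_affine[of "-1" 0]) (simp_all add: nn_integral_density nn_integral_distr)
  ultimately have "(\<integral>\<^sup>+g. f (u ** g) \<partial>lborel) * (\<integral>\<^sup>+g. ?b g \<partial>lborel) =
      (\<integral>\<^sup>+g. ?b (u ** g) \<partial>lborel) * (\<integral>\<^sup>+g. f g \<partial>lborel)"
    using f lin b_meas by (intro nn_integral_linear_ratio[where S=UNIV] lborel.sigma_finite_measure_axioms) auto
  also have "(\<integral>\<^sup>+g. ?b (u ** g) \<partial>lborel) = (\<integral>\<^sup>+g. ?b g \<partial>lborel)"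
    by (simp add: indicator_def norm_orthogonal_mult[OF u])
  finally have "(\<integral>\<^sup>+g. ?b g \<partial>lborel) * (\<integral>\<^sup>+g. f (u ** g) \<partial>lborel) = (\<integral>\<^sup>+g. ?b g \<partial>lborel) * (\<integral>\<^sup>+g. f g \<partial>lborel)"
    by (simp only: mult.commute)
  moreover have "(\<integral>\<^sup>+g. ?b g \<partial>lborel) \<noteq> top"
    using emeasure_bounded_finite[of "ball 0 1 :: (real^'n^'n) set"] by simp
  moreover have "(\<integral>\<^sup>+g. ?b g \<partial>lborel) \<noteq> 0"
  proof -
    have "ball 0 1 \<notin> null_sets (lborel :: (real^'n^'n) measure)"
      using open_not_negligible[of "ball 0 1 :: (real^'n^'n) set"]
      by (auto simp: negligible_iff_null_sets null_sets_completion_iff)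
    then show ?thesis
      by (auto simp: null_sets_def)
  qed
  ultimately show ?thesis
    unfolding ennreal_mult_cancel_left by blast
qed

text \<open>Left invariance is what the construction delivers; invariance under transposition and
  under right multiplication is derived from it.\<close>

locale haar_orthogonal = prob_space \<kappa> for \<kappa> :: "(real^'n^'n) measure" +
  assumes sets_haar [measurable_cong]: "sets \<kappa> = sets O_space"
    and haar_left: "f \<in> borel_measurable O_space \<Longrightarrow> orthogonal_matrix u \<Longrightarrow>
      (\<integral>\<^sup>+k. f (u ** k) \<partial>\<kappa>) = (\<integral>\<^sup>+k. f k \<partial>\<kappa>)"
begin

lemma space_haar: "space \<kappa> = {k. orthogonal_matrix k}"
  using sets_eq_imp_space_eq[OF sets_haar] by (simp add: space_restrict_space)

lemma O_space_ident: "(\<lambda>k. k) \<in> borel_measurable O_space"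
  by (rule measurable_restrict_space1) simp

lemma O_space_mult:
  assumes "f \<in> N \<rightarrow>\<^sub>M O_space" "g \<in> N \<rightarrow>\<^sub>M O_space"
  shows "(\<lambda>x. f x ** g x :: real^'n^'n) \<in> N \<rightarrow>\<^sub>M O_space"
proof (rule measurable_restrict_space2)
  have [measurable]: "f \<in> borel_measurable N" "g \<in> borel_measurable N"
    using assms by (auto intro: measurable_compose[OF _ O_space_ident])
  show "(\<lambda>x. f x ** g x) \<in> borel_measurable N"
    by measurable
  show "(\<lambda>x. f x ** g x) \<in> space N \<rightarrow> {k. orthogonal_matrix k}"
    using assms[THEN measurable_space] by (auto simp: space_restrict_space intro!: orthogonal_matrix_mul)
qed

lemma O_space_transpose:
  assumes "f \<in> N \<rightarrow>\<^sub>M O_space"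
  shows "(\<lambda>x. transpose (f x) :: real^'n^'n) \<in> N \<rightarrow>\<^sub>M O_space"
proof (rule measurable_restrict_space2)
  have [measurable]: "f \<in> borel_measurable N"
    using assms by (auto intro: measurable_compose[OF _ O_space_ident])
  show "(\<lambda>x. transpose (f x)) \<in> borel_measurable N"
    by measurable
  show "(\<lambda>x. transpose (f x)) \<in> space N \<rightarrow> {k. orthogonal_matrix k}"
    using assms[THEN measurable_space] by (auto simp: space_restrict_space)
qed

text \<open>The double integral of \<open>f (transpose l ** k)\<close> is computed in both orders.
  Over k, left invariance removes \<open>transpose l\<close>; over l, the argument is the transpose
  of \<open>transpose k ** l\<close>, and left invariance removes k.\<close>

lemma haar_transpose:
  assumes f [measurable]: "f \<in> borel_measurable O_space"
  shows "(\<integral>\<^sup>+k. f (transpose k) \<partial>\<kappa>) = (\<integral>\<^sup>+k. f k \<partial>\<kappa>)"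
proof -
  interpret pair_sigma_finite \<kappa> \<kappa> ..
  have fst: "fst \<in> \<kappa> \<Otimes>\<^sub>M \<kappa> \<rightarrow>\<^sub>M O_space" and snd: "snd \<in> \<kappa> \<Otimes>\<^sub>M \<kappa> \<rightarrow>\<^sub>M O_space"
    by measurable
  have m: "(\<lambda>(l, k). f (transpose l ** k)) \<in> borel_measurable (\<kappa> \<Otimes>\<^sub>M \<kappa>)"
    using measurable_compose[OF O_space_mult[OF O_space_transpose[OF fst] snd] f] by (simp add: case_prod_beta')
  have "(\<integral>\<^sup>+k. f k \<partial>\<kappa>) = (\<integral>\<^sup>+l. (\<integral>\<^sup>+k. f k \<partial>\<kappa>) \<partial>\<kappa>)"
    by (simp add: emeasure_space_1)
  also have "\<dots> = (\<integral>\<^sup>+l. \<integral>\<^sup>+k. f (transpose l ** k) \<partial>\<kappa> \<partial>\<kappa>)"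
    by (intro nn_integral_cong haar_left[symmetric] f) (simp add: space_haar)
  also have "\<dots> = (\<integral>\<^sup>+k. \<integral>\<^sup>+l. f (transpose l ** k) \<partial>\<kappa> \<partial>\<kappa>)"
    by (rule Fubini'[symmetric, OF m])
  also have "\<dots> = (\<integral>\<^sup>+k. \<integral>\<^sup>+l. f (transpose l) \<partial>\<kappa> \<partial>\<kappa>)"
  proof (rule nn_integral_cong)
    fix k assume "k \<in> space \<kappa>"
    then have k: "orthogonal_matrix (transpose k)" by (simp add: space_haar)
    have "(\<lambda>l. f (transpose l)) \<in> borel_measurable O_space"
      by (rule measurable_compose[OF O_space_transpose f]) measurable
    from haar_left[OF this k] show "(\<integral>\<^sup>+l. f (transpose l ** k) \<partial>\<kappa>) = (\<integral>\<^sup>+l. f (transpose l) \<partial>\<kappa>)"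
      by (simp add: matrix_transpose_mul)
  qed
  also have "\<dots> = (\<integral>\<^sup>+l. f (transpose l) \<partial>\<kappa>)"
    by (simp add: emeasure_space_1)
  finally show ?thesis ..
qed

text \<open>Left invariance conjugated by transposition.\<close>

lemma haar_right:
  assumes f [measurable]: "f \<in> borel_measurable O_space" and u: "orthogonal_matrix u"
  shows "(\<integral>\<^sup>+k. f (k ** u) \<partial>\<kappa>) = (\<integral>\<^sup>+k. f k \<partial>\<kappa>)"
proof -
  have cu: "(\<lambda>_. u) \<in> O_space \<rightarrow>\<^sub>M O_space"
    using u by (intro measurable_const) (simp add: space_restrict_space)
  have id: "(\<lambda>k. k) \<in> O_space \<rightarrow>\<^sub>M O_space" by measurable
  have "(\<lambda>k. f (k ** u)) \<in> borel_measurable O_space"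
    by (rule measurable_compose[OF O_space_mult[OF id cu] f])
  from haar_transpose[OF this] have "(\<integral>\<^sup>+k. f (k ** u) \<partial>\<kappa>) = (\<integral>\<^sup>+k. f (transpose (transpose u ** k)) \<partial>\<kappa>)"
    by (simp add: matrix_transpose_mul)
  also have "\<dots> = (\<integral>\<^sup>+k. f (transpose k) \<partial>\<kappa>)"
    using u by (intro haar_left[of "\<lambda>k. f (transpose k)"] measurable_compose[OF O_space_transpose[OF id] f]) simp
  also have "\<dots> = (\<integral>\<^sup>+k. f k \<partial>\<kappa>)"
    by (rule haar_transpose[OF f])
  finally show ?thesis .
qed

end

text \<open>The Haar measure is the law of the orthogonal factor \<open>k\<close> in \<open>g = k ** w (transpose g ** g)\<close>
  when \<open>g\<close> is uniformly distributed on the unit ball, up to the null set of singular matrices.\<close>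

lemma (in gram_root) haar_orthogonal_exists: "\<exists>\<kappa>. haar_orthogonal (\<kappa> :: 'n sqmat measure)"
proof -
  \<comment> \<open>Open, bounded and nonempty, so of positive finite volume; excluding singular
    matrices puts the Gram matrices into \<open>PD\<close>.\<close>
  define B :: "'n sqmat set" where "B = {g. det g \<noteq> 0 \<and> norm g < 1}"
  define e where "e = emeasure lborel B"
  have B_eq: "B = ball 0 1 \<inter> {g. det g \<noteq> 0}"
    by (auto simp: B_def)
  have "open B"
    unfolding B_eq by (intro open_Int open_ball open_Collect_neq continuous_intros)
  then have B [measurable]: "B \<in> sets borel" by simp
  \<comment> \<open>The identity has norm sqrt d, which is below d + 1; this scaling yields an
    explicit point of \<open>B\<close>.\<close>
  have "(1 / (real CARD('n) + 1)) *\<^sub>R mat 1 \<in> B"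
  proof -
    have "(norm (mat 1 :: 'n sqmat))\<^sup>2 = real CARD('n)"
      by (simp add: trace_gram[symmetric] trace_I)
    also have "\<dots> < (real CARD('n) + 1)\<^sup>2"
      by (simp add: power2_eq_square algebra_simps add_strict_increasing)
    finally have "norm (mat 1 :: 'n sqmat) < real CARD('n) + 1"
      by (rule power_less_imp_less_base) simp
    moreover have "det ((1 / (real CARD('n) + 1)) *\<^sub>R mat 1 :: 'n sqmat) \<noteq> 0"
      by (subst det_diagonal) (auto simp: mat_def)
    ultimately show ?thesis
      by (simp add: B_def divide_less_eq)
  qed
  then have "\<not> negligible B"
    using \<open>open B\<close> by (intro open_not_negligible) auto
  then have e0: "e \<noteq> 0"
    by (auto simp: e_def negligible_iff_null_sets null_sets_completion_iff null_sets_def)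
  have "bounded B"
    unfolding B_eq by (rule bounded_subset[OF bounded_ball]) auto
  then have e_fin: "e \<noteq> top"
    unfolding e_def using emeasure_bounded_finite by (metis less_irrefl infinity_ennreal_def)
  \<comment> \<open>An orthogonal left factor of g drops out of the Gram matrix, so \<phi> commutes
    with left multiplication and transports the invariance of \<open>B\<close> and
    \<open>lborel\<close> to \<kappa>.\<close>
  define \<phi> where "\<phi> g = g ** cramer_inverse (w (transpose g ** g))" for g :: "'n sqmat"
  have gram_PD: "transpose g ** g \<in> PD" if "g \<in> B" for g
    using that by (intro PD_gram) (simp add: B_def invertible_det_nz)
  have \<phi>_orth: "orthogonal_matrix (\<phi> g)" if g: "g \<in> B" for g
  proof -
    define v c where "v = w (transpose g ** g)" and "c = cramer_inverse v"
    have vc: "v ** c = mat 1"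
      unfolding v_def c_def using invertible_w[OF gram_PD[OF g]]
      by (intro cramer_inverse) (simp add: invertible_det_nz)
    have "transpose (\<phi> g) ** \<phi> g = congr c (transpose g ** g)"
      by (simp add: \<phi>_def v_def c_def matrix_transpose_mul matrix_mul_assoc)
    also have "transpose g ** g = transpose v ** v"
      unfolding v_def using gram_w[OF gram_PD[OF g]] by simp
    also have "congr c (transpose v ** v) = transpose (v ** c) ** (v ** c)"
      by (simp add: matrix_transpose_mul matrix_mul_assoc)
    finally show ?thesis
      by (simp add: vc orthogonal_matrix)
  qed
  have \<phi>_left: "\<phi> (u ** g) = u ** \<phi> g" if "orthogonal_matrix u" for u g
    unfolding \<phi>_def orthogonal_gram[OF that] by (simp add: matrix_mul_assoc)
  let ?R = "restrict_space lborel B"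
  have \<phi>_meas [measurable]: "\<phi> \<in> ?R \<rightarrow>\<^sub>M O_space"
  proof (rule measurable_restrict_space2)
    show "\<phi> \<in> space ?R \<rightarrow> {k. orthogonal_matrix k}"
      using \<phi>_orth by (auto simp: space_restrict_space)
    have id [measurable]: "(\<lambda>g. g) \<in> borel_measurable ?R"
      by (rule measurable_restrict_space1) simp
    have "(\<lambda>g. transpose g ** g) \<in> ?R \<rightarrow>\<^sub>M PD_space"
      by (rule measurable_restrict_space2) (auto simp: space_restrict_space gram_PD)
    from measurable_compose[OF this w_borel]
    have [measurable]: "(\<lambda>g. w (transpose g ** g)) \<in> borel_measurable ?R" .
    show "\<phi> \<in> borel_measurable ?R"
      unfolding \<phi>_def by measurable
  qed
  define \<kappa> where "\<kappa> = distr (density ?R (\<lambda>_. inverse e)) O_space \<phi>"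
  have int: "(\<integral>\<^sup>+k. f k \<partial>\<kappa>) = inverse e * (\<integral>\<^sup>+g. f (\<phi> g) * indicator B g \<partial>lborel)"
    if [measurable]: "f \<in> borel_measurable O_space" for f
  proof -
    have "(\<integral>\<^sup>+k. f k \<partial>\<kappa>) = inverse e * (\<integral>\<^sup>+g. f (\<phi> g) \<partial>?R)"
      by (simp add: \<kappa>_def nn_integral_distr nn_integral_density nn_integral_cmult)
    then show ?thesis
      by (simp add: nn_integral_restrict_space)
  qed
  have meas: "(\<lambda>g. f (\<phi> g) * indicator B g) \<in> borel_measurable borel"
    if [measurable]: "f \<in> borel_measurable O_space" for f :: "'n sqmat \<Rightarrow> ennreal"
  proof -
    have "(\<lambda>g. f (\<phi> g)) \<in> borel_measurable (restrict_space lborel B)"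
      by measurable
    then show ?thesis
      by (subst (asm) borel_measurable_restrict_space_iff_ennreal) auto
  qed
  have "haar_orthogonal \<kappa>"
  proof (intro haar_orthogonal.intro haar_orthogonal_axioms.intro)
    show "sets \<kappa> = sets O_space"
      by (simp add: \<kappa>_def)
    have "emeasure \<kappa> (space \<kappa>) = (\<integral>\<^sup>+k. 1 \<partial>\<kappa>)"
      by simp
    also have "\<dots> = inverse e * e"
      by (subst int) (simp_all add: e_def)
    also have "\<dots> = 1"
      using e0 e_fin by (simp add: mult.commute ennreal_divide_self[unfolded divide_ennreal_def] less_top zero_less_iff_neq_zero)
    finally show "prob_space \<kappa>"
      by (rule prob_spaceI)
  next
    fix f :: "'n sqmat \<Rightarrow> ennreal" and u :: "'n sqmat"
    assume f [measurable]: "f \<in> borel_measurable O_space" and u: "orthogonal_matrix u"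
    have Lu: "(\<lambda>k. u ** k) \<in> O_space \<rightarrow>\<^sub>M O_space"
    proof (rule measurable_restrict_space2)
      show "(\<lambda>k. u ** k) \<in> borel_measurable O_space"
        by (rule measurable_restrict_space1) measurable
    qed (use u in \<open>auto simp: space_restrict_space orthogonal_matrix_mul\<close>)
    have "(\<integral>\<^sup>+k. f (u ** k) \<partial>\<kappa>) = inverse e * (\<integral>\<^sup>+g. f (u ** \<phi> g) * indicator B g \<partial>lborel)"
      by (rule int) (rule measurable_compose[OF Lu f])
    also have "(\<lambda>g. f (u ** \<phi> g) * indicator B g) = (\<lambda>g. f (\<phi> (u ** g)) * indicator B (u ** g))"
    proof
      fix g
      have "det u \<noteq> 0"
        using abs_det_orthogonal[OF u] by auto
      then have "u ** g \<in> B \<longleftrightarrow> g \<in> B"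
        by (simp add: B_def det_mul norm_orthogonal_mult[OF u])
      then show "f (u ** \<phi> g) * indicator B g = f (\<phi> (u ** g)) * indicator B (u ** g)"
        by (simp add: \<phi>_left[OF u] indicator_def)
    qed
    also have "(\<integral>\<^sup>+g. f (\<phi> (u ** g)) * indicator B (u ** g) \<partial>lborel) = (\<integral>\<^sup>+g. f (\<phi> g) * indicator B g \<partial>lborel)"
      by (rule nn_integral_lborel_orthogonal[OF u meas[OF f]])
    also have "inverse e * \<dots> = (\<integral>\<^sup>+k. f k \<partial>\<kappa>)"
      by (rule int[OF f, symmetric])
    finally show "(\<integral>\<^sup>+k. f (u ** k) \<partial>\<kappa>) = (\<integral>\<^sup>+k. f k \<partial>\<kappa>)" .
  qed
  then show ?thesis ..
qed

section \<open>Comparison of the two one-step laws\<close>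

lemma conj_measurable:
  "case_prod (\<lambda>k x. congr k x) \<in> O_space \<Otimes>\<^sub>M PD_space \<rightarrow>\<^sub>M (PD_space :: (real^'n^'n) measure)"
proof (rule measurable_restrict_space2)
  have [measurable]: "fst \<in> borel_measurable (O_space \<Otimes>\<^sub>M PD_space)"
    by (rule measurable_compose[OF measurable_fst measurable_restrict_space1]) simp
  show "case_prod (\<lambda>k x. congr k x) \<in> borel_measurable (O_space \<Otimes>\<^sub>M (PD_space :: (real^'n^'n) measure))"
    unfolding case_prod_beta' by measurable
qed (auto simp: space_pair_measure space_restrict_space PD_congruence orthogonal_matrix_invertible)

lemma O_invariant_nn_integral:
  assumes "O_invariant \<nu>" and f: "f \<in> borel_measurable PD_space" and k: "orthogonal_matrix k"
  shows "(\<integral>\<^sup>+x. f (congr k x) \<partial>\<nu>) = (\<integral>\<^sup>+x. f x \<partial>\<nu>)"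
proof -
  have eq: "distr \<nu> PD_space (\<lambda>x. congr k x) = \<nu>"
    using assms by (simp add: O_invariant_def)
  then have "sets \<nu> = sets PD_space"
    by (metis sets_distr)
  then have L: "(\<lambda>x. congr k x) \<in> \<nu> \<rightarrow>\<^sub>M PD_space"
    using measurable_congruence[OF orthogonal_matrix_invertible[OF k]] by (simp cong: measurable_cong_sets)
  have "f \<in> borel_measurable \<nu>"
    using f \<open>sets \<nu> = sets PD_space\<close> by (simp cong: measurable_cong_sets)
  then show ?thesis
    using nn_integral_distr[OF L, of f] by (simp add: eq)
qed

lemma O_invariant_sets: "O_invariant \<nu> \<Longrightarrow> sets \<nu> = sets PD_space"
  unfolding O_invariant_def by (metis orthogonal_matrix_id sets_distr)

locale gram_root_haar = gram_root w + haar_orthogonal \<kappa>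
  for w :: "'n::{finite,linorder} sqmat \<Rightarrow> 'n sqmat" and \<kappa> :: "'n sqmat measure"
begin

text \<open>Both integrands depend only on the orbit of \<open>transpose m ** m\<close> with \<open>m = w y ** k ** w x\<close>,
  which is also the orbit of \<open>m ** transpose m\<close>; the remaining orthogonal factors are absorbed by \<open>k\<close>.\<close>

lemma orbit_integral_commute:
  fixes F :: "'n sqmat \<Rightarrow> ennreal"
  assumes F: "F \<in> borel_measurable PD_space"
    and F_inv: "\<And>u z. orthogonal_matrix u \<Longrightarrow> z \<in> PD \<Longrightarrow> F (congr u z) = F z"
    and x: "x \<in> PD" and y: "y \<in> PD"
  shows "(\<integral>\<^sup>+k. F (T w x (congr k y)) \<partial>\<kappa>) = (\<integral>\<^sup>+k. F (T w y (congr k x)) \<partial>\<kappa>)"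
proof -
  define A where "A = w y"
  define B where "B = w x"
  have A: "transpose A ** A = y" "invertible A" and B: "transpose B ** B = x" "invertible B"
    by (auto simp: A_def B_def gram_w invertible_w x y)
  obtain v where v: "orthogonal_matrix v" "B ** transpose B = congr v (transpose B ** B)"
    by (rule gram_conjugate)
  obtain u where u: "orthogonal_matrix u" "A ** transpose A = congr u (transpose A ** A)"
    by (rule gram_conjugate)
  \<comment> \<open>\<open>transpose A\<close> and \<open>A ** u\<close> have the same Gram matrix
    \<open>A ** transpose A\<close>, so they differ by an orthogonal left factor
    \<open>t\<close>.\<close>
  have "transpose (transpose A) ** transpose A = transpose (A ** u) ** (A ** u)"
    using u(2) by (simp add: matrix_transpose_mul matrix_mul_assoc)
  then obtain t where t: "orthogonal_matrix t" "transpose A = t ** (A ** u)"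
    using A(2) u(1) by (elim equal_gram[rotated]) (auto intro: invertible_mult orthogonal_matrix_invertible)
  define \<Phi> where "\<Phi> k = F (congr (k ** A) x)" for k
  have \<Phi>: "\<Phi> \<in> borel_measurable O_space"
  proof -
    have "(\<lambda>k. k ** A) \<in> borel_measurable O_space"
      by (rule measurable_restrict_space1) measurable
    then have "(\<lambda>k. congr (k ** A) x) \<in> O_space \<rightarrow>\<^sub>M PD_space"
      using PD_congruence[OF x invertible_mult[OF orthogonal_matrix_invertible A(2)]]
      by (intro measurable_restrict_space2) (auto simp: space_restrict_space)
    from measurable_compose[OF this F] show ?thesis
      by (simp add: \<Phi>_def[abs_def])
  qed
  have "F (T w x (congr k y)) = \<Phi> (v ** transpose k ** t)" if k: "orthogonal_matrix k" for k
  proof -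
    define m where "m = A ** k ** B"
    have m: "invertible m"
      unfolding m_def by (intro invertible_mult A(2) B(2) orthogonal_matrix_invertible[OF k])
    obtain s where s: "orthogonal_matrix s" "m ** transpose m = congr s (transpose m ** m)"
      by (rule gram_conjugate)
    have "T w x (congr k y) = transpose m ** m"
      by (simp add: T_def m_def B_def[symmetric] A(1)[symmetric] matrix_transpose_mul matrix_mul_assoc)
    \<comment> \<open>\<open>F\<close> does not distinguish \<open>transpose m ** m\<close> from
      \<open>m ** transpose m\<close>. The latter can be rewritten with \<open>x\<close> in the
      middle and the root of \<open>y\<close> outside, which exchanges the two roles.\<close>
    then have "F (T w x (congr k y)) = F (m ** transpose m)"
      unfolding s(2) using F_inv[OF s(1) PD_gram[OF m]] by simp
    also have "m ** transpose m = A ** k ** (B ** transpose B) ** transpose k ** transpose A"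
      by (simp add: m_def matrix_transpose_mul matrix_mul_assoc)
    also have "\<dots> = A ** k ** transpose v ** x ** v ** transpose k ** transpose A"
      unfolding v(2) B(1) by (simp add: matrix_mul_assoc)
    also have "\<dots> = congr (v ** transpose k ** transpose A) x"
      by (simp add: matrix_transpose_mul matrix_mul_assoc)
    also have "v ** transpose k ** transpose A = v ** transpose k ** t ** A ** u"
      unfolding t(2) by (simp add: matrix_mul_assoc)
    also have "congr (v ** transpose k ** t ** A ** u) x =
        congr u (congr (v ** transpose k ** t ** A) x)"
      by (rule congr_congr[symmetric])
    also have "F \<dots> = \<Phi> (v ** transpose k ** t)"
      unfolding \<Phi>_def using k
      by (intro F_inv[OF u(1)] PD_congruence[OF x] invertible_mult A(2)
          orthogonal_matrix_invertible[OF v(1)] orthogonal_matrix_invertible[OF t(1)]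
          orthogonal_matrix_invertible[of "transpose k"]) simp
    finally show ?thesis .
  qed
  then have "(\<integral>\<^sup>+k. F (T w x (congr k y)) \<partial>\<kappa>) = (\<integral>\<^sup>+k. \<Phi> (v ** transpose k ** t) \<partial>\<kappa>)"
    by (intro nn_integral_cong) (simp add: space_haar)
  also have "\<dots> = (\<integral>\<^sup>+k. \<Phi> (v ** k ** t) \<partial>\<kappa>)"
  proof (rule haar_transpose)
    have id: "(\<lambda>k. k) \<in> O_space \<rightarrow>\<^sub>M O_space" and c: "\<And>u. orthogonal_matrix u \<Longrightarrow> (\<lambda>_. u) \<in> O_space \<rightarrow>\<^sub>M O_space"
      by (auto simp: space_restrict_space)
    show "(\<lambda>k. \<Phi> (v ** k ** t)) \<in> borel_measurable O_space"
      using v t by (intro measurable_compose[OF _ \<Phi>] O_space_mult id c)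
  qed
  also have "\<dots> = (\<integral>\<^sup>+k. \<Phi> (k ** t) \<partial>\<kappa>)"
  proof (rule haar_left[OF _ v(1), of "\<lambda>k. \<Phi> (k ** t)"])
    have id: "(\<lambda>k. k) \<in> O_space \<rightarrow>\<^sub>M O_space" and c: "(\<lambda>_. t) \<in> O_space \<rightarrow>\<^sub>M O_space"
      using t by (auto simp: space_restrict_space)
    show "(\<lambda>k. \<Phi> (k ** t)) \<in> borel_measurable O_space"
      by (rule measurable_compose[OF O_space_mult[OF id c] \<Phi>])
  qed
  also have "\<dots> = (\<integral>\<^sup>+k. \<Phi> k \<partial>\<kappa>)"
    by (rule haar_right[OF \<Phi> t(1)])
  also have "\<dots> = (\<integral>\<^sup>+k. F (T w y (congr k x)) \<partial>\<kappa>)"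
    by (simp add: \<Phi>_def T_def A_def matrix_transpose_mul matrix_mul_assoc)
  finally show ?thesis .
qed

text \<open>\<open>orbit_integral_commute\<close> requires an invariant integrand; averaging
  produces one from an arbitrary test function.\<close>

definition orbit_average :: "('n sqmat \<Rightarrow> ennreal) \<Rightarrow> 'n sqmat \<Rightarrow> ennreal" where
  "orbit_average f z = (\<integral>\<^sup>+l. f (congr l z) \<partial>\<kappa>)"

lemma orbit_average_measurable:
  assumes f: "f \<in> borel_measurable PD_space"
  shows "orbit_average f \<in> borel_measurable PD_space"
proof -
  have "(\<lambda>(z, l). f (congr l z)) \<in> borel_measurable (PD_space \<Otimes>\<^sub>M O_space)"
    using measurable_compose[OF measurable_compose[OF measurable_pair_swap' conj_measurable] f]
    by (simp add: case_prod_beta')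
  then have "(\<lambda>(z, l). f (congr l z)) \<in> borel_measurable (PD_space \<Otimes>\<^sub>M \<kappa>)"
    by (simp cong: measurable_cong_sets sets_pair_measure_cong add: sets_haar)
  then show ?thesis
    unfolding orbit_average_def by (rule borel_measurable_nn_integral)
qed

lemma orbit_average_invariant:
  assumes f: "f \<in> borel_measurable PD_space" and u: "orthogonal_matrix u" and z: "z \<in> PD"
  shows "orbit_average f (congr u z) = orbit_average f z"
proof -
  have "(\<lambda>l. f (congr l z)) \<in> borel_measurable O_space"
  proof -
    have "(\<lambda>l. (l, z)) \<in> O_space \<rightarrow>\<^sub>M O_space \<Otimes>\<^sub>M PD_space"
      using z by (intro measurable_Pair) (auto simp: space_restrict_space)
    from measurable_compose[OF measurable_compose[OF this conj_measurable] f] show ?thesis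
      by simp
  qed
  from haar_left[OF this u] show ?thesis
    by (simp add: orbit_average_def matrix_transpose_mul matrix_mul_assoc)
qed

text \<open>Two independent rotations are inserted: one outside, since the law of
  \<open>T w y x\<close> is O_d-invariant, and one on \<open>x\<close>, since \<rho> is. The outer
  one replaces \<open>f\<close> by its average, the inner one supplies the integral over k in which
  the exchange takes place.\<close>

lemma nn_integral_T_orbit_average:
  assumes \<eta>: "prob_space \<eta>" "O_invariant \<eta>" and \<rho>: "prob_space \<rho>" "O_invariant \<rho>"
    and f: "f \<in> borel_measurable PD_space"
  shows "(\<integral>\<^sup>+y. \<integral>\<^sup>+x. f (T w y x) \<partial>\<rho> \<partial>\<eta>) =
    (\<integral>\<^sup>+y. \<integral>\<^sup>+x. \<integral>\<^sup>+k. orbit_average f (T w y (congr k x)) \<partial>\<kappa> \<partial>\<rho> \<partial>\<eta>)"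
proof -
  interpret \<eta>: prob_space \<eta> by fact
  interpret \<rho>: prob_space \<rho> by fact
  interpret \<eta>\<rho>: pair_sigma_finite \<eta> \<rho> ..
  interpret \<kappa>\<eta>: pair_sigma_finite \<kappa> \<eta> ..
  interpret \<kappa>\<rho>: pair_sigma_finite \<kappa> \<rho> ..
  have s\<eta> [measurable_cong]: "sets \<eta> = sets PD_space" and s\<rho> [measurable_cong]: "sets \<rho> = sets PD_space"
    using \<eta> \<rho> O_invariant_sets by auto
  have sp: "space \<eta> = PD" "space \<rho> = PD"
    using sets_eq_imp_space_eq[OF s\<eta>] sets_eq_imp_space_eq[OF s\<rho>] by (auto simp: space_restrict_space)
  have Tm: "(\<lambda>p. T w (g p) (h p)) \<in> N \<rightarrow>\<^sub>M PD_space" if "g \<in> N \<rightarrow>\<^sub>M PD_space" "h \<in> N \<rightarrow>\<^sub>M PD_space"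
    for N :: "'b measure" and g h
    using measurable_compose[OF measurable_Pair[OF that] T_measurable] by simp
  have Cm: "(\<lambda>p. transpose (g p) ** h p ** g p) \<in> N \<rightarrow>\<^sub>M PD_space" if "g \<in> N \<rightarrow>\<^sub>M O_space" "h \<in> N \<rightarrow>\<^sub>M PD_space"
    for N :: "'b measure" and g h
    using measurable_compose[OF measurable_Pair[OF that] conj_measurable] by simp
  \<comment> \<open>Conjugation by \<open>l\<close> replaces the root \<open>w y\<close> by
    \<open>w y ** l\<close>, a root of \<open>congr l y\<close> and hence of the form
    \<open>u ** w (congr l y)\<close>. At fixed \<open>y\<close> the factor \<open>u\<close> is
    absorbed by \<rho>; afterwards \<open>l\<close> is absorbed by \<eta>.\<close>
  have conj_step: "(\<integral>\<^sup>+y. \<integral>\<^sup>+x. f (transpose l ** T w y x ** l) \<partial>\<rho> \<partial>\<eta>) = (\<integral>\<^sup>+y. \<integral>\<^sup>+x. f (T w y x) \<partial>\<rho> \<partial>\<eta>)"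
    if l: "orthogonal_matrix l" for l
  proof -
    define h where "h y = (\<integral>\<^sup>+x. f (T w y x) \<partial>\<rho>)" for y
    have "(\<lambda>p. f (T w (fst p) (snd p))) \<in> borel_measurable (PD_space \<Otimes>\<^sub>M \<rho>)"
      by (rule measurable_compose[OF Tm f]) measurable
    then have h: "h \<in> borel_measurable PD_space"
      unfolding h_def by (intro \<rho>.borel_measurable_nn_integral) (simp add: case_prod_beta')
    have "(\<integral>\<^sup>+x. f (transpose l ** T w y x ** l) \<partial>\<rho>) = h (congr l y)" if y: "y \<in> PD" for y
    proof -
      let ?y = "congr l y"
      have y': "?y \<in> PD"
        using y l by (intro PD_congruence orthogonal_matrix_invertible)
      have "transpose (w y ** l) ** (w y ** l) = congr l (transpose (w y) ** w y)"
        by (simp add: matrix_transpose_mul matrix_mul_assoc)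
      also have "\<dots> = transpose (w ?y) ** w ?y"
        by (simp only: gram_w[OF y] gram_w[OF y'])
      finally obtain u where u: "orthogonal_matrix u" "w y ** l = u ** w ?y"
        by (rule equal_gram[OF invertible_w[OF y']])
      have "transpose l ** T w y x ** l = T w ?y (congr u x)" for x
      proof -
        have "transpose l ** T w y x ** l = congr (w y ** l) x"
          by (simp add: T_def matrix_transpose_mul matrix_mul_assoc)
        then show ?thesis
          unfolding u(2) by (simp add: T_def matrix_transpose_mul matrix_mul_assoc)
      qed
      then have "(\<integral>\<^sup>+x. f (transpose l ** T w y x ** l) \<partial>\<rho>) = (\<integral>\<^sup>+x. f (T w ?y (congr u x)) \<partial>\<rho>)"
        by simp
      also have "\<dots> = h ?y"
        unfolding h_def
      proof (rule O_invariant_nn_integral[OF \<rho>(2) _ u(1)])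
        show "(\<lambda>x. f (T w ?y x)) \<in> borel_measurable PD_space"
          by (rule measurable_compose[OF Tm f]) (use y' in \<open>auto simp: space_restrict_space\<close>)
      qed
      finally show ?thesis .
    qed
    then have "(\<integral>\<^sup>+y. \<integral>\<^sup>+x. f (transpose l ** T w y x ** l) \<partial>\<rho> \<partial>\<eta>) = (\<integral>\<^sup>+y. h (congr l y) \<partial>\<eta>)"
      by (intro nn_integral_cong) (simp add: sp)
    also have "\<dots> = (\<integral>\<^sup>+y. h y \<partial>\<eta>)"
      by (rule O_invariant_nn_integral[OF \<eta>(2) h l])
    finally show ?thesis
      by (simp add: h_def)
  qed
  let ?F = "orbit_average f"
  note F = orbit_average_measurable[OF f]
  have "(\<integral>\<^sup>+y. \<integral>\<^sup>+x. f (T w y x) \<partial>\<rho> \<partial>\<eta>) = (\<integral>\<^sup>+l. \<integral>\<^sup>+y. \<integral>\<^sup>+x. f (transpose l ** T w y x ** l) \<partial>\<rho> \<partial>\<eta> \<partial>\<kappa>)"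
  proof -
    have "(\<integral>\<^sup>+l. \<integral>\<^sup>+y. \<integral>\<^sup>+x. f (transpose l ** T w y x ** l) \<partial>\<rho> \<partial>\<eta> \<partial>\<kappa>) =
        (\<integral>\<^sup>+l. \<integral>\<^sup>+y. \<integral>\<^sup>+x. f (T w y x) \<partial>\<rho> \<partial>\<eta> \<partial>\<kappa>)"
      by (rule nn_integral_cong) (simp add: space_haar conj_step)
    then show ?thesis
      by (simp add: emeasure_space_1)
  qed
  also have "\<dots> = (\<integral>\<^sup>+y. \<integral>\<^sup>+l. \<integral>\<^sup>+x. f (transpose l ** T w y x ** l) \<partial>\<rho> \<partial>\<kappa> \<partial>\<eta>)"
  proof (rule \<kappa>\<eta>.Fubini'[symmetric])
    have "(\<lambda>q. f (transpose (fst (fst q)) ** T w (snd (fst q)) (snd q) ** fst (fst q))) \<in> borel_measurable ((\<kappa> \<Otimes>\<^sub>M \<eta>) \<Otimes>\<^sub>M \<rho>)"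
      by (rule measurable_compose[OF Cm[OF _ Tm] f]) measurable
    then have "(\<lambda>p. \<integral>\<^sup>+x. f (transpose (fst p) ** T w (snd p) x ** fst p) \<partial>\<rho>) \<in> borel_measurable (\<kappa> \<Otimes>\<^sub>M \<eta>)"
      by (intro \<rho>.borel_measurable_nn_integral) (simp add: case_prod_beta')
    then show "(\<lambda>(l, y). \<integral>\<^sup>+x. f (transpose l ** T w y x ** l) \<partial>\<rho>) \<in> borel_measurable (\<kappa> \<Otimes>\<^sub>M \<eta>)"
      by (simp add: case_prod_beta')
  qed
  also have "\<dots> = (\<integral>\<^sup>+y. \<integral>\<^sup>+x. ?F (T w y x) \<partial>\<rho> \<partial>\<eta>)"
  proof (rule nn_integral_cong)
    fix y assume y: "y \<in> space \<eta>"
    have yc: "(\<lambda>_. y) \<in> \<kappa> \<Otimes>\<^sub>M \<rho> \<rightarrow>\<^sub>M PD_space"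
      using y by (simp add: sp space_restrict_space)
    show "(\<integral>\<^sup>+l. \<integral>\<^sup>+x. f (transpose l ** T w y x ** l) \<partial>\<rho> \<partial>\<kappa>) = (\<integral>\<^sup>+x. ?F (T w y x) \<partial>\<rho>)"
      unfolding orbit_average_def
    proof (rule \<kappa>\<rho>.Fubini'[symmetric])
      have "(\<lambda>p. f (transpose (fst p) ** T w y (snd p) ** fst p)) \<in> borel_measurable (\<kappa> \<Otimes>\<^sub>M \<rho>)"
        by (rule measurable_compose[OF Cm[OF _ Tm[OF yc]] f]) measurable
      then show "(\<lambda>(l, x). f (transpose l ** T w y x ** l)) \<in> borel_measurable (\<kappa> \<Otimes>\<^sub>M \<rho>)"
        by (simp add: case_prod_beta')
    qed
  qed
  also have "\<dots> = (\<integral>\<^sup>+y. \<integral>\<^sup>+x. \<integral>\<^sup>+k. ?F (T w y (congr k x)) \<partial>\<kappa> \<partial>\<rho> \<partial>\<eta>)"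
  proof (rule nn_integral_cong)
    fix y assume y: "y \<in> space \<eta>"
    have yc: "(\<lambda>_. y) \<in> \<kappa> \<Otimes>\<^sub>M \<rho> \<rightarrow>\<^sub>M PD_space"
      using y by (simp add: sp space_restrict_space)
    have "(\<lambda>x. ?F (T w y x)) \<in> borel_measurable PD_space"
      by (rule measurable_compose[OF Tm F]) (use y in \<open>auto simp: sp space_restrict_space\<close>)
    note inv = O_invariant_nn_integral[OF \<rho>(2) this]
    have "(\<integral>\<^sup>+k. \<integral>\<^sup>+x. ?F (T w y (congr k x)) \<partial>\<rho> \<partial>\<kappa>) = (\<integral>\<^sup>+k. \<integral>\<^sup>+x. ?F (T w y x) \<partial>\<rho> \<partial>\<kappa>)"
      by (rule nn_integral_cong) (simp add: space_haar inv)
    then have "(\<integral>\<^sup>+x. ?F (T w y x) \<partial>\<rho>) = (\<integral>\<^sup>+k. \<integral>\<^sup>+x. ?F (T w y (congr k x)) \<partial>\<rho> \<partial>\<kappa>)"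
      by (simp add: emeasure_space_1)
    also have "\<dots> = (\<integral>\<^sup>+x. \<integral>\<^sup>+k. ?F (T w y (congr k x)) \<partial>\<kappa> \<partial>\<rho>)"
    proof (rule \<kappa>\<rho>.Fubini'[symmetric])
      have "(\<lambda>p. ?F (T w y (congr (fst p) (snd p)))) \<in> borel_measurable (\<kappa> \<Otimes>\<^sub>M \<rho>)"
        by (rule measurable_compose[OF Tm[OF yc Cm] F]) measurable
      then show "(\<lambda>(k, x). ?F (T w y (congr k x))) \<in> borel_measurable (\<kappa> \<Otimes>\<^sub>M \<rho>)"
        by (simp add: case_prod_beta')
    qed
    finally show "(\<integral>\<^sup>+x. ?F (T w y x) \<partial>\<rho>) = (\<integral>\<^sup>+x. \<integral>\<^sup>+k. ?F (T w y (congr k x)) \<partial>\<kappa> \<partial>\<rho>)" .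
  qed
  finally show ?thesis .
qed

text \<open>After averaging, the inner integrals over \<kappa> agree for each pair of x and y.
  Tonelli then exchanges the two laws, and the averaging is undone with \<eta> and \<rho>
  swapped.\<close>

theorem nn_integral_T_commute:
  assumes \<eta>: "prob_space \<eta>" "O_invariant \<eta>" and \<rho>: "prob_space \<rho>" "O_invariant \<rho>"
    and f: "f \<in> borel_measurable PD_space"
  shows "(\<integral>\<^sup>+y. \<integral>\<^sup>+x. f (T w y x) \<partial>\<rho> \<partial>\<eta>) = (\<integral>\<^sup>+y. \<integral>\<^sup>+x. f (T w x y) \<partial>\<rho> \<partial>\<eta>)"
proof -
  interpret \<eta>: prob_space \<eta> by fact
  interpret \<rho>: prob_space \<rho> by fact
  interpret \<rho>\<eta>: pair_sigma_finite \<rho> \<eta> ..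
  have s\<eta> [measurable_cong]: "sets \<eta> = sets PD_space" and s\<rho> [measurable_cong]: "sets \<rho> = sets PD_space"
    using \<eta> \<rho> O_invariant_sets by auto
  have sp: "space \<eta> = PD" "space \<rho> = PD"
    using sets_eq_imp_space_eq[OF s\<eta>] sets_eq_imp_space_eq[OF s\<rho>] by (auto simp: space_restrict_space)
  let ?G = "\<lambda>x y. \<integral>\<^sup>+k. orbit_average f (T w x (congr k y)) \<partial>\<kappa>"
  have T': "case_prod (T w) \<in> \<rho> \<Otimes>\<^sub>M \<eta> \<rightarrow>\<^sub>M PD_space"
    using T_measurable by (simp cong: measurable_cong_sets sets_pair_measure_cong add: s\<rho> s\<eta>)
  have "(\<integral>\<^sup>+y. \<integral>\<^sup>+x. f (T w y x) \<partial>\<rho> \<partial>\<eta>) = (\<integral>\<^sup>+y. \<integral>\<^sup>+x. ?G y x \<partial>\<rho> \<partial>\<eta>)"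
    by (rule nn_integral_T_orbit_average[OF \<eta> \<rho> f])
  also have "\<dots> = (\<integral>\<^sup>+y. \<integral>\<^sup>+x. ?G x y \<partial>\<rho> \<partial>\<eta>)"
    by (intro nn_integral_cong orbit_integral_commute orbit_average_measurable[OF f] orbit_average_invariant[OF f])
      (auto simp: sp)
  also have "\<dots> = (\<integral>\<^sup>+x. \<integral>\<^sup>+y. ?G x y \<partial>\<eta> \<partial>\<rho>)"
  proof (rule \<rho>\<eta>.Fubini')
    have "(\<lambda>q. T w (fst (fst q)) (transpose (snd q) ** snd (fst q) ** snd q)) \<in> (\<rho> \<Otimes>\<^sub>M \<eta>) \<Otimes>\<^sub>M \<kappa> \<rightarrow>\<^sub>M PD_space"
    proof -
      have 1: "(\<lambda>q. (snd q, snd (fst q))) \<in> (\<rho> \<Otimes>\<^sub>M \<eta>) \<Otimes>\<^sub>M \<kappa> \<rightarrow>\<^sub>M O_space \<Otimes>\<^sub>M PD_space"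
        by measurable
      have 2: "(\<lambda>q. (fst (fst q), transpose (snd q) ** snd (fst q) ** snd q)) \<in> (\<rho> \<Otimes>\<^sub>M \<eta>) \<Otimes>\<^sub>M \<kappa> \<rightarrow>\<^sub>M PD_space \<Otimes>\<^sub>M PD_space"
        using measurable_compose[OF 1 conj_measurable] by (intro measurable_Pair) (measurable, simp)
      show ?thesis
        using measurable_compose[OF 2 T_measurable] by simp
    qed
    from measurable_compose[OF this orbit_average_measurable[OF f]]
    show "(\<lambda>(x, y). ?G x y) \<in> borel_measurable (\<rho> \<Otimes>\<^sub>M \<eta>)"
      unfolding case_prod_beta' by (intro borel_measurable_nn_integral) (simp add: case_prod_beta')
  qed
  also have "\<dots> = (\<integral>\<^sup>+x. \<integral>\<^sup>+y. f (T w x y) \<partial>\<eta> \<partial>\<rho>)"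
    by (rule nn_integral_T_orbit_average[OF \<rho> \<eta> f, symmetric])
  also have "\<dots> = (\<integral>\<^sup>+y. \<integral>\<^sup>+x. f (T w x y) \<partial>\<rho> \<partial>\<eta>)"
    using measurable_compose[OF T' f] by (intro \<rho>\<eta>.Fubini'[symmetric]) (simp add: case_prod_beta')
  finally show ?thesis .
qed

end

section \<open>Equality of the one-step laws from invariant initial distributions\<close>

context gram_root_haar
begin

lemma O_invariant_mat_1_add:
  fixes \<pi> :: "'n sqmat measure"
  assumes "O_invariant \<pi>"
  shows "O_invariant (distr \<pi> PD_space (\<lambda>z. mat 1 + z))"
  unfolding O_invariant_def
proof (intro allI impI)
  fix k :: "'n sqmat" assume k: "orthogonal_matrix k"
  note sets_\<pi> = O_invariant_sets[OF assms]
  have add: "(\<lambda>z. mat 1 + z) \<in> \<pi> \<rightarrow>\<^sub>M PD_space"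
    using mat_1_add_measurable sets_\<pi> by (simp cong: measurable_cong_sets)
  have conj: "(\<lambda>x. congr k x) \<in> PD_space \<rightarrow>\<^sub>M PD_space"
    "(\<lambda>x. congr k x) \<in> \<pi> \<rightarrow>\<^sub>M PD_space"
    using measurable_congruence[OF orthogonal_matrix_invertible[OF k]] sets_\<pi>
    by (simp_all cong: measurable_cong_sets)
  have "congr k (mat 1 + z) = mat 1 + congr k z" for z
    using k by (simp add: matrix_add_ldistrib matrix_add_rdistrib orthogonal_matrix_def)
  then have "distr (distr \<pi> PD_space (\<lambda>z. mat 1 + z)) PD_space (\<lambda>x. congr k x) =
      distr (distr \<pi> PD_space (\<lambda>x. congr k x)) PD_space (\<lambda>z. mat 1 + z)"
    by (simp add: distr_distr[OF conj(1) add] distr_distr[OF mat_1_add_measurable conj(2)] comp_def)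
  also have "distr \<pi> PD_space (\<lambda>x. congr k x) = \<pi>"
    using assms k by (simp add: O_invariant_def)
  finally show "distr (distr \<pi> PD_space (\<lambda>z. mat 1 + z)) PD_space (\<lambda>x. congr k x) =
      distr \<pi> PD_space (\<lambda>z. mat 1 + z)" .
qed

text \<open>On a set \<open>A\<close> both laws are double integrals of its indicator over \<rho>
  and the law \<eta> of I + z, and these are the two sides of
  \<open>nn_integral_T_commute\<close>.\<close>

theorem bind_xi_eq_bind_xi':
  assumes \<pi>: "prob_space \<pi>" "O_invariant \<pi>" and \<rho>: "prob_space \<rho>" "O_invariant \<rho>"
  shows "\<pi> \<bind> (\<lambda>z. distr \<rho> PD_space (\<lambda>x. T w x (mat 1 + z))) =
    \<pi> \<bind> (\<lambda>z. distr \<rho> PD_space (T w (mat 1 + z)))" (is "?lhs = ?rhs")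
proof -
  interpret \<pi>: prob_space \<pi> by fact
  interpret \<rho>: prob_space \<rho> by fact
  note s\<pi> = O_invariant_sets[OF \<pi>(2)] and s\<rho> = O_invariant_sets[OF \<rho>(2)]
  define \<eta> where "\<eta> = distr \<pi> PD_space (\<lambda>z. mat 1 + z)"
  have add: "(\<lambda>z. mat 1 + z) \<in> \<pi> \<rightarrow>\<^sub>M PD_space"
    using mat_1_add_measurable s\<pi> by (simp cong: measurable_cong_sets)
  have \<eta>: "prob_space \<eta>" "O_invariant \<eta>"
    unfolding \<eta>_def by (rule \<pi>.prob_space_distr[OF add] O_invariant_mat_1_add[OF \<pi>(2)])+
  have bind: "emeasure (\<pi> \<bind> (\<lambda>z. distr \<rho> PD_space (F (mat 1 + z)))) A =
      (\<integral>\<^sup>+y. \<integral>\<^sup>+x. indicator A (F y x) \<partial>\<rho> \<partial>\<eta>)"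
    if F: "case_prod F \<in> PD_space \<Otimes>\<^sub>M PD_space \<rightarrow>\<^sub>M PD_space" and A: "A \<in> sets PD_space"
    for F :: "'n sqmat \<Rightarrow> 'n sqmat \<Rightarrow> 'n sqmat" and A
  proof -
    note F1 = step_measurable[OF F]
    have K: "(\<lambda>z. distr \<rho> PD_space (F (mat 1 + z))) \<in> \<pi> \<rightarrow>\<^sub>M subprob_algebra PD_space"
      using kernel_measurable[OF F1 \<rho>(1) s\<rho>] s\<pi> by (simp cong: measurable_cong_sets)
    have h: "(\<lambda>y. \<integral>\<^sup>+x. indicator A (F y x) \<partial>\<rho>) \<in> borel_measurable PD_space"
    proof (rule \<rho>.borel_measurable_nn_integral)
      have "(\<lambda>p. indicator A (case_prod F p) :: ennreal) \<in> borel_measurable (PD_space \<Otimes>\<^sub>M PD_space)"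
        by (rule measurable_compose[OF F]) (use A in simp)
      then show "(\<lambda>(y, x). indicator A (F y x) :: ennreal) \<in> borel_measurable (PD_space \<Otimes>\<^sub>M \<rho>)"
        unfolding case_prod_beta' measurable_cong_sets[OF sets_pair_measure_cong[OF refl s\<rho>] refl] .
    qed
    have "emeasure (\<pi> \<bind> (\<lambda>z. distr \<rho> PD_space (F (mat 1 + z)))) A =
        (\<integral>\<^sup>+z. emeasure (distr \<rho> PD_space (F (mat 1 + z))) A \<partial>\<pi>)"
      using \<pi>.not_empty by (rule emeasure_bind[OF _ K A])
    also have "\<dots> = (\<integral>\<^sup>+z. \<integral>\<^sup>+x. indicator A (F (mat 1 + z) x) \<partial>\<rho> \<partial>\<pi>)"
    proof (rule nn_integral_cong)
      fix z assume "z \<in> space \<pi>"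
      then have "z \<in> space PD_space"
        using sets_eq_imp_space_eq[OF s\<pi>] by simp
      from measurable_compose_Pair1[OF this F1]
      have [measurable]: "F (mat 1 + z) \<in> \<rho> \<rightarrow>\<^sub>M PD_space"
        using s\<rho> by (simp cong: measurable_cong_sets)
      show "emeasure (distr \<rho> PD_space (F (mat 1 + z))) A = (\<integral>\<^sup>+x. indicator A (F (mat 1 + z) x) \<partial>\<rho>)"
        using A by (simp add: nn_integral_distr flip: nn_integral_indicator)
    qed
    also have "\<dots> = (\<integral>\<^sup>+y. \<integral>\<^sup>+x. indicator A (F y x) \<partial>\<rho> \<partial>\<eta>)"
      unfolding \<eta>_def using nn_integral_distr[OF add, of "\<lambda>y. \<integral>\<^sup>+x. indicator A (F y x) \<partial>\<rho>"] h by simp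
    finally show ?thesis .
  qed
  show ?thesis
  proof (rule measure_eqI)
    have "sets (\<pi> \<bind> (\<lambda>z. distr \<rho> PD_space (F z))) = sets PD_space" for F :: "'n sqmat \<Rightarrow> 'n sqmat \<Rightarrow> 'n sqmat"
      using \<pi>.not_empty by (subst sets_bind) auto
    then show "sets ?lhs = sets ?rhs"
      by simp
  next
    fix A assume "A \<in> sets ?lhs"
    then have A: "A \<in> sets PD_space"
      using \<pi>.not_empty by (subst (asm) sets_bind) auto
    show "emeasure ?lhs A = emeasure ?rhs A"
      unfolding bind[OF T_measurable A] bind[OF T_flip_measurable A]
      by (rule nn_integral_T_commute[OF \<eta> \<rho>, symmetric]) (use A in simp)
  qed
qed

end

theorem corollary5p6:
  fixes w :: "real^'n::{finite,linorder}^'n::{finite,linorder} \<Rightarrow> real^'n::{finite,linorder}^'n::{finite,linorder}"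
    and \<alpha> \<beta> :: real
    and M :: "'w measure"
    and X :: "nat \<Rightarrow> 'w \<Rightarrow> real^'n::{finite,linorder}^'n::{finite,linorder}"
  assumes "\<alpha> > (real CARD('n) - 1) / 2"
    and "\<beta> - \<alpha> > (real CARD('n) - 1) / 2"
    and "w \<in> PD_space \<rightarrow>\<^sub>M GL_space"
    and "\<And>x. x \<in> PD \<Longrightarrow> x = transpose (w x) ** w x"
    and "prob_space M"
    and "prob_space.indep_vars M (\<lambda>_. PD_space) X {1..}"
    and "\<And>n. n \<ge> 1 \<Longrightarrow> distr M PD_space (X n) = BetaII \<alpha> \<beta>"
  shows "(\<forall>\<pi>. O_invariant \<pi> \<and> stationary_distribution M PD_space (xi w X) \<pi>
               \<longleftrightarrow> \<pi> = BetaII \<alpha> (\<beta> - \<alpha>)) \<and>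
         (\<forall>\<pi>. O_invariant \<pi> \<and> stationary_distribution M PD_space (xi' w X) \<pi>
               \<longleftrightarrow> \<pi> = BetaII \<alpha> (\<beta> - \<alpha>))"
proof -
  interpret gram_root w
    by (rule gram_root.intro) (rule assms(3), rule assms(4)[symmetric])
  obtain \<kappa> :: "'n sqmat measure" where \<kappa>: "haar_orthogonal \<kappa>"
    using haar_orthogonal_exists ..
  interpret gram_root_haar w \<kappa>
    using \<kappa> by (intro gram_root_haar.intro gram_root_axioms)
  have \<rho>: "prob_space (BetaII \<alpha> \<beta> :: 'n sqmat measure)"
    using prob_space_BetaII[OF assms(1) parameter_sum[OF assms(1,2)]] by simp
  have xi: "stationary_distribution M PD_space (xi w X) \<pi> \<longleftrightarrow> prob_space \<pi> \<and> sets \<pi> = sets PD_space \<and>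
      \<pi> \<bind> (\<lambda>z. distr (BetaII \<alpha> \<beta>) PD_space (\<lambda>x. T w x (mat 1 + z))) = \<pi>" for \<pi>
    by (rule stationary_distribution_iff_one_step[OF assms(5) step_measurable[OF T_flip_measurable] assms(6,7)]) simp_all
  have xi': "stationary_distribution M PD_space (xi' w X) \<pi> \<longleftrightarrow> \<pi> = BetaII \<alpha> (\<beta> - \<alpha>)" for \<pi>
    unfolding xi'_one_step_iff[OF assms(1,2), symmetric]
    by (rule stationary_distribution_iff_one_step[OF assms(5) step_measurable[OF T_measurable] assms(6,7)]) simp_all
  \<comment> \<open>For O_d-invariant \<pi> the two one-step laws coincide, so \<pi> is fixed by one
    kernel iff it is fixed by the other; this carries the characterisation for \<xi>' over to
    \<xi>.\<close>
  have "O_invariant \<pi> \<and> stationary_distribution M PD_space (xi w X) \<pi> \<longleftrightarrow>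
      O_invariant \<pi> \<and> stationary_distribution M PD_space (xi' w X) \<pi>" for \<pi>
    unfolding xi xi' xi'_one_step_iff[OF assms(1,2), symmetric]
    using bind_xi_eq_bind_xi'[OF _ _ \<rho> BetaII_O_invariant] by metis
  then show ?thesis
    using xi' BetaII_O_invariant by metis
qed

end
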